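(* For any positive concave function $f$ on $(0,\infty)$ and any $\alpha>0$, $$\widetilde u_f(s,t)=s\wedge t+f(t),\qquad s,t>0,$$ is the kernel of an $\alpha$-permanental process $\widetilde Z_{\alpha,f}=\{\widetilde Z_{\alpha,f}(t),t>0\}$, and (for the version with continuous sample paths on $(0,\infty)$) $$1\le\limsup_{t\to\infty}\frac{\widetilde Z_{\alpha,f}(t)}{t\log\log t}\le1+C_0\qquad a.s.,$$ where $C_0=\lim_{t\to\infty}f(t)/t$, which is necessarily finite. If $f$ is a potential for $\widetilde B$ of a function $h\in L^1_+(0,\infty)$, where $\widetilde B$ is Brownian motion on $(0,\infty)$ killed the first time it hits $0$, then $f(t)=o(t)$ (as $t\to\infty$) and $$\limsup_{t\to\infty}\frac{\widetilde Z_{\alpha,f}(t)}{t\log\log t}=1\qquad a.s.$$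
   Context: For $\alpha>0$, a random vector $(X_1,\dots,X_n)$ with nonnegative components is $\alpha$-permanental with kernel $U$ (a real $n\times n$ matrix) if $E\big(e^{-\sum_{i=1}^n s_iX_i}\big)=|I+US|^{-\alpha}$ for every diagonal matrix $S$ with positive diagonal entries $s_1,\dots,s_n$, where $|\cdot|$ denotes the determinant. A stochastic process $\{X_\alpha(t),t\in\mathcal T\}$ is an $\alpha$-permanental process with kernel $\{u(s,t),s,t\in\mathcal T\}$ if for all $t_1,\dots,t_n\in\mathcal T$ the vector $(X_\alpha(t_1),\dots,X_\alpha(t_n))$ is $\alpha$-permanental with kernel $\{u(t_i,t_j)\}_{i,j=1}^n$. $\widetilde B$ has state space $(0,\infty)$ and potential densities $2(x\wedge y)$, $x,y>0$, with respect to Lebesgue measure; $f$ is a potential for $\widetilde B$ of $h\in L^1_+(0,\infty)$ (the nonnegative functions in $L^1(0,\infty)$) if $f(x)=\int_0^\infty 2(x\wedge y)h(y)\,dy$. *)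

theory Defs
  imports
    "HOL-Probability.Probability"
    "HOL-Library.Landau_Symbols"
    "Jordan_Normal_Form.Determinant"
begin

(* The dimension n varies, so matrices are those of Jordan_Normal_Form and a vector of
   length n is a function on nat whose values below n matter. The requirement implies
   that det (I + U S) is positive: the left-hand side is positive whereas 0 powr a = 0, so
   the determinant, which is continuous in s and tends to 1 as s tends to 0, never vanishes.
   Hence the value of powr at negative bases plays no role. *)
definition permanental_vector ::
  "'w measure \<Rightarrow> real \<Rightarrow> nat \<Rightarrow> real mat \<Rightarrow> (nat \<Rightarrow> 'w \<Rightarrow> real) \<Rightarrow> bool" where
  "permanental_vector M \<alpha> n U X \<longleftrightarrow>
     prob_space M \<and> \<alpha> > 0 \<and> U \<in> carrier_mat n n \<and>
     (\<forall>i<n. X i \<in> borel_measurable M \<and> (\<forall>\<omega>\<in>space M. 0 \<le> X i \<omega>)) \<and>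
     (\<forall>s :: nat \<Rightarrow> real. (\<forall>i<n. s i > 0) \<longrightarrow>
        (\<integral>\<omega>. exp (- (\<Sum>i<n. s i * X i \<omega>)) \<partial>M)
          = Determinant.det (1\<^sub>m n + U * mat_diag n s) powr (- \<alpha>))"

definition permanental_process ::
  "'w measure \<Rightarrow> real \<Rightarrow> 't set \<Rightarrow> ('t \<Rightarrow> 't \<Rightarrow> real) \<Rightarrow> ('t \<Rightarrow> 'w \<Rightarrow> real) \<Rightarrow> bool" where
  "permanental_process M \<alpha> T u X \<longleftrightarrow>
     (\<forall>n. \<forall>t :: nat \<Rightarrow> 't. (\<forall>i<n. t i \<in> T) \<longrightarrow>
        permanental_vector M \<alpha> n (Matrix.mat n n (\<lambda>(i, j). u (t i) (t j))) (\<lambda>i. X (t i)))"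

definition continuous_paths_on ::
  "'w measure \<Rightarrow> 't::topological_space set \<Rightarrow> ('t \<Rightarrow> 'w \<Rightarrow> real) \<Rightarrow> bool" where
  "continuous_paths_on M T X \<longleftrightarrow> (\<forall>\<omega>\<in>space M. continuous_on T (\<lambda>t. X t \<omega>))"

(* Potential density of Brownian motion on (0,infinity) killed when it first hits 0. *)
definition killed_BM_potential_density :: "real \<Rightarrow> real \<Rightarrow> real" where
  "killed_BM_potential_density x y = 2 * min x y"

definition L1_plus :: "(real \<Rightarrow> real) set" where
  "L1_plus = {h. set_integrable lebesgue {0<..} h \<and> (\<forall>y>0. 0 \<le> h y)}"

definition is_potential_of :: "(real \<Rightarrow> real) \<Rightarrow> (real \<Rightarrow> real) \<Rightarrow> bool" where
  "is_potential_of f h \<longleftrightarrow>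
     (\<forall>x>0. f x = (LINT y:{0<..}|lebesgue. killed_BM_potential_density x y * h y))"

(* Not symmetric: f is evaluated at the second argument only. *)
definition u_tilde :: "(real \<Rightarrow> real) \<Rightarrow> real \<Rightarrow> real \<Rightarrow> real" where
  "u_tilde f s t = min s t + f t"

definition limsup_ratio :: "(real \<Rightarrow> 'w \<Rightarrow> real) \<Rightarrow> 'w \<Rightarrow> ereal" where
  "limsup_ratio Z \<omega> = Limsup at_top (\<lambda>t. ereal (Z t \<omega> / (t * ln (ln t))))"

end

theory Submission
  imports Defs "HOL-Real_Asymp.Real_Asymp"
begin

text \<open>
The theorem rests on one algebraic fact about the kernel matrix \<open>U\<close> of \<open>min s t + f t\<close> at times
\<open>t\<^sub>0 < \<dots> < t\<^sub>n\<close>: its inverse has nonpositive off-diagonal entries, because \<open>f\<close> is nondecreasing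
with decreasing chord slopes. Eliminating the times from the last to the first writes \<open>|I + U S|\<close>
as a product of pivots. In the variables \<open>y\<^sub>i = a\<^sub>i / (a\<^sub>i + s\<^sub>i)\<close>, where \<open>a\<^sub>i\<close> is the \<open>i\<close>th diagonal
entry of the inverse of \<open>U\<close> (taken with one further time appended), every pivot is a positive
multiple of \<open>(1 - G(y)) / y\<^sub>i\<close> with a power series \<open>G\<close> that has nonnegative coefficients. So
\<open>|I + U S|\<close> to the power \<open>- \<alpha>\<close> is \<open>\<Prod>i. y\<^sub>i\<close> to the power \<open>\<alpha>\<close>, times such a power series
(\<open>kernel_det_series\<close>). Since \<open>y\<^sub>i\<close> to the power \<open>\<alpha> + k\<close> is the Laplace transform of a gamma law of
shape \<open>\<alpha> + k\<close> and rate \<open>a\<^sub>i\<close>, the vector is a mixture of products of gamma laws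
(\<open>gamma_mixture\<close>). The mixture gives everything else.

Existence. It provides the finite-dimensional laws. Multivariate Laplace transforms determine laws,
and \<open>|I + A B| = |I + B A|\<close> shows how repeated, permuted or omitted times act on the determinant, so
the laws are consistent and Kolmogorov's extension theorem applies (\<open>permanental_process_exists\<close>).
The series still converges for some negative \<open>s\<^sub>i\<close>; this yields exponential moments of increments at the
Brownian scale \<open>sqrt (c * (t - s))\<close> on \<open>[c, 2 c]\<close> (\<open>increment_tail\<close>), and a chaining argument then
produces a continuous version (\<open>continuous_version\<close>).

Upper bound. One marginal is a gamma variable of scale \<open>t + f t\<close>, which is asymptotic to
\<open>(1 + C\<^sub>0) t\<close>. The Borel--Cantelli lemma along \<open>\<theta> ^ n\<close> gives the constant \<open>1 + C\<^sub>0\<close>, and chaining bounds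
the oscillation between consecutive points by \<open>\<theta> ^ n * ln n\<close> times a multiple of \<open>sqrt (\<theta> - 1)\<close>;
then \<open>\<theta>\<close> tends to 1 (\<open>limsup_upper\<close>).

Lower bound. Shapes in the mixture are at least \<open>\<alpha>\<close>, so along a grid the process dominates
independent gamma variables of shape \<open>\<alpha>\<close> and rates \<open>a\<^sub>k\<close>. Along \<open>\<theta> ^ k\<close> with \<open>\<theta>\<close> large the rate is,
from the second time on, close to \<open>1 / t\<^sub>k\<close>, whatever \<open>f\<close> is, and the probability of staying below \<open>(1 - e) t ln (ln t)\<close> at all
late grid points is bounded by an infinite product that vanishes (\<open>limsup_lower\<close>).

Finally \<open>f t / t\<close> is nonincreasing, hence converges to \<open>C\<^sub>0\<close>; if \<open>f\<close> is a potential, dominated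
convergence gives \<open>C\<^sub>0 = 0\<close> and the two bounds agree.
\<close>

section \<open>Power series with nonnegative coefficients\<close>

text \<open>
The coefficients and values are extended nonnegative reals, so that rearranging, multiplying and
nesting series needs no convergence hypothesis. The same multi-index may occur for several \<open>j\<close>:
then products and countable sums of series need no collecting of equal monomials.
\<close>
definition nonneg_series :: "nat \<Rightarrow> ((nat \<Rightarrow> ennreal) \<Rightarrow> ennreal) \<Rightarrow> bool" where
  "nonneg_series n F \<longleftrightarrow>
     (\<exists>(c :: nat \<Rightarrow> ennreal) (\<kappa> :: nat \<Rightarrow> nat \<Rightarrow> nat).
        \<forall>y. F y = (\<Sum>j. c j * (\<Prod>i<n. y i ^ \<kappa> j i)))"

lemma suminf_single_ennreal: "(\<Sum>j. if j = (0::nat) then a else (0::ennreal)) = a"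
  by (subst suminf_finite[of "{0}"]) auto

lemma nonneg_series_monomial: "nonneg_series n (\<lambda>y. a * (\<Prod>i<n. y i ^ k i))"
  unfolding nonneg_series_def
proof (intro exI allI)
  fix y :: "nat \<Rightarrow> ennreal"
  have "(\<lambda>j. (if j = (0::nat) then a else 0) * (\<Prod>i<n. y i ^ k i)) =
      (\<lambda>j. if j = 0 then a * (\<Prod>i<n. y i ^ k i) else 0)"
    by auto
  then show "a * (\<Prod>i<n. y i ^ k i) = (\<Sum>j. (if j = (0::nat) then a else 0) * (\<Prod>i<n. y i ^ (\<lambda>_. k) j i))"
    by (simp add: suminf_single_ennreal)
qed

lemma nonneg_series_const: "nonneg_series n (\<lambda>_. a)"
  using nonneg_series_monomial[of n a "\<lambda>_. 0"] by simp

lemma nonneg_series_var: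
  assumes "i < n" shows "nonneg_series n (\<lambda>y. y i)"
proof -
  have "(\<Prod>k<n. y k ^ (if k = i then 1 else 0)) = y i" for y :: "nat \<Rightarrow> ennreal"
  proof -
    have "(\<Prod>k<n. y k ^ (if k = i then 1 else 0)) = (\<Prod>k<n. if k = i then y k else 1)"
      by (intro prod.cong) auto
    then show ?thesis using assms by (simp add: prod.delta)
  qed
  then show ?thesis
    using nonneg_series_monomial[of n 1 "\<lambda>k. if k = i then 1 else 0"] by simp
qed

lemma nonneg_series_suminf:
  assumes "\<And>m :: nat. nonneg_series n (F m)"
  shows "nonneg_series n (\<lambda>y. \<Sum>m. F m y)"
proof -
  have "\<forall>m. \<exists>c \<kappa>. \<forall>y. F m y = (\<Sum>j. c j * (\<Prod>i<n. y i ^ \<kappa> j i))"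
    using assms unfolding nonneg_series_def by blast
  then obtain c \<kappa> where c: "\<And>m y. F m y = (\<Sum>j. c m j * (\<Prod>i<n. y i ^ \<kappa> m j i))"
    by metis
  show ?thesis
    unfolding nonneg_series_def
  proof (intro exI allI)
    fix y
    have "(\<Sum>j. (\<lambda>(m, l). c m l * (\<Prod>i<n. y i ^ \<kappa> m l i)) (prod_decode j)) = (\<Sum>m. F m y)"
      by (rule suminf_ennreal_2dimen) (simp add: c)
    then show "(\<Sum>m. F m y) =
        (\<Sum>j. (\<lambda>j. c (fst (prod_decode j)) (snd (prod_decode j))) j *
           (\<Prod>i<n. y i ^ (\<lambda>j. \<kappa> (fst (prod_decode j)) (snd (prod_decode j))) j i))"
      by (simp add: case_prod_unfold)
  qed
qed

lemma nonneg_series_add: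
  assumes "nonneg_series n F" "nonneg_series n G"
  shows "nonneg_series n (\<lambda>y. F y + G y)"
proof -
  define H where "H m y = (if m = 0 then F y else if m = Suc 0 then G y else 0)" for m :: nat and y
  have "nonneg_series n (H m)" for m
    using assms by (cases "m = 0"; cases "m = Suc 0") (simp_all add: H_def[abs_def] nonneg_series_const)
  then have "nonneg_series n (\<lambda>y. \<Sum>m. H m y)" by (rule nonneg_series_suminf)
  moreover have "(\<Sum>m. H m y) = F y + G y" for y
    by (subst suminf_finite[of "{0, 1}"]) (auto simp: H_def)
  ultimately show ?thesis by simp
qed

lemma nonneg_series_mult:
  assumes "nonneg_series n F" "nonneg_series n G"
  shows "nonneg_series n (\<lambda>y. F y * G y)"
proof -
  obtain c \<kappa> where c: "\<And>y. F y = (\<Sum>j. c j * (\<Prod>i<n. y i ^ \<kappa> j i))"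
    using assms(1) unfolding nonneg_series_def by blast
  obtain d \<mu> where d: "\<And>y. G y = (\<Sum>j. d j * (\<Prod>i<n. y i ^ \<mu> j i))"
    using assms(2) unfolding nonneg_series_def by blast
  have "F y * G y = (\<Sum>j. \<Sum>l. (c j * d l) * (\<Prod>i<n. y i ^ (\<kappa> j i + \<mu> l i)))" for y
  proof -
    have "F y * G y = (\<Sum>j. (c j * (\<Prod>i<n. y i ^ \<kappa> j i)) * G y)"
      by (simp add: c)
    also have "\<dots> = (\<Sum>j. \<Sum>l. (c j * (\<Prod>i<n. y i ^ \<kappa> j i)) * (d l * (\<Prod>i<n. y i ^ \<mu> l i)))"
      by (simp only: d ennreal_suminf_cmult)
    finally show ?thesis by (simp add: power_add prod.distrib mult_ac)
  qed
  then show ?thesis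
    by (simp only:) (intro nonneg_series_suminf nonneg_series_monomial)
qed

lemma nonneg_series_power:
  assumes "nonneg_series n F" shows "nonneg_series n (\<lambda>y. F y ^ m)"
  by (induction m) (auto intro: nonneg_series_const nonneg_series_mult assms)

definition binomial_series :: "real \<Rightarrow> ennreal \<Rightarrow> ennreal" where
  "binomial_series \<beta> x = (\<Sum>m. ennreal (pochhammer \<beta> m / fact m) * x ^ m)"

lemma nonneg_series_binomial_series:
  assumes "nonneg_series n F" shows "nonneg_series n (\<lambda>y. binomial_series \<beta> (F y))"
  unfolding binomial_series_def
  by (intro nonneg_series_suminf nonneg_series_mult nonneg_series_const nonneg_series_power assms)

lemma binomial_series_eq:
  assumes "0 \<le> x" "x < 1" "\<beta> > 0"
  shows "binomial_series \<beta> (ennreal x) = ennreal ((1 - x) powr (- \<beta>))"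
proof -
  have "(\<lambda>n. ((-\<beta>) gchoose n) * (-x)^n) sums (1 + (-x)) powr (-\<beta>)"
    using assms by (intro gen_binomial_real) auto
  moreover have "((-\<beta>) gchoose n) * (-x)^n = pochhammer \<beta> n / fact n * x ^ n" for n
    by (subst power_minus) (simp add: gbinomial_pochhammer flip: power_mult_distrib)
  ultimately have s: "(\<lambda>n. pochhammer \<beta> n / fact n * x ^ n) sums (1 - x) powr (-\<beta>)"
    by simp
  have "ennreal (pochhammer \<beta> m / fact m) * ennreal x ^ m = ennreal (pochhammer \<beta> m / fact m * x ^ m)" for m
    using assms by (simp add: ennreal_power pochhammer_nonneg del: times_divide_eq_left flip: ennreal_mult)
  then have "binomial_series \<beta> (ennreal x) = (\<Sum>m. ennreal (pochhammer \<beta> m / fact m * x ^ m))"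
    unfolding binomial_series_def by simp
  also have "\<dots> = ennreal ((1 - x) powr (-\<beta>))"
    using assms by (intro suminf_ennreal_eq[OF _ s]) (auto simp: pochhammer_nonneg)
  finally show ?thesis .
qed

section \<open>The determinant as a product of pivots\<close>

text \<open>
Every pivot of the elimination below has the form \<open>K (a + s) / a - G\<close>. In the variable
\<open>y = a / (a + s)\<close> this is \<open>(K / y) (1 - y G / K)\<close>, so the binomial series turns a power series for
\<open>G\<close> into one for a negative power of the pivot, apart from the factor \<open>(y / K)\<close> to the power \<open>\<alpha>\<close>.
\<close>
lemma pivot_powr_series:
  fixes K a s G \<alpha> :: real
  assumes "a > 0" "a + s > 0" "K > 0" "G \<ge> 0" "\<alpha> > 0" and pos: "K * (a + s) / a - G > 0"
  shows "ennreal ((K * (a + s) / a - G) powr (- \<alpha>)) =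
    ennreal (K powr (- \<alpha>)) * ennreal ((a / (a + s)) powr \<alpha>) *
      binomial_series \<alpha> (ennreal (a / (a + s)) * ennreal (1 / K) * ennreal G)"
proof -
  define x where "x = a / (a + s) * (1 / K) * G"
  have x0: "0 \<le> x" using assms by (simp add: x_def)
  have e: "K * (a + s) / a - G = K * ((a + s) / a) * (1 - x)"
  proof -
    have "K * ((a + s) / a) * x = G" using assms by (simp add: x_def)
    then show ?thesis by (simp only: right_diff_distrib mult_1_right times_divide_eq_right)
  qed
  have x1: "x < 1"
  proof -
    have "0 < K * ((a + s) / a)" using assms by simp
    then show ?thesis using pos unfolding e by (metis diff_gt_0_iff_gt zero_less_mult_pos)
  qed
  have "(K * ((a + s) / a) * (1 - x)) powr (- \<alpha>) = K powr (- \<alpha>) * ((a + s) / a) powr (- \<alpha>) * (1 - x) powr (- \<alpha>)"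
  proof -
    have "0 \<le> K" "0 \<le> (a + s) / a" "0 \<le> K * ((a + s) / a)" "0 \<le> 1 - x" using assms x1 by auto
    then show ?thesis by (simp only: powr_mult)
  qed
  also have "((a + s) / a) powr (- \<alpha>) = (a / (a + s)) powr \<alpha>"
    using assms by (simp add: powr_minus powr_divide field_simps)
  finally show ?thesis
    using assms x0 x1 unfolding e
    by (simp add: ennreal_mult binomial_series_eq x_def flip: ennreal_mult)
qed

text \<open>
With \<open>w j = f (t j) * s j\<close> this is the determinant of \<open>I + U S\<close> for the kernel \<open>min s t + f t\<close>. The
rank-one part is left general because eliminating a time leaves that special form.
\<close>
definition kernel_det :: "nat \<Rightarrow> (nat \<Rightarrow> real) \<Rightarrow> (nat \<Rightarrow> real) \<Rightarrow> (nat \<Rightarrow> real) \<Rightarrow> real" where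
  "kernel_det n t s w = Determinant.det (Matrix.mat n n
     (\<lambda>(i, j). (if i = j then 1 else 0) + min (t i) (t j) * s j + w j))"

lemma kernel_det_1: "kernel_det (Suc 0) t s w = 1 + t 0 * s 0 + w 0"
  unfolding kernel_det_def by (subst det_single) auto

text \<open>
Elimination of the last time. The kernel rows of the last two times agree to the left of the
diagonal, so the difference of these rows of the matrix has two nonzero entries only; a column operation
clears one of them, and expanding along the row leaves a determinant of the same kind. The weights
of the eliminated time are passed on, divided by the pivot \<open>p\<close>, to the time before it.
\<close>
lemma kernel_det_Suc_Suc:
  fixes t s w :: "nat \<Rightarrow> real" and n :: nat
  defines "p \<equiv> 1 + (t (Suc n) - t n) * s (Suc n)"
  assumes mono: "strict_mono t" and p: "p \<noteq> 0"
  shows "kernel_det (Suc (Suc n)) t s w =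
    p * kernel_det (Suc n) t (s(n := s n + s (Suc n) / p)) (w(n := w n + w (Suc n) / p))"
proof -
  let ?N = "Suc (Suc n)"
  let ?s = "s(n := s n + s (Suc n) / p)" and ?w = "w(n := w n + w (Suc n) / p)"
  have tm: "min (t i) (t j) = t (min i j)" for i j
    using mono by (simp add: min_def strict_mono_less_eq)
  define A where "A = Matrix.mat ?N ?N
     (\<lambda>(i, j). (if i = j then 1 else 0) + min (t i) (t j) * s j + w j)"
  have A: "A \<in> carrier_mat ?N ?N" by (simp add: A_def)
  define B where "B = addrow (-1) (Suc n) n A"
  have B: "B \<in> carrier_mat ?N ?N" unfolding B_def using A by simp
  define C where "C = addcol (1 / p) n (Suc n) B"
  have C: "C \<in> carrier_mat ?N ?N" unfolding C_def using B by (intro carrier_matI) auto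
  have "kernel_det ?N t s w = Determinant.det A" by (simp add: kernel_det_def A_def)
  also have "\<dots> = Determinant.det B"
    unfolding B_def by (rule det_addrow[symmetric, OF _ _ A]) auto
  also have "\<dots> = Determinant.det C"
    unfolding C_def by (rule det_addcol[symmetric, OF _ _ B]) auto
  also have "\<dots> = (\<Sum>j<?N. C $$ (Suc n, j) * cofactor C (Suc n) j)"
    by (rule laplace_expansion_row[OF C]) auto
  also have "\<dots> = (\<Sum>j<?N. if j = Suc n then p * Determinant.det (mat_delete C (Suc n) (Suc n)) else 0)"
  proof (rule sum.cong, simp)
    fix j assume j: "j \<in> {..<?N}"
    have Cij: "C $$ (Suc n, j) = (if j = Suc n then p else 0)"
    proof -
      have Aij: "A $$ (i, l) = (if i = l then 1 else 0) + min (t i) (t l) * s l + w l"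
        if "i < ?N" "l < ?N" for i l
        using that by (simp add: A_def)
      have Bij: "B $$ (Suc n, l) = A $$ (Suc n, l) - A $$ (n, l)" if "l < ?N" for l
        using that A unfolding B_def by simp
      consider "j < n" | "j = n" | "j = Suc n" using j by force
      then show ?thesis
      proof cases
        case 1
        then have "C $$ (Suc n, j) = B $$ (Suc n, j)" using B j unfolding C_def by simp
        then show ?thesis using 1 by (simp add: Bij Aij tm)
      next
        case 2
        then have "C $$ (Suc n, j) = 1 / p * B $$ (Suc n, Suc n) + B $$ (Suc n, n)"
          using B j unfolding C_def by simp
        then show ?thesis using 2 p by (simp add: Bij Aij tm field_simps p_def)
      next
        case 3
        then have "C $$ (Suc n, j) = B $$ (Suc n, j)" using B j unfolding C_def by simp
        then show ?thesis using 3 by (simp add: Bij Aij tm p_def algebra_simps)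
      qed
    qed
    show "C $$ (Suc n, j) * cofactor C (Suc n) j =
        (if j = Suc n then p * Determinant.det (mat_delete C (Suc n) (Suc n)) else 0)"
      unfolding Cij by (simp add: cofactor_def)
  qed
  also have "\<dots> = p * Determinant.det (mat_delete C (Suc n) (Suc n))" by simp
  also have "mat_delete C (Suc n) (Suc n) = Matrix.mat (Suc n) (Suc n)
     (\<lambda>(i, j). (if i = j then 1 else 0) + min (t i) (t j) * ?s j + ?w j)"
  proof (rule eq_matI)
    fix i j assume ij: "i < dim_row (Matrix.mat (Suc n) (Suc n)
     (\<lambda>(i, j). (if i = j then 1 else 0) + min (t i) (t j) * ?s j + ?w j))"
      "j < dim_col (Matrix.mat (Suc n) (Suc n)
     (\<lambda>(i, j). (if i = j then 1 else 0) + min (t i) (t j) * ?s j + ?w j))"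
    have "mat_delete C (Suc n) (Suc n) $$ (i, j) = C $$ (i, j)"
      using ij C by (simp add: mat_delete_def)
    also have "\<dots> = (if j = n then 1 / p * A $$ (i, Suc n) + A $$ (i, n) else A $$ (i, j))"
      using ij A unfolding C_def B_def by simp
    finally show "mat_delete C (Suc n) (Suc n) $$ (i, j) = Matrix.mat (Suc n) (Suc n)
     (\<lambda>(i, j). (if i = j then 1 else 0) + min (t i) (t j) * ?s j + ?w j) $$ (i, j)"
      using ij by (auto simp: A_def tm algebra_simps add_divide_distrib)
  qed (use C in auto)
  finally show ?thesis by (simp add: kernel_det_def)
qed

text \<open>
Positivity of all pivots. It holds for nonnegative weights, but also for some negative ones, and
those are the ones that exponential moments need.
\<close>
fun pivots_pos :: "(nat \<Rightarrow> real) \<Rightarrow> nat \<Rightarrow> (nat \<Rightarrow> real) \<Rightarrow> (nat \<Rightarrow> real) \<Rightarrow> bool" where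
  "pivots_pos t 0 s w \<longleftrightarrow> 1 + t 0 * s 0 + w 0 > 0"
| "pivots_pos t (Suc n) s w \<longleftrightarrow>
     1 + (t (Suc n) - t n) * s (Suc n) > 0 \<and>
     pivots_pos t n
       (s(n := s n + s (Suc n) / (1 + (t (Suc n) - t n) * s (Suc n))))
       (w(n := w n + w (Suc n) / (1 + (t (Suc n) - t n) * s (Suc n))))"

lemma pivots_pos_nonneg:
  assumes "strict_mono t" "0 < t 0" "\<And>i. i \<le> n \<Longrightarrow> 0 \<le> s i" "\<And>i. i \<le> n \<Longrightarrow> 0 \<le> w i"
  shows "pivots_pos t n s w"
  using assms
proof (induction n arbitrary: s w)
  case 0
  then show ?case by (simp add: add_pos_nonneg)
next
  case (Suc n)
  have "t n < t (Suc n)" using Suc.prems(1) by (simp add: strict_mono_def)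
  then have p: "1 + (t (Suc n) - t n) * s (Suc n) > 0"
    using Suc.prems(3)[of "Suc n"] by (simp add: add_pos_nonneg)
  show ?case
    using p Suc.prems by (auto intro!: Suc.IH)
qed

section \<open>Grids on which the chord slopes decrease\<close>

definition gap :: "(nat \<Rightarrow> real) \<Rightarrow> nat \<Rightarrow> real" where
  "gap t k = t (Suc k) - t k"

definition slope :: "(real \<Rightarrow> real) \<Rightarrow> (nat \<Rightarrow> real) \<Rightarrow> nat \<Rightarrow> real" where
  "slope f t k = (f (t (Suc k)) - f (t k)) / gap t k"

text \<open>
The diagonal of the inverse of the kernel matrix of \<open>min s t + f t\<close>, for times that are not the
last one. The rank-one part \<open>f t\<close> affects the first row of the inverse only, hence the special role of
index 0.
\<close>
definition gamma_rate :: "(real \<Rightarrow> real) \<Rightarrow> (nat \<Rightarrow> real) \<Rightarrow> nat \<Rightarrow> real" where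
  "gamma_rate f t k = (case k of
       0 \<Rightarrow> (1 + (t 0 + f (t 0)) / gap t 0 + slope f t 0) / (t 0 + f (t 0))
     | Suc k \<Rightarrow> 1 / gap t k + 1 / gap t (Suc k))"

text \<open>
The grid is infinite so that each of its times has a successor; a finite set of times is extended
arbitrarily.
\<close>
locale concave_grid =
  fixes f :: "real \<Rightarrow> real" and t :: "nat \<Rightarrow> real"
  assumes t0_pos: "0 < t 0" and strict_mono_t: "strict_mono t"
    and f_pos: "\<And>k. 0 < f (t k)"
    and slope_nonneg: "\<And>k. 0 \<le> slope f t k"
    and slope_antimono: "\<And>k. slope f t (Suc k) \<le> slope f t k"
begin

abbreviation "a \<equiv> gamma_rate f t"

lemma gap_pos: "0 < gap t k"
  using strict_mono_t by (simp add: gap_def strict_mono_def)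

lemma u0_pos: "0 < t 0 + f (t 0)"
  using t0_pos f_pos[of 0] by simp

lemma gamma_rate_pos: "0 < a k"
proof (cases k)
  case 0
  have "0 < 1 + (t 0 + f (t 0)) / gap t 0 + slope f t 0"
    using gap_pos[of 0] u0_pos slope_nonneg[of 0] by (intro add_pos_nonneg) auto
  then show ?thesis using 0 u0_pos by (simp add: gamma_rate_def)
next
  case (Suc l)
  then show ?thesis using gap_pos by (simp add: gamma_rate_def add_pos_pos)
qed

text \<open>
The Laplace transform at \<open>s i\<close> of the exponential law with rate \<open>a i\<close>.
\<close>
definition y_of :: "(nat \<Rightarrow> real) \<Rightarrow> nat \<Rightarrow> ennreal" where
  "y_of s = (\<lambda>i. ennreal (a i / (a i + s i)))"

text \<open>
The invariant of the elimination. Suppose that all times after \<open>n\<close> have been eliminated, and that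
this has changed the weights at time \<open>n\<close> to \<open>s' n\<close> and \<open>w' n\<close>, where \<open>q\<close> and \<open>r\<close> are power series
with nonnegative coefficients. Eliminating time \<open>n\<close> changes the weights of its predecessor in the same way,
with the reciprocal of the pivot in place of \<open>q\<close> and with
\<open>(slope f t (n - 1) - slope f t n + r)\<close> times that reciprocal in place of \<open>r\<close>. The new \<open>r\<close> has nonnegative
coefficients because the slopes decrease.
\<close>
lemma series_level:
  assumes "n < N" "nonneg_series N q" "nonneg_series N r" "\<alpha> > 0"
  shows "\<exists>F C. nonneg_series N F \<and> C > 0 \<and>
    (\<forall>s qv rv s' w'. (\<forall>i\<le>n. 0 < a i + s i) \<longrightarrow>
       q (y_of s) = ennreal qv \<longrightarrow> r (y_of s) = ennreal rv \<longrightarrow> 0 \<le> qv \<longrightarrow> 0 \<le> rv \<longrightarrow>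
       (\<forall>i<n. s' i = s i \<and> w' i = f (t i) * s i) \<longrightarrow>
       s' n = s n + (1 - qv) / gap t n \<longrightarrow> w' n = f (t n) * s' n + slope f t n - rv \<longrightarrow>
       pivots_pos t n s' w' \<longrightarrow>
       ennreal (kernel_det (Suc n) t s' w' powr (- \<alpha>)) =
         ennreal C * (\<Prod>i\<le>n. ennreal ((a i / (a i + s i)) powr \<alpha>)) * F (y_of s))"
  using assms
proof (induction n arbitrary: q r)
  case 0
  let ?u = "t 0 + f (t 0)"
  define K where "K = ?u * a 0"
  have K: "K > 0" using u0_pos gamma_rate_pos by (simp add: K_def)
  have Ke: "K = 1 + ?u / gap t 0 + slope f t 0"
    using u0_pos by (simp add: K_def gamma_rate_def)
  define F where "F y = binomial_series \<alpha> (y 0 * ennreal (1 / K) * (ennreal (?u / gap t 0) * q y + r y))" for y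
  have "nonneg_series N F"
    unfolding F_def using 0
    by (intro nonneg_series_binomial_series nonneg_series_mult nonneg_series_add nonneg_series_const
        nonneg_series_var)
  moreover have "K powr (- \<alpha>) > 0" using K by simp
  moreover have "ennreal (kernel_det (Suc 0) t s' w' powr (- \<alpha>)) =
         ennreal (K powr (- \<alpha>)) * (\<Prod>i\<le>0. ennreal ((a i / (a i + s i)) powr \<alpha>)) * F (y_of s)"
    if h: "\<forall>i\<le>0. 0 < a i + s i" "q (y_of s) = ennreal qv" "r (y_of s) = ennreal rv" "0 \<le> qv" "0 \<le> rv"
      "s' 0 = s 0 + (1 - qv) / gap t 0" "w' 0 = f (t 0) * s' 0 + slope f t 0 - rv"
      "pivots_pos t 0 s' w'" for s qv rv s' w'
  proof -
    let ?G = "?u / gap t 0 * qv + rv"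
    have G: "?G \<ge> 0" using h u0_pos gap_pos[of 0] by simp
    have "K * (a 0 + s 0) / a 0 = K + ?u * s 0"
      using gamma_rate_pos[of 0] by (simp add: K_def field_simps)
    then have e: "1 + t 0 * s' 0 + w' 0 = K * (a 0 + s 0) / a 0 - ?G"
      unfolding h Ke by (simp add: algebra_simps diff_divide_distrib add_divide_distrib)
    have "K * (a 0 + s 0) / a 0 - ?G > 0"
      using h(8) e by simp
    from pivot_powr_series[OF gamma_rate_pos[of 0] _ K G 0(4) this] h
    have "ennreal ((K * (a 0 + s 0) / a 0 - ?G) powr (- \<alpha>)) =
      ennreal (K powr (- \<alpha>)) * ennreal ((a 0 / (a 0 + s 0)) powr \<alpha>) *
      binomial_series \<alpha> (ennreal (a 0 / (a 0 + s 0)) * ennreal (1 / K) * ennreal ?G)"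
      by auto
    moreover have "ennreal ?G = ennreal (?u / gap t 0) * q (y_of s) + r (y_of s)"
      using h u0_pos gap_pos[of 0] by (simp add: ennreal_mult del: times_divide_eq_left)
    ultimately show ?thesis
      by (simp add: kernel_det_1 e F_def y_of_def)
  qed
  ultimately show ?case by (intro exI[of _ F] exI[of _ "K powr (- \<alpha>)"]) auto
next
  case (Suc n)
  let ?g = "gap t n" and ?g' = "gap t (Suc n)"
  define K where "K = ?g * a (Suc n)"
  have g: "?g > 0" "?g' > 0" by (rule gap_pos)+
  have K: "K > 0" using g gamma_rate_pos by (simp add: K_def)
  have Ke: "K = 1 + ?g / ?g'" using g by (simp add: K_def gamma_rate_def field_simps)
  define x where "x y = y (Suc n) * ennreal (1 / K) * (ennreal (?g / ?g') * q y)" for y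
  \<comment> \<open>\<open>Q\<close> is the reciprocal of the pivot, and \<open>R\<close> the new correction to the weight \<open>w\<close>.\<close>
  define Q where "Q y = ennreal (1 / K) * y (Suc n) * binomial_series 1 (x y)" for y
  define R where "R y = (ennreal (slope f t n - slope f t (Suc n)) + r y) * Q y" for y
  have x: "nonneg_series N x"
    unfolding x_def using Suc.prems by (intro nonneg_series_mult nonneg_series_const nonneg_series_var)
  have Q: "nonneg_series N Q"
    unfolding Q_def using Suc.prems
    by (intro nonneg_series_mult nonneg_series_const nonneg_series_var nonneg_series_binomial_series x)
  have R: "nonneg_series N R"
    unfolding R_def using Suc.prems
    by (intro nonneg_series_mult nonneg_series_add nonneg_series_const Q)
  have "n < N" using Suc.prems by simp
  from Suc.IH[OF this Q R Suc.prems(4)] obtain F C where F: "nonneg_series N F" "C > 0" and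
    FC: "\<And>s qv rv s' w'. \<lbrakk>\<forall>i\<le>n. 0 < a i + s i; Q (y_of s) = ennreal qv; R (y_of s) = ennreal rv;
       0 \<le> qv; 0 \<le> rv; \<forall>i<n. s' i = s i \<and> w' i = f (t i) * s i; s' n = s n + (1 - qv) / gap t n;
       w' n = f (t n) * s' n + slope f t n - rv; pivots_pos t n s' w'\<rbrakk> \<Longrightarrow>
       ennreal (kernel_det (Suc n) t s' w' powr (- \<alpha>)) =
         ennreal C * (\<Prod>i\<le>n. ennreal ((a i / (a i + s i)) powr \<alpha>)) * F (y_of s)"
    by blast
  define F' where "F' y = F y * binomial_series \<alpha> (x y)" for y
  define C' where "C' = C * K powr (- \<alpha>)"
  have "nonneg_series N F'"
    unfolding F'_def by (intro nonneg_series_mult nonneg_series_binomial_series x F)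
  moreover have "C' > 0" using F K by (simp add: C'_def)
  moreover have "ennreal (kernel_det (Suc (Suc n)) t s' w' powr (- \<alpha>)) =
         ennreal C' * (\<Prod>i\<le>Suc n. ennreal ((a i / (a i + s i)) powr \<alpha>)) * F' (y_of s)"
    if h: "\<forall>i\<le>Suc n. 0 < a i + s i" "q (y_of s) = ennreal qv" "r (y_of s) = ennreal rv" "0 \<le> qv" "0 \<le> rv"
      "\<forall>i<Suc n. s' i = s i \<and> w' i = f (t i) * s i"
      "s' (Suc n) = s (Suc n) + (1 - qv) / gap t (Suc n)"
      "w' (Suc n) = f (t (Suc n)) * s' (Suc n) + slope f t (Suc n) - rv"
      "pivots_pos t (Suc n) s' w'" for s qv rv s' w'
  proof -
    define p where "p = 1 + (t (Suc n) - t n) * s' (Suc n)"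
    define s'' where "s'' = s'(n := s' n + s' (Suc n) / p)"
    define w'' where "w'' = w'(n := w' n + w' (Suc n) / p)"
    let ?G = "?g / ?g' * qv"
    have p: "p > 0" and piv: "pivots_pos t n s'' w''"
      using h(9) by (auto simp: p_def s''_def w''_def)
    have as: "a (Suc n) + s (Suc n) > 0" using h by simp
    have G: "?G \<ge> 0" using h g by simp
    have "K * (a (Suc n) + s (Suc n)) / a (Suc n) = K + ?g * s (Suc n)"
      using gamma_rate_pos[of "Suc n"] by (simp add: K_def field_simps)
    then have pe: "p = K * (a (Suc n) + s (Suc n)) / a (Suc n) - ?G"
      unfolding p_def h Ke by (simp add: gap_def[symmetric] algebra_simps diff_divide_distrib add_divide_distrib)
    have xe: "x (y_of s) = ennreal (a (Suc n) / (a (Suc n) + s (Suc n))) * ennreal (1 / K) * ennreal ?G"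
      using h g unfolding x_def y_of_def[symmetric] by (simp add: ennreal_mult y_of_def del: times_divide_eq_left)
    have pos: "K * (a (Suc n) + s (Suc n)) / a (Suc n) - ?G > 0" using p pe by simp
    have pp: "ennreal (p powr (- \<beta>)) = ennreal (K powr (- \<beta>)) *
        ennreal ((a (Suc n) / (a (Suc n) + s (Suc n))) powr \<beta>) * binomial_series \<beta> (x (y_of s))"
      if "\<beta> > 0" for \<beta>
      unfolding xe pe by (rule pivot_powr_series[OF gamma_rate_pos as K G that pos])
    have Qv: "Q (y_of s) = ennreal (1 / p)"
      using pp[of 1] p K as gamma_rate_pos[of "Suc n"] 
      by (simp add: Q_def powr_minus_divide y_of_def)
    define rv' where "rv' = (slope f t n - slope f t (Suc n) + rv) * (1 / p)"
    have rv': "0 \<le> rv'" using p slope_antimono[of n] h by (simp add: rv'_def)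
    have Rv: "R (y_of s) = ennreal rv'"
    proof -
      have "R (y_of s) = ennreal (slope f t n - slope f t (Suc n) + rv) * ennreal (1 / p)"
        unfolding R_def Qv using h(3,5) slope_antimono[of n] by simp
      also have "\<dots> = ennreal rv'"
        unfolding rv'_def using h(5) p slope_antimono[of n] by (intro ennreal_mult[symmetric]) auto
      finally show ?thesis .
    qed
    have s'p: "s' (Suc n) / p = (1 - 1 / p) / ?g"
    proof -
      have "1 - 1 / p = (p - 1) / p" using p by (simp add: diff_divide_distrib)
      also have "\<dots> = ?g * s' (Suc n) / p" by (simp add: p_def gap_def)
      finally show ?thesis using g by simp
    qed
    have 1: "s'' n = s n + (1 - 1 / p) / gap t n"
      using h(6) by (simp add: s''_def s'p)
    have fs: "f (t (Suc n)) = f (t n) + slope f t n * ?g"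
      using g by (simp add: slope_def)
    have "w' (Suc n) / p = f (t (Suc n)) * (s' (Suc n) / p) + (slope f t (Suc n) - rv) / p"
      unfolding h(8) by (simp add: add_divide_distrib diff_divide_distrib)
    also have "\<dots> = f (t n) * ((1 - 1 / p) / ?g) + slope f t n * (1 - 1 / p) + (slope f t (Suc n) - rv) / p"
    proof -
      have "slope f t n * ?g * ((1 - 1 / p) / ?g) = slope f t n * (1 - 1 / p)" using g by simp
      then show ?thesis by (simp only: fs s'p distrib_right)
    qed
    finally have 2: "w'' n = f (t n) * s'' n + slope f t n - rv'"
      using h(6) unfolding 1 by (simp add: w''_def rv'_def algebra_simps diff_divide_distrib add_divide_distrib)
    have IH: "ennreal (kernel_det (Suc n) t s'' w'' powr (- \<alpha>)) =
         ennreal C * (\<Prod>i\<le>n. ennreal ((a i / (a i + s i)) powr \<alpha>)) * F (y_of s)"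
      by (rule FC[OF _ Qv Rv _ rv' _ 1 2 piv]) (use h p in \<open>auto simp: s''_def w''_def\<close>)
    have kd: "kernel_det (Suc (Suc n)) t s' w' = p * kernel_det (Suc n) t s'' w''"
      using kernel_det_Suc_Suc[OF strict_mono_t, of n s' w'] p
      by (simp add: p_def s''_def w''_def)
    have "ennreal (kernel_det (Suc (Suc n)) t s' w' powr (- \<alpha>)) =
        ennreal (p powr (- \<alpha>)) * ennreal (kernel_det (Suc n) t s'' w'' powr (- \<alpha>))"
      unfolding kd using p by (simp add: powr_mult ennreal_mult)
    also have "\<dots> = ennreal C' * (\<Prod>i\<le>Suc n. ennreal ((a i / (a i + s i)) powr \<alpha>)) * F' (y_of s)"
      unfolding IH pp[OF Suc.prems(4)] using F by (simp add: C'_def F'_def ennreal_mult mult_ac)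
    finally show ?thesis .
  qed
  ultimately show ?case by (intro exI[of _ F'] exI[of _ C']) auto
qed

text \<open>
The invariant starts with \<open>q = 1\<close> and \<open>r = slope f t n\<close>: then \<open>s' n = s n\<close> and \<open>w' n = f (t n) * s n\<close>,
which is the effect of eliminating a time after \<open>t n\<close> that carries no weight.
\<close>
lemma kernel_det_series:
  assumes "\<alpha> > 0"
  shows "\<exists>F C. nonneg_series (Suc n) F \<and> C > 0 \<and>
    (\<forall>s. (\<forall>i\<le>n. 0 < a i + s i) \<longrightarrow> pivots_pos t n s (\<lambda>i. f (t i) * s i) \<longrightarrow>
       ennreal (kernel_det (Suc n) t s (\<lambda>i. f (t i) * s i) powr (- \<alpha>)) =
         ennreal C * (\<Prod>i\<le>n. ennreal ((a i / (a i + s i)) powr \<alpha>)) * F (y_of s))"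
proof -
  obtain F C where "nonneg_series (Suc n) F" "C > 0" and
    *: "\<And>s qv rv s' w'. (\<forall>i\<le>n. 0 < a i + s i) \<longrightarrow>
       1 = ennreal qv \<longrightarrow> ennreal (slope f t n) = ennreal rv \<longrightarrow> 0 \<le> qv \<longrightarrow> 0 \<le> rv \<longrightarrow>
       (\<forall>i<n. s' i = s i \<and> w' i = f (t i) * s i) \<longrightarrow>
       s' n = s n + (1 - qv) / gap t n \<longrightarrow> w' n = f (t n) * s' n + slope f t n - rv \<longrightarrow>
       pivots_pos t n s' w' \<longrightarrow>
       ennreal (kernel_det (Suc n) t s' w' powr (- \<alpha>)) =
         ennreal C * (\<Prod>i\<le>n. ennreal ((a i / (a i + s i)) powr \<alpha>)) * F (y_of s)"
    using series_level[of n "Suc n" "\<lambda>_. 1" "\<lambda>_. ennreal (slope f t n)" \<alpha>] assms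
    by (auto simp: nonneg_series_const)
  moreover have "ennreal (kernel_det (Suc n) t s (\<lambda>i. f (t i) * s i) powr (- \<alpha>)) =
         ennreal C * (\<Prod>i\<le>n. ennreal ((a i / (a i + s i)) powr \<alpha>)) * F (y_of s)"
    if "\<forall>i\<le>n. 0 < a i + s i" "pivots_pos t n s (\<lambda>i. f (t i) * s i)" for s
    using *[of s 1 "slope f t n" s "\<lambda>i. f (t i) * s i"] that slope_nonneg[of n] by simp
  ultimately show ?thesis by blast
qed

end

section \<open>Mixtures of products of gamma laws\<close>

definition gamma_dens :: "real \<Rightarrow> real \<Rightarrow> real \<Rightarrow> ennreal" where
  "gamma_dens \<beta> b x = ennreal (indicator {0..} x * (b powr \<beta> * x powr (\<beta> - 1) * exp (- b * x) / Gamma \<beta>))"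

lemma gamma_dens_measurable [measurable]: "gamma_dens \<beta> b \<in> borel_measurable borel"
  unfolding gamma_dens_def[abs_def] by measurable

abbreviation gamma_cdf :: "real \<Rightarrow> real \<Rightarrow> real \<Rightarrow> ennreal" where
  "gamma_cdf \<beta> b c \<equiv> \<integral>\<^sup>+x. indicator {..c} x * gamma_dens \<beta> b x \<partial>lborel"

abbreviation laplace :: "'i set \<Rightarrow> ('i \<Rightarrow> real) measure \<Rightarrow> ('i \<Rightarrow> real) \<Rightarrow> ennreal" where
  "laplace I \<mu> s \<equiv> \<integral>\<^sup>+x. ennreal (exp (- (\<Sum>i\<in>I. s i * x i))) \<partial>\<mu>"

lemma gamma_dens_laplace:
  assumes \<beta>: "\<beta> > 0" and b: "b > 0" "b + s > 0"
  shows "(\<integral>\<^sup>+x. ennreal (exp (- s * x)) * gamma_dens \<beta> b x \<partial>lborel) = ennreal ((b / (b + s)) powr \<beta>)"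
proof -
  let ?c = "b + s"
  define K where "K = (b / ?c) powr \<beta> / Gamma \<beta>"
  have G: "Gamma \<beta> > 0" using \<beta> by (rule Gamma_real_pos)
  have K: "K \<ge> 0" using G by (simp add: K_def)
  have "(\<integral>\<^sup>+x. ennreal (exp (- s * x)) * gamma_dens \<beta> b x \<partial>lborel) =
      ennreal \<bar>1 / ?c\<bar> * (\<integral>\<^sup>+x. ennreal (exp (- s * (0 + 1 / ?c * x))) * gamma_dens \<beta> b (0 + 1 / ?c * x) \<partial>lborel)"
    using b by (intro nn_integral_real_affine) auto
  also have "\<dots> = (\<integral>\<^sup>+x. ennreal (1 / ?c) * (ennreal (exp (- s * (1 / ?c * x))) * gamma_dens \<beta> b (1 / ?c * x)) \<partial>lborel)"
    using b by (subst nn_integral_cmult) auto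
  also have "\<dots> = (\<integral>\<^sup>+x. ennreal K * ennreal (indicator {0..} x * x powr (\<beta> - 1) / exp x) \<partial>lborel)"
  proof (intro nn_integral_cong)
    fix x :: real
    show "ennreal (1 / ?c) * (ennreal (exp (- s * (1 / ?c * x))) * gamma_dens \<beta> b (1 / ?c * x)) =
        ennreal K * ennreal (indicator {0..} x * x powr (\<beta> - 1) / exp x)"
    proof (cases "x \<ge> 0")
      case True
      have "1 / ?c * x \<ge> 0" using True b by simp
      have e: "exp (- s * (1 / ?c * x)) * exp (- b * (1 / ?c * x)) = 1 / exp x"
      proof -
        have "- s * (1 / ?c * x) + - b * (1 / ?c * x) = - (?c / ?c) * x"
          by (simp only: add_divide_distrib) (simp add: algebra_simps add_divide_distrib)
        also have "\<dots> = - x" using b by simp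
        finally show ?thesis by (simp add: exp_minus inverse_eq_divide flip: exp_add)
      qed
      have p: "1 / ?c * (1 / ?c * x) powr (\<beta> - 1) = x powr (\<beta> - 1) / ?c powr \<beta>"
        using b True by (simp add: powr_divide powr_diff)
      have "1 / ?c * (exp (- s * (1 / ?c * x)) * (b powr \<beta> * (1 / ?c * x) powr (\<beta> - 1) * exp (- b * (1 / ?c * x)) / Gamma \<beta>))
        = (1 / ?c * (1 / ?c * x) powr (\<beta> - 1)) * b powr \<beta> * (exp (- s * (1 / ?c * x)) * exp (- b * (1 / ?c * x))) / Gamma \<beta>"
        by (simp only: mult_ac times_divide_eq_left times_divide_eq_right)
      also have "\<dots> = K * (x powr (\<beta> - 1) / exp x)"
        unfolding p e K_def using b by (simp add: powr_divide mult_ac)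
      finally have *: "1 / ?c * (exp (- s * (1 / ?c * x)) * (b powr \<beta> * (1 / ?c * x) powr (\<beta> - 1) * exp (- b * (1 / ?c * x)) / Gamma \<beta>))
        = K * (x powr (\<beta> - 1) / exp x)" .
      have "indicator {0..} (1 / ?c * x) = (1::real)" "indicator {0..} x = (1::real)"
        using True b by (auto simp: indicator_def)
      then show ?thesis
        unfolding gamma_dens_def using b K G
        by (simp only: mult_1) (subst ennreal_mult[symmetric], simp, simp, subst ennreal_mult[symmetric], simp, simp,
          subst ennreal_mult[symmetric], simp, simp, simp only: *)
    next
      case False
      then have "\<not> 1 / ?c * x \<ge> 0" using b by (simp add: zero_le_divide_iff)
      then have "indicator {0..} (1 / ?c * x) = (0::real)" by (simp add: indicator_def)
      with False show ?thesis by (simp add: gamma_dens_def)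
    qed
  qed
  also have "\<dots> = ennreal K * ennreal (Gamma \<beta>)"
    by (subst nn_integral_cmult) (use Gamma_conv_nn_integral_real[OF \<beta>] in auto)
  also have "\<dots> = ennreal ((b / ?c) powr \<beta>)"
    using G K by (simp add: K_def flip: ennreal_mult)
  finally show ?thesis .
qed

lemma nn_integral_gamma_dens:
  assumes "\<beta> > 0" "b > 0" shows "(\<integral>\<^sup>+x. gamma_dens \<beta> b x \<partial>lborel) = 1"
  using gamma_dens_laplace[of \<beta> b 0] assms by simp

lemma gamma_dens_Suc:
  assumes "\<beta> > 0" "b > 0" "x \<ge> 0"
  shows "gamma_dens (\<beta> + 1) b x = ennreal (b * x / \<beta>) * gamma_dens \<beta> b x"
proof -
  have G: "Gamma \<beta> > 0" using assms by (simp add: Gamma_real_pos)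
  have "x powr \<beta> = x * x powr (\<beta> - 1)"
    using assms by (cases "x = 0") (auto simp: powr_diff)
  moreover have "Gamma (\<beta> + 1) = \<beta> * Gamma \<beta>" using assms by (intro Gamma_plus1) (auto elim!: nonpos_Ints_cases)
  ultimately have "b powr (\<beta> + 1) * x powr (\<beta> + 1 - 1) * exp (- b * x) / Gamma (\<beta> + 1) =
      b * x / \<beta> * (b powr \<beta> * x powr (\<beta> - 1) * exp (- b * x) / Gamma \<beta>)"
    using assms by (simp add: powr_add)
  then show ?thesis
    using assms G by (simp add: gamma_dens_def flip: ennreal_mult)
qed

text \<open>
The gamma law grows stochastically with its shape. By \<open>gamma_dens_Suc\<close> the densities for \<open>\<beta> + 1\<close> and
\<open>\<beta>\<close> have the ratio \<open>b x / \<beta>\<close>, which crosses 1 at \<open>\<beta> / b\<close>. So the densities are compared on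
the lower tail if \<open>c\<close> lies to the left of this point, and on the upper tail otherwise.
\<close>
lemma gamma_cdf_Suc_le:
  assumes \<beta>: "\<beta> > 0" and b: "b > 0"
  shows "gamma_cdf (\<beta> + 1) b c \<le>
         gamma_cdf \<beta> b c"
proof (cases "c \<le> \<beta> / b")
  case True
  show ?thesis
  proof (intro nn_integral_mono)
    fix x :: real
    show "indicator {..c} x * gamma_dens (\<beta> + 1) b x \<le> indicator {..c} x * gamma_dens \<beta> b x"
    proof (cases "0 \<le> x \<and> x \<le> c")
      case t: True
      have "b * x \<le> \<beta>" using t True b by (simp add: field_simps) (meson mult_left_mono order_trans less_imp_le)
      then have "ennreal (b * x / \<beta>) \<le> 1" using \<beta> by (simp add: ennreal_le_1 divide_le_eq)
      then have "ennreal (b * x / \<beta>) * gamma_dens \<beta> b x \<le> 1 * gamma_dens \<beta> b x" by (intro mult_right_mono) auto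
      then show ?thesis using t by (simp add: gamma_dens_Suc[OF \<beta> b])
    qed (auto simp: gamma_dens_def indicator_def)
  qed
next
  case False
  let ?F = "\<lambda>\<beta>. gamma_cdf \<beta> b c"
  let ?T = "\<lambda>\<beta>. (\<integral>\<^sup>+x. indicator {c<..} x * gamma_dens \<beta> b x \<partial>lborel)"
  have s: "?F \<gamma> + ?T \<gamma> = 1" if "\<gamma> > 0" for \<gamma>
  proof -
    have "?F \<gamma> + ?T \<gamma> = (\<integral>\<^sup>+x. indicator {..c} x * gamma_dens \<gamma> b x + indicator {c<..} x * gamma_dens \<gamma> b x \<partial>lborel)"
      by (intro nn_integral_add[symmetric]) auto
    also have "\<dots> = (\<integral>\<^sup>+x. gamma_dens \<gamma> b x \<partial>lborel)"
      by (intro nn_integral_cong) (auto simp: indicator_def)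
    finally show ?thesis using nn_integral_gamma_dens[OF that b] by simp
  qed
  have T: "?T \<beta> \<le> ?T (\<beta> + 1)"
  proof (intro nn_integral_mono)
    fix x :: real
    show "indicator {c<..} x * gamma_dens \<beta> b x \<le> indicator {c<..} x * gamma_dens (\<beta> + 1) b x"
    proof (cases "c < x")
      case t: True
      have xb: "\<beta> / b \<le> x" using t False by simp
      then have "\<beta> \<le> b * x" using b by (simp add: field_simps)
      moreover have "x \<ge> 0" using xb \<beta> b by (meson divide_nonneg_pos less_imp_le order_trans)
      ultimately have "1 * gamma_dens \<beta> b x \<le> ennreal (b * x / \<beta>) * gamma_dens \<beta> b x"
        using \<beta> by (intro mult_right_mono) (auto simp: le_divide_eq)
      then show ?thesis using t \<open>x \<ge> 0\<close> by (simp add: gamma_dens_Suc[OF \<beta> b])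
    qed auto
  qed
  have sum: "?F \<beta> + ?T \<beta> = ?F (\<beta> + 1) + ?T (\<beta> + 1)" using s[of \<beta>] s[of "\<beta> + 1"] \<beta> by simp
  have "?T \<beta> \<le> 1" unfolding s[OF \<beta>, symmetric] by simp
  then have "?T \<beta> \<noteq> \<infinity>" by (auto simp: top_unique)
  have "?T \<beta> + ?F (\<beta> + 1) \<le> ?T (\<beta> + 1) + ?F (\<beta> + 1)" using T by (rule add_right_mono)
  also have "\<dots> = ?T \<beta> + ?F \<beta>" using sum by (simp add: add.commute)
  finally show ?thesis using \<open>?T \<beta> \<noteq> \<infinity>\<close> by (simp add: ennreal_add_left_cancel_le)
qed

lemma gamma_cdf_add_le:
  assumes \<beta>: "\<beta> > 0" and b: "b > 0"
  shows "gamma_cdf (\<beta> + real k) b c \<le>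
         gamma_cdf \<beta> b c"
proof (induction k)
  case (Suc k)
  have "gamma_cdf ((\<beta> + real k) + 1) b c \<le>
      gamma_cdf (\<beta> + real k) b c"
    using \<beta> b by (intro gamma_cdf_Suc_le) auto
  with Suc show ?case by (simp add: add_ac)
qed simp

context concave_grid
begin

text \<open>
In \<open>kernel_det_series\<close>, each monomial of the series times the common factor \<open>\<Prod>i. y\<^sub>i\<close> to the power
\<open>\<alpha>\<close> is the Laplace transform of a product of gamma laws of shapes at least \<open>\<alpha>\<close>, and at \<open>s = 0\<close> the
coefficients are seen to sum to 1. The last conjunct says that the mixture dominates the product
of the gamma laws of shape \<open>\<alpha>\<close>.
\<close>
lemma gamma_mixture:
  assumes \<alpha>: "\<alpha> > 0"
  shows "\<exists>\<mu>. prob_space \<mu> \<and> sets \<mu> = sets (PiM {..n} (\<lambda>_. borel)) \<and>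
    (AE x in \<mu>. \<forall>i\<le>n. 0 \<le> x i) \<and>
    (\<forall>s. (\<forall>i\<le>n. 0 < a i + s i) \<longrightarrow> pivots_pos t n s (\<lambda>i. f (t i) * s i) \<longrightarrow>
       laplace {..n} \<mu> s =
         ennreal (kernel_det (Suc n) t s (\<lambda>i. f (t i) * s i) powr (- \<alpha>))) \<and>
    (\<forall>c. emeasure \<mu> {x \<in> space \<mu>. \<forall>i\<le>n. x i \<le> c i} \<le>
       (\<Prod>i\<le>n. gamma_cdf \<alpha> (a i) (c i)))"
proof -
  let ?det = "\<lambda>s. kernel_det (Suc n) t s (\<lambda>i. f (t i) * s i)"
  let ?Y = "\<lambda>s i. a i / (a i + s i)"
  obtain F C where F: "nonneg_series (Suc n) F" "C > 0" and
    det: "\<And>s. \<lbrakk>\<forall>i\<le>n. 0 < a i + s i; pivots_pos t n s (\<lambda>i. f (t i) * s i)\<rbrakk> \<Longrightarrow>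
       ennreal (?det s powr (- \<alpha>)) = ennreal C * (\<Prod>i\<le>n. ennreal (?Y s i powr \<alpha>)) * F (y_of s)"
    using kernel_det_series[OF \<alpha>, of n] by blast
  obtain c \<kappa> where c: "\<And>y. F y = (\<Sum>j. c j * (\<Prod>i\<le>n. y i ^ \<kappa> j i))"
    using F(1) unfolding nonneg_series_def lessThan_Suc_atMost by blast
  have a: "a i > 0" for i by (rule gamma_rate_pos)
  define p where "p x = (\<Sum>j. ennreal C * c j * (\<Prod>i\<le>n. gamma_dens (\<alpha> + real (\<kappa> j i)) (a i) (x i)))" for x
  let ?L = "PiM {..n} (\<lambda>_. lborel :: real measure)"
  interpret L: product_sigma_finite "\<lambda>_ :: nat. lborel :: real measure" ..
  have [measurable]: "p \<in> borel_measurable ?L" unfolding p_def by measurable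
  define \<mu> where "\<mu> = density ?L p"
  have prod_int: "(\<integral>\<^sup>+x. (\<Prod>i\<le>n. g i (x i)) \<partial>\<mu>) =
      (\<Sum>j. ennreal C * c j * (\<Prod>i\<le>n. \<integral>\<^sup>+x. g i x * gamma_dens (\<alpha> + real (\<kappa> j i)) (a i) x \<partial>lborel))"
    if [measurable]: "\<And>i. g i \<in> borel_measurable borel" for g :: "nat \<Rightarrow> real \<Rightarrow> ennreal"
  proof -
    have "(\<integral>\<^sup>+x. (\<Prod>i\<le>n. g i (x i)) \<partial>\<mu>) = (\<integral>\<^sup>+x. p x * (\<Prod>i\<le>n. g i (x i)) \<partial>?L)"
      unfolding \<mu>_def by (intro nn_integral_density) auto
    also have "\<dots> = (\<integral>\<^sup>+x. (\<Sum>j. ennreal C * c j * (\<Prod>i\<le>n. g i (x i) * gamma_dens (\<alpha> + real (\<kappa> j i)) (a i) (x i))) \<partial>?L)"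
    proof (intro nn_integral_cong)
      fix x
      let ?P = "\<lambda>j. \<Prod>i\<le>n. gamma_dens (\<alpha> + real (\<kappa> j i)) (a i) (x i)"
      have "p x * (\<Prod>i\<le>n. g i (x i)) = (\<Sum>j. ennreal C * c j * ?P j * (\<Prod>i\<le>n. g i (x i)))"
        unfolding p_def by (rule ennreal_suminf_multc[symmetric])
      also have "\<dots> = (\<Sum>j. ennreal C * c j * (\<Prod>i\<le>n. g i (x i) * gamma_dens (\<alpha> + real (\<kappa> j i)) (a i) (x i)))"
        by (simp only: prod.distrib mult_ac)
      finally show "p x * (\<Prod>i\<le>n. g i (x i)) =
          (\<Sum>j. ennreal C * c j * (\<Prod>i\<le>n. g i (x i) * gamma_dens (\<alpha> + real (\<kappa> j i)) (a i) (x i)))" .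
    qed
    also have "\<dots> = (\<Sum>j. \<integral>\<^sup>+x. ennreal C * c j * (\<Prod>i\<le>n. g i (x i) * gamma_dens (\<alpha> + real (\<kappa> j i)) (a i) (x i)) \<partial>?L)"
      by (intro nn_integral_suminf) measurable
    also have "\<dots> = (\<Sum>j. ennreal C * c j * (\<integral>\<^sup>+x. (\<Prod>i\<le>n. g i (x i) * gamma_dens (\<alpha> + real (\<kappa> j i)) (a i) (x i)) \<partial>?L))"
      by (subst nn_integral_cmult) measurable
    also have "\<dots> = (\<Sum>j. ennreal C * c j * (\<Prod>i\<le>n. \<integral>\<^sup>+x. g i x * gamma_dens (\<alpha> + real (\<kappa> j i)) (a i) x \<partial>lborel))"
      by (subst L.product_nn_integral_prod) auto
    finally show ?thesis .
  qed
  have laplace: "laplace {..n} \<mu> s = ennreal (?det s powr (- \<alpha>))"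
    if s: "\<forall>i\<le>n. 0 < a i + s i" "pivots_pos t n s (\<lambda>i. f (t i) * s i)" for s
  proof -
    have "laplace {..n} \<mu> s = (\<integral>\<^sup>+x. (\<Prod>i\<le>n. ennreal (exp (- s i * x i))) \<partial>\<mu>)"
      by (simp add: exp_sum prod_ennreal flip: sum_negf)
    also have "\<dots> = (\<Sum>j. ennreal C * c j * (\<Prod>i\<le>n. \<integral>\<^sup>+x. ennreal (exp (- s i * x)) * gamma_dens (\<alpha> + real (\<kappa> j i)) (a i) x \<partial>lborel))"
      by (rule prod_int) measurable
    also have "\<dots> = (\<Sum>j. ennreal C * c j * (\<Prod>i\<le>n. ennreal (?Y s i powr (\<alpha> + real (\<kappa> j i)))))"
      using s \<alpha> a by (intro suminf_cong arg_cong2[where f = "(*)"] refl prod.cong gamma_dens_laplace) auto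
    also have "\<dots> = (\<Sum>j. ennreal C * c j * (\<Prod>i\<le>n. ennreal (?Y s i powr \<alpha>) * y_of s i ^ \<kappa> j i))"
    proof (intro suminf_cong arg_cong2[where f = "(*)"] refl prod.cong)
      fix j i assume "i \<in> {..n}"
      then have "0 < ?Y s i" using s a[of i] by auto
      then show "ennreal (?Y s i powr (\<alpha> + real (\<kappa> j i))) = ennreal (?Y s i powr \<alpha>) * y_of s i ^ \<kappa> j i"
        by (simp add: powr_add powr_realpow y_of_def ennreal_mult ennreal_power)
    qed
    also have "\<dots> = ennreal C * (\<Prod>i\<le>n. ennreal (?Y s i powr \<alpha>)) * F (y_of s)"
      unfolding c ennreal_suminf_cmult[symmetric] by (simp only: prod.distrib mult_ac)
    finally show ?thesis using det[OF s] by simp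
  qed
  have "pivots_pos t n (\<lambda>_. 0) (\<lambda>i. f (t i) * (\<lambda>_. 0) i)"
    by (rule pivots_pos_nonneg[OF strict_mono_t t0_pos]) auto
  note l0 = laplace[OF _ this] det[OF _ this]
  have d0: "?det (\<lambda>_. 0) = 1"
  proof -
    have "Matrix.mat (Suc n) (Suc n) (\<lambda>(i, j). (if i = j then 1 else 0) + min (t i) (t j) * 0 + f (t j) * 0) = 1\<^sub>m (Suc n)"
      by (rule eq_matI) auto
    then show ?thesis unfolding kernel_det_def by simp
  qed
  have one: "emeasure \<mu> (space \<mu>) = 1"
    using l0(1) a d0 by simp
  have Cc: "(\<Sum>j. ennreal C * c j) = 1"
    using l0(2) a d0 less_imp_neq[OF a] unfolding c y_of_def 
    by (simp add: c)
  have ps: "prob_space \<mu>" by (rule prob_spaceI) (rule one)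
  have sets: "sets \<mu> = sets (PiM {..n} (\<lambda>_. borel))"
    unfolding \<mu>_def by (simp cong: sets_PiM_cong)
  have pos: "AE x in \<mu>. \<forall>i\<le>n. 0 \<le> x i"
  proof -
    have "0 \<le> x i" if "0 < p x" "i \<le> n" for x i
    proof (rule ccontr)
      assume "\<not> 0 \<le> x i"
      then have "(\<Prod>i\<le>n. gamma_dens (\<alpha> + real (\<kappa> j i)) (a i) (x i)) = 0" for j
        using that(2) by (intro prod_zero bexI[of _ i]) (auto simp: gamma_dens_def)
      then have "p x = 0" unfolding p_def by (simp only: mult_zero_right suminf_zero)
      then show False using that(1) by simp
    qed
    then show ?thesis unfolding \<mu>_def by (subst AE_density) auto
  qed
  have dom: "emeasure \<mu> {x \<in> space \<mu>. \<forall>i\<le>n. x i \<le> b i} \<le>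
       (\<Prod>i\<le>n. gamma_cdf \<alpha> (a i) (b i))" (is "_ \<le> ?R") for b
  proof -
    have [measurable]: "(\<lambda>x. x i) \<in> borel_measurable \<mu>" if "i \<le> n" for i
      using that unfolding measurable_cong_sets[OF sets refl] by simp
    have "emeasure \<mu> {x \<in> space \<mu>. \<forall>i\<le>n. x i \<le> b i} = (\<integral>\<^sup>+x. indicator {x \<in> space \<mu>. \<forall>i\<le>n. x i \<le> b i} x \<partial>\<mu>)"
      by (intro nn_integral_indicator[symmetric]) measurable
    also have "\<dots> = (\<integral>\<^sup>+x. (\<Prod>i\<le>n. indicator {..b i} (x i)) \<partial>\<mu>)"
    proof (intro nn_integral_cong)
      fix x assume "x \<in> space \<mu>"
      then show "indicator {x \<in> space \<mu>. \<forall>i\<le>n. x i \<le> b i} x = (\<Prod>i\<le>n. indicator {..b i} (x i) :: ennreal)"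
        by (cases "\<forall>i\<le>n. x i \<le> b i") (auto simp: prod_zero_iff indicator_def)
    qed
    also have "\<dots> = (\<Sum>j. ennreal C * c j * (\<Prod>i\<le>n. gamma_cdf (\<alpha> + real (\<kappa> j i)) (a i) (b i)))"
      by (rule prod_int) measurable
    also have "\<dots> \<le> (\<Sum>j. ennreal C * c j * ?R)"
      by (intro suminf_le mult_left_mono prod_mono_ennreal gamma_cdf_add_le \<alpha> a) auto
    also have "\<dots> = ?R" using Cc by (simp only: ennreal_suminf_multc) simp
    finally show ?thesis .
  qed
  show ?thesis using ps sets pos laplace dom by blast
qed

end

section \<open>Laplace transforms determine measures\<close>

text \<open>
The characteristic function of a law on the unit interval is a power series in its moments.
\<close>
lemma moments_determine_unit_interval:
  fixes M N :: "real measure"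
  assumes "real_distribution M" "real_distribution N"
    and M: "AE y in M. 0 \<le> y \<and> y \<le> 1" and N: "AE y in N. 0 \<le> y \<and> y \<le> 1"
    and mom: "\<And>k :: nat. (\<integral>y. y ^ k \<partial>M) = (\<integral>y. y ^ k \<partial>N)"
  shows "M = N"
proof (rule Levy_uniqueness[OF assms(1,2)], rule ext)
  fix u :: real
  have char: "char P u = (\<Sum>k. (\<i> * complex_of_real u) ^ k / fact k * complex_of_real (\<integral>y. y ^ k \<partial>P))"
    if "real_distribution P" and P: "AE y in P. 0 \<le> y \<and> y \<le> 1" for P
  proof -
    interpret P: real_distribution P by fact
    define g where "g k y = (\<i> * complex_of_real u) ^ k / fact k * complex_of_real (y ^ k)" for k :: nat and y
    have ng: "norm (g k y) = \<bar>u\<bar> ^ k / fact k * \<bar>y\<bar> ^ k" for k y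
      by (simp add: g_def norm_mult norm_divide norm_power power_abs)
    have nb: "norm (g k y) \<le> \<bar>u\<bar> ^ k / fact k" if "0 \<le> y \<and> y \<le> 1" for k y
      unfolding ng using that by (intro mult_left_le) (auto intro: power_le_one)
    have iy: "integrable P (\<lambda>y. y ^ k)" for k :: nat
      by (rule P.integrable_const_bound[where B = 1]) (use P in \<open>auto simp: power_le_one power_abs\<close>)
    have ig: "integrable P (g k)" for k
      unfolding g_def by (intro integrable_mult_right integrable_of_real iy)
    have ser: "summable (\<lambda>k. \<bar>u\<bar> ^ k / fact k)"
      using summable_exp_generic[of "\<bar>u\<bar>"] by (simp add: divide_inverse mult_ac)
    have "(\<integral>y. norm (g k y) \<partial>P) \<le> \<bar>u\<bar> ^ k / fact k" for k
    proof -
      have "(\<integral>y. norm (g k y) \<partial>P) \<le> (\<integral>y. \<bar>u\<bar> ^ k / fact k \<partial>P)"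
        by (intro integral_mono_AE integrable_norm ig) (use P nb in auto)
      then show ?thesis using P.prob_space by simp
    qed
    then have sI: "summable (\<lambda>k. \<integral>y. norm (g k y) \<partial>P)"
      by (intro summable_comparison_test[OF _ ser]) (auto simp: exI[of _ 0] intro!: exI[of _ "0::nat"])
    have sA: "AE y in P. summable (\<lambda>k. norm (g k y))"
      using P by eventually_elim (auto intro!: summable_comparison_test[OF _ ser] exI[of _ "0::nat"] nb)
    have "char P u = (\<integral>y. (\<Sum>k. g k y) \<partial>P)"
    proof -
      have "(\<Sum>k. g k y) = iexp (u * y)" for y
      proof -
        have "(\<lambda>k. (\<i> * complex_of_real (u * y)) ^ k /\<^sub>R fact k) sums exp (\<i> * complex_of_real (u * y))"
          by (rule exp_converges)
        moreover have "(\<i> * complex_of_real (u * y)) ^ k /\<^sub>R fact k = g k y" for k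
          by (simp add: g_def scaleR_conv_of_real power_mult_distrib divide_inverse mult_ac)
        ultimately show ?thesis by (simp add: sums_iff)
      qed
      then show ?thesis by (simp add: char_def)
    qed
    also have "\<dots> = (\<Sum>k. \<integral>y. g k y \<partial>P)"
      by (rule integral_suminf[OF ig sA sI])
    also have "\<dots> = (\<Sum>k. (\<i> * complex_of_real u) ^ k / fact k * complex_of_real (\<integral>y. y ^ k \<partial>P))"
      unfolding g_def by (simp only: integral_mult_right_zero integral_complex_of_real)
    finally show ?thesis .
  qed
  show "char M u = char N u"
    using char[OF assms(1) M] char[OF assms(2) N] mom by simp
qed

text \<open>
Weight the measure by \<open>exp (- x)\<close>, normalise it and transport it by \<open>x \<mapsto> exp (- x)\<close>. The moments of
the resulting law on the unit interval are the values of the Laplace transform at 1, 2, \<open>\<dots>\<close>, divided by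
the normalising mass. The weight is positive and the map injective, so the measure can be recovered.
\<close>
lemma laplace_determines_measure:
  fixes M N :: "real measure"
  assumes "finite_measure M" "finite_measure N" and [measurable_cong]: "sets M = sets borel" "sets N = sets borel"
    and M: "AE x in M. 0 \<le> x" and N: "AE x in N. 0 \<le> x"
    and lap: "\<And>s. s > 0 \<Longrightarrow> (\<integral>\<^sup>+x. ennreal (exp (- s * x)) \<partial>M) = (\<integral>\<^sup>+x. ennreal (exp (- s * x)) \<partial>N)"
  shows "M = N"
proof -
  let ?w = "\<lambda>x :: real. ennreal (exp (- x))"
  define m where "m = (\<integral>\<^sup>+x. ?w x \<partial>M)"
  have mN: "m = (\<integral>\<^sup>+x. ?w x \<partial>N)" using lap[of 1] by (simp add: m_def)
  show ?thesis
  proof (cases "m = 0")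
    case True
    have z: "P = null_measure borel" if s[measurable_cong]: "sets P = sets borel" and z: "(\<integral>\<^sup>+x. ?w x \<partial>P) = 0" for P :: "real measure"
    proof (rule measure_eqI)
      have "AE x in P. ?w x = 0" using z by (subst (asm) nn_integral_0_iff_AE) auto
      then have "AE x in P. False" by eventually_elim simp
      then show "emeasure P A = emeasure (null_measure borel) A" if "A \<in> sets P" for A
      proof -
        have "emeasure P A = emeasure P {}"
          by (rule emeasure_eq_AE) (use that \<open>AE x in P. False\<close> in auto)
        then show ?thesis by simp
      qed
    qed (simp add: s)
    show ?thesis using z[of M] z[of N] assms True mN m_def by simp
  next
    case False
    have mfin: "m < \<infinity>"
    proof -
      have "m \<le> (\<integral>\<^sup>+x. 1 \<partial>M)" unfolding m_def
        by (intro nn_integral_mono_AE) (use M in \<open>auto simp: ennreal_le_1\<close>)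
      also have "\<dots> = emeasure M (space M)" by simp
      also have "\<dots> < \<infinity>" using finite_measure.emeasure_finite[OF assms(1)] by (simp add: top.not_eq_extremum)
      finally show ?thesis .
    qed
    define D where "D P = distr (density P (\<lambda>x. ?w x / m)) borel (\<lambda>x. exp (- x))" for P :: "real measure"
    have DI: "(\<integral>\<^sup>+y. g y \<partial>D P) = (\<integral>\<^sup>+x. ?w x / m * g (exp (- x)) \<partial>P)"
      if [measurable_cong]: "sets P = sets borel" and [measurable]: "g \<in> borel_measurable borel" for P g
      unfolding D_def by (subst nn_integral_distr) (auto intro!: nn_integral_density)
    have key: "real_distribution (D P) \<and> (AE y in D P. 0 \<le> y \<and> y \<le> 1) \<and>
        (\<forall>k :: nat. (\<integral>y. y ^ k \<partial>D P) = enn2real ((\<integral>\<^sup>+x. ennreal (exp (- (real k + 1) * x)) \<partial>P) / m))"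
      if s[measurable_cong]: "sets P = sets borel" and m: "m = (\<integral>\<^sup>+x. ?w x \<partial>P)" and P: "AE x in P. 0 \<le> x" for P
    proof -
      have "emeasure (D P) (space (D P)) = (\<integral>\<^sup>+y. 1 \<partial>D P)" by simp
      also have "\<dots> = (\<integral>\<^sup>+x. ?w x / m \<partial>P)" by (subst DI[OF s]) auto
      also have "\<dots> = m / m" by (subst nn_integral_divide) (auto simp: m)
      also have "\<dots> = 1" using False mfin by (intro ennreal_divide_self) auto
      finally have "prob_space (D P)" by (rule prob_spaceI)
      then have rd: "real_distribution (D P)"
        by (simp add: real_distribution_def real_distribution_axioms_def D_def)
      have ae: "AE y in D P. 0 \<le> y \<and> y \<le> 1"
        unfolding D_def using P by (subst AE_distr_iff) (auto simp: AE_density elim!: eventually_mono)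
      have "(\<integral>y. y ^ k \<partial>D P) = enn2real ((\<integral>\<^sup>+x. ennreal (exp (- (real k + 1) * x)) \<partial>P) / m)" for k :: nat
      proof -
        have "(\<integral>y. y ^ k \<partial>D P) = enn2real (\<integral>\<^sup>+y. ennreal (y ^ k) \<partial>D P)"
          by (intro integral_eq_nn_integral) (use ae in \<open>auto simp: D_def\<close>)
        also have "(\<integral>\<^sup>+y. ennreal (y ^ k) \<partial>D P) = (\<integral>\<^sup>+x. ?w x / m * ennreal (exp (- x) ^ k) \<partial>P)"
          by (rule DI[OF s]) measurable
        also have "\<dots> = (\<integral>\<^sup>+x. ennreal (exp (- (real k + 1) * x)) / m \<partial>P)"
        proof (intro nn_integral_cong)
          fix x :: real
          have "exp (- x) * exp (- x) ^ k = exp (- (real k + 1) * x)"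
            by (simp add: algebra_simps flip: exp_of_nat_mult exp_add)
          then have "?w x * ennreal (exp (- x) ^ k) = ennreal (exp (- (real k + 1) * x))"
            by (simp flip: ennreal_mult)
          then show "?w x / m * ennreal (exp (- x) ^ k) = ennreal (exp (- (real k + 1) * x)) / m"
            by (simp add: divide_ennreal_def mult_ac)
        qed
        also have "\<dots> = (\<integral>\<^sup>+x. ennreal (exp (- (real k + 1) * x)) \<partial>P) / m"
          by (intro nn_integral_divide) auto
        finally show ?thesis .
      qed
      with rd ae show ?thesis by blast
    qed
    have lk: "(\<integral>\<^sup>+x. ennreal (exp (- (real k + 1) * x)) \<partial>M) = (\<integral>\<^sup>+x. ennreal (exp (- (real k + 1) * x)) \<partial>N)" for k :: nat
      by (rule lap) simp
    have DMN: "D M = D N"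
    proof (rule moments_determine_unit_interval)
      fix k :: nat
      have "(\<integral>y. y ^ k \<partial>D M) = enn2real ((\<integral>\<^sup>+x. ennreal (exp (- (real k + 1) * x)) \<partial>M) / m)"
        using key[OF assms(3) m_def M] by blast
      also have "\<dots> = (\<integral>y. y ^ k \<partial>D N)"
        unfolding lk using key[OF assms(4) mN N] by metis
      finally show "(\<integral>y. y ^ k \<partial>D M) = (\<integral>y. y ^ k \<partial>D N)" .
    qed (use key[OF assms(3) m_def M] key[OF assms(4) mN N] in \<open>blast+\<close>)
    have invert: "emeasure P A = (\<integral>\<^sup>+y. indicator A (- ln y) * (m * ennreal (1 / y)) \<partial>D P)"
      if s[measurable_cong]: "sets P = sets borel" and [measurable]: "A \<in> sets borel" for P A
    proof -
      have "(\<integral>\<^sup>+y. indicator A (- ln y) * (m * ennreal (1 / y)) \<partial>D P) =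
          (\<integral>\<^sup>+x. ?w x / m * (indicator A (- ln (exp (- x))) * (m * ennreal (1 / exp (- x)))) \<partial>P)"
        by (rule DI[OF s]) measurable
      also have "\<dots> = (\<integral>\<^sup>+x. indicator A x \<partial>P)"
      proof (intro nn_integral_cong)
        fix x :: real
        have "?w x / m * (m * ennreal (1 / exp (- x))) = (m / m) * (?w x * ennreal (1 / exp (- x)))"
          by (simp add: divide_ennreal_def mult_ac)
        also have "\<dots> = 1" using False mfin by (simp add: ennreal_divide_self flip: ennreal_mult)
        finally show "?w x / m * (indicator A (- ln (exp (- x))) * (m * ennreal (1 / exp (- x)))) = indicator A x"
          by (simp add: indicator_def)
      qed
      finally show ?thesis using s by simp
    qed
    show ?thesis
      using assms by (intro measure_eqI) (auto simp: invert DMN)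
  qed
qed

text \<open>
In the integral of a product of functions of single coordinates, the exponentials are replaced by indicator
functions one coordinate at a time: with the remaining factors as a density, the distribution of the
coordinate in question is a finite measure on the line, which its Laplace transform determines.
\<close>
lemma laplace_determines_measure_PiM:
  fixes M N :: "('i \<Rightarrow> real) measure"
  assumes fin: "finite I" and fM: "finite_measure M" "finite_measure N"
    and sM: "sets M = sets (PiM I (\<lambda>_. borel))" and sN: "sets N = sets (PiM I (\<lambda>_. borel))"
    and nM: "AE x in M. \<forall>i\<in>I. 0 \<le> x i" and nN: "AE x in N. \<forall>i\<in>I. 0 \<le> x i"
    and lap: "\<And>s. (\<And>i. i \<in> I \<Longrightarrow> s i > 0) \<Longrightarrow>
      laplace I M s = laplace I N s"
  shows "M = N"
proof -
  define J where "J P K B s = (\<integral>\<^sup>+x. (\<Prod>i\<in>K. indicator (B i) (x i)) * ennreal (exp (- (\<Sum>i\<in>I - K. s i * x i))) \<partial>P)"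
    for P :: "('i \<Rightarrow> real) measure" and K :: "'i set" and B :: "'i \<Rightarrow> real set" and s :: "'i \<Rightarrow> real"
  have eq: "J M K B s = J N K B s"
    if "K \<subseteq> I" "\<And>i. B i \<in> sets borel" "\<And>i. i \<in> I \<Longrightarrow> s i > 0" for K B s
    using finite_subset[OF that(1) fin] that
  proof (induction K arbitrary: B s rule: finite_induct)
    case empty
    then show ?case using lap[of s] by (simp add: J_def)
  next
    case (insert j K)
    let ?R = "I - insert j K"
    let ?g = "\<lambda>x. (\<Prod>i\<in>K. indicator (B i) (x i)) * ennreal (exp (- (\<Sum>i\<in>?R. s i * x i)))"
    have j: "j \<in> I" and KI: "K \<subseteq> I" using insert by auto
    define D where "D P = distr (density P ?g) borel (\<lambda>x. x j)" for P :: "('i \<Rightarrow> real) measure"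
    have DI: "(\<integral>\<^sup>+y. h y \<partial>D P) = (\<integral>\<^sup>+x. ?g x * h (x j) \<partial>P)"
      and gm: "?g \<in> borel_measurable P"
      if s: "sets P = sets (PiM I (\<lambda>_. borel))" and [measurable]: "h \<in> borel_measurable borel" for P h
    proof -
      have [measurable]: "(\<lambda>x. x i) \<in> borel_measurable P" if "i \<in> I" for i
        using that unfolding measurable_cong_sets[OF s refl] by simp
      have [measurable]: "(\<lambda>x. x j) \<in> borel_measurable P" using j by simp
      have [measurable]: "B i \<in> sets borel" for i using insert.prems by simp
      have "(\<lambda>x. indicator (B i) (x i) :: ennreal) \<in> borel_measurable P" if "i \<in> K" for i
        using that KI by (intro measurable_compose[where N = borel, OF _ borel_measurable_indicator]) auto
      then show g[measurable]: "?g \<in> borel_measurable P"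
        by (intro borel_measurable_times_ennreal borel_measurable_prod_ennreal) auto
      show "(\<integral>\<^sup>+y. h y \<partial>D P) = (\<integral>\<^sup>+x. ?g x * h (x j) \<partial>P)"
        unfolding D_def by (subst nn_integral_distr) (auto intro!: nn_integral_density)
    qed
    have fD: "finite_measure (D P) \<and> (AE y in D P. 0 \<le> y)"
      if s: "sets P = sets (PiM I (\<lambda>_. borel))" and f: "finite_measure P" and n: "AE x in P. \<forall>i\<in>I. 0 \<le> x i" for P
    proof -
      have [measurable]: "(\<lambda>x. x j) \<in> borel_measurable P"
        using j unfolding measurable_cong_sets[OF s refl] by simp
      have "emeasure (D P) (space (D P)) = (\<integral>\<^sup>+y. 1 \<partial>D P)" by simp
      also have "\<dots> = (\<integral>\<^sup>+x. ?g x \<partial>P)" by (subst DI[OF s]) auto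
      also have "\<dots> \<le> (\<integral>\<^sup>+x. 1 \<partial>P)"
      proof (intro nn_integral_mono_AE)
        show "AE x in P. ?g x \<le> 1" using n
        proof eventually_elim
          case (elim x)
          have "(\<Prod>i\<in>K. indicator (B i) (x i) :: ennreal) \<le> (\<Prod>i\<in>K. 1)"
            by (intro prod_mono_ennreal) (auto simp: indicator_def)
          moreover have "ennreal (exp (- (\<Sum>i\<in>?R. s i * x i))) \<le> 1"
          proof -
            have "0 \<le> (\<Sum>i\<in>?R. s i * x i)"
              using elim insert.prems(3) by (intro sum_nonneg mult_nonneg_nonneg) (auto intro: less_imp_le)
            then show ?thesis by (simp add: ennreal_le_1)
          qed
          ultimately show ?case using mult_mono[of _ "1::ennreal" _ 1] by simp
        qed
      qed
      also have "\<dots> = emeasure P (space P)" by simp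
      also have "\<dots> < \<infinity>" using finite_measure.emeasure_finite[OF f] by (simp add: top.not_eq_extremum)
      finally have "finite_measure (D P)" by (intro finite_measureI) auto
      moreover have "AE y in D P. 0 \<le> y"
        unfolding D_def using n j gm[OF s, of "\<lambda>_. 0"]
        by (subst AE_distr_iff) (auto simp: AE_density elim!: eventually_mono)
      ultimately show ?thesis ..
    qed
    have "D M = D N"
    proof (rule laplace_determines_measure)
      fix r :: real assume r: "r > 0"
      have "(\<integral>\<^sup>+y. ennreal (exp (- r * y)) \<partial>D P) = J P K B (s(j := r))"
        if s: "sets P = sets (PiM I (\<lambda>_. borel))" for P
      proof -
        have R: "I - K = insert j ?R" using insert.hyps j by auto
        have e: "(\<Sum>i\<in>I - K. (s(j := r)) i * x i) = r * x j + (\<Sum>i\<in>?R. s i * x i)" for x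
        proof -
          have "(\<Sum>i\<in>I - K. (s(j := r)) i * x i) =
              (s(j := r)) j * x j + (\<Sum>i\<in>?R. (s(j := r)) i * x i)"
            unfolding R using fin by (intro sum.insert) auto
          also have "(\<Sum>i\<in>?R. (s(j := r)) i * x i) = (\<Sum>i\<in>?R. s i * x i)"
            by (intro sum.cong) auto
          finally show ?thesis by simp
        qed
        have "?g x * ennreal (exp (- r * x j)) = (\<Prod>i\<in>K. indicator (B i) (x i)) *
             ennreal (exp (- (\<Sum>i\<in>I - K. (s(j := r)) i * x i)))" for x
        proof -
          have "exp (- (\<Sum>i\<in>?R. s i * x i)) * exp (- r * x j) = exp (- (\<Sum>i\<in>I - K. (s(j := r)) i * x i))"
            unfolding e by (simp flip: exp_add)
          then show ?thesis by (simp add: mult.assoc flip: ennreal_mult)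
        qed
        then show ?thesis unfolding J_def by (subst DI[OF s]) auto
      qed
      moreover have "J M K B (s(j := r)) = J N K B (s(j := r))"
        using KI insert.prems r by (intro insert.IH) auto
      ultimately show "(\<integral>\<^sup>+y. ennreal (exp (- r * y)) \<partial>D M) = (\<integral>\<^sup>+y. ennreal (exp (- r * y)) \<partial>D N)"
        using sM sN by simp
    qed (use fD[OF sM fM(1) nM] fD[OF sN fM(2) nN] in \<open>auto simp: D_def\<close>)
    moreover have "J P (insert j K) B s = (\<integral>\<^sup>+y. indicator (B j) y \<partial>D P)"
      if s: "sets P = sets (PiM I (\<lambda>_. borel))" for P
      unfolding J_def using insert.hyps insert.prems(2) by (subst DI[OF s]) (auto simp: mult_ac)
    ultimately show ?case using sM sN by simp
  qed
  have box: "emeasure P (Pi\<^sub>E I A) = J P I A (\<lambda>_. 1)"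
    if s: "sets P = sets (PiM I (\<lambda>_. borel))" and A: "\<And>i. i \<in> I \<Longrightarrow> A i \<in> sets borel" for P A
  proof -
    have sp: "space P = (\<Pi>\<^sub>E i\<in>I. UNIV)" using sets_eq_imp_space_eq[OF s] by (simp add: space_PiM)
    have "emeasure P (Pi\<^sub>E I A) = (\<integral>\<^sup>+x. indicator (Pi\<^sub>E I A) x \<partial>P)"
      using A fin by (intro nn_integral_indicator[symmetric]) (simp add: s sets_PiM_I_finite)
    also have "\<dots> = J P I A (\<lambda>_. 1)"
      unfolding J_def
    proof (intro nn_integral_cong)
      fix x assume "x \<in> space P"
      then have "x \<in> Pi\<^sub>E I A \<longleftrightarrow> (\<forall>i\<in>I. x i \<in> A i)" unfolding sp by (auto simp: PiE_def Pi_def)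
      then show "indicator (Pi\<^sub>E I A) x = (\<Prod>i\<in>I. indicator (A i) (x i)) * ennreal (exp (- (\<Sum>i\<in>I - I. 1 * x i)))"
        using fin by (cases "x \<in> Pi\<^sub>E I A") (auto simp: prod_zero_iff indicator_def)
    qed
    finally show ?thesis .
  qed
  show ?thesis
  proof (rule measure_eqI_PiM_finite[OF fin sM sN])
    fix A :: "'i \<Rightarrow> real set" assume A: "\<And>i. i \<in> I \<Longrightarrow> A i \<in> sets borel"
    have "emeasure P (Pi\<^sub>E I A) = J P I (\<lambda>i. if i \<in> I then A i else {}) (\<lambda>_. 1)"
      if s: "sets P = sets (PiM I (\<lambda>_. borel))" for P
      using box[OF s, of "\<lambda>i. if i \<in> I then A i else {}"] A by (auto cong: PiE_cong)
    then show "emeasure M (Pi\<^sub>E I A) = emeasure N (Pi\<^sub>E I A)"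
      using eq[of I "\<lambda>i. if i \<in> I then A i else {}" "\<lambda>_. 1"] A sM sN by simp
  next
    show "range (\<lambda>_ :: nat. \<Pi>\<^sub>E i\<in>I. UNIV) \<subseteq> prod_algebra I (\<lambda>_. borel :: real measure)"
      using fin by (auto intro!: prod_algebraI_finite)
    show "(\<Union>i :: nat. \<Pi>\<^sub>E i\<in>I. UNIV) = space (PiM I (\<lambda>_. borel :: real measure))" by (simp add: space_PiM)
    show "\<And>i :: nat. emeasure M (\<Pi>\<^sub>E i\<in>I. UNIV) \<noteq> \<infinity>" using finite_measure.emeasure_finite[OF fM(1)] by simp
  qed
qed

section \<open>Determinants under repetition and selection of times\<close>

text \<open>
Multiplying the block matrix with blocks \<open>I, - A, B, I\<close> by a unipotent one from the right and from the
left gives two block triangular matrices, with the two sides as their determinants.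
\<close>
lemma det_one_plus_mult_commute:
  fixes A B :: "'a :: idom mat"
  assumes A: "A \<in> carrier_mat n m" and B: "B \<in> carrier_mat m n"
  shows "Determinant.det (1\<^sub>m n + A * B) = Determinant.det (1\<^sub>m m + B * A)"
proof -
  let ?X = "four_block_mat (1\<^sub>m n) (- A) B (1\<^sub>m m)"
  let ?Y = "four_block_mat (1\<^sub>m n) A (0\<^sub>m m n) (1\<^sub>m m)"
  have X: "?X \<in> carrier_mat (n + m) (n + m)" and Y: "?Y \<in> carrier_mat (n + m) (n + m)"
    using A B by auto
  have XY: "?X * ?Y = four_block_mat (1\<^sub>m n) (0\<^sub>m n m) B (1\<^sub>m m + B * A)"
    using A B by (subst mult_four_block_mat[OF one_carrier_mat uminus_carrier_mat[OF A] B one_carrier_mat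
        one_carrier_mat A zero_carrier_mat one_carrier_mat])
      (auto intro!: cong_four_block_mat simp: comm_add_mat)
  have YX: "?Y * ?X = four_block_mat (1\<^sub>m n + A * B) (0\<^sub>m n m) B (1\<^sub>m m)"
    using A B by (subst mult_four_block_mat[OF one_carrier_mat A zero_carrier_mat one_carrier_mat
        one_carrier_mat uminus_carrier_mat[OF A] B one_carrier_mat])
      (auto intro!: cong_four_block_mat)
  have "Determinant.det (?X * ?Y) = Determinant.det (1\<^sub>m m + B * A)"
    unfolding XY using A B by (subst det_four_block_mat_upper_right_zero) auto
  moreover have "Determinant.det (?Y * ?X) = Determinant.det (1\<^sub>m n + A * B)"
    unfolding YX using A B by (subst det_four_block_mat_upper_right_zero) auto
  ultimately show ?thesis using det_mult[OF X Y] det_mult[OF Y X] by (simp add: mult.commute)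
qed

text \<open>
The kernel matrix at the times with indices \<open>e i\<close> is \<open>A V\<close> times the transpose of \<open>A\<close>, where \<open>A\<close> selects
rows by \<open>e\<close>. Moving \<open>A\<close> to the other side adds up the weights of equal times. As \<open>e\<close> need not be
injective, surjective or monotone, this covers repetition, omission and reordering.
\<close>
lemma det_merge_times:
  fixes V :: "real mat" and e :: "nat \<Rightarrow> nat"
  assumes V: "V \<in> carrier_mat m m" and e: "\<And>i. i < n \<Longrightarrow> e i < m"
  shows "Determinant.det (1\<^sub>m n + Matrix.mat n n (\<lambda>(i, j). V $$ (e i, e j)) * mat_diag n s) =
    Determinant.det (1\<^sub>m m + V * mat_diag m (\<lambda>k. \<Sum>i | i < n \<and> e i = k. s i))"
proof -
  define A where "A = Matrix.mat n m (\<lambda>(i, k). if e i = k then 1 else 0 :: real)"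
  define B where "B = Matrix.mat m n (\<lambda>(k, j). V $$ (k, e j) * s j)"
  have A: "A \<in> carrier_mat n m" and B: "B \<in> carrier_mat m n" by (auto simp: A_def B_def)
  have "A * B = Matrix.mat n n (\<lambda>(i, j). V $$ (e i, e j)) * mat_diag n s"
  proof (rule eq_matI)
    fix i j assume "i < dim_row (Matrix.mat n n (\<lambda>(i, j). V $$ (e i, e j)) * mat_diag n s)"
      "j < dim_col (Matrix.mat n n (\<lambda>(i, j). V $$ (e i, e j)) * mat_diag n s)"
    then have ij: "i < n" "j < n" by (auto simp: mat_diag_def)
    have "(A * B) $$ (i, j) = (\<Sum>k\<in>{0..<m}. (if e i = k then 1 else 0) * (V $$ (k, e j) * s j))"
      using ij by (simp add: A_def B_def scalar_prod_def)
    also have "\<dots> = (\<Sum>k\<in>{0..<m}. if e i = k then V $$ (k, e j) * s j else 0)"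
      by (intro sum.cong) auto
    also have "\<dots> = V $$ (e i, e j) * s j" using e[OF ij(1)] by simp
    also have "\<dots> = (Matrix.mat n n (\<lambda>(i, j). V $$ (e i, e j)) * mat_diag n s) $$ (i, j)"
      using ij by (subst mat_diag_mult_right[of _ n]) auto
    finally show "(A * B) $$ (i, j) = (Matrix.mat n n (\<lambda>(i, j). V $$ (e i, e j)) * mat_diag n s) $$ (i, j)" .
  qed (auto simp: A_def B_def mat_diag_def)
  moreover have "B * A = V * mat_diag m (\<lambda>k. \<Sum>i | i < n \<and> e i = k. s i)"
  proof (rule eq_matI)
    fix k l assume "k < dim_row (V * mat_diag m (\<lambda>k. \<Sum>i | i < n \<and> e i = k. s i))"
      "l < dim_col (V * mat_diag m (\<lambda>k. \<Sum>i | i < n \<and> e i = k. s i))"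
    then have kl: "k < m" "l < m" using V by (auto simp: mat_diag_def)
    have "(B * A) $$ (k, l) = (\<Sum>j\<in>{0..<n}. V $$ (k, e j) * s j * (if e j = l then 1 else 0))"
      using kl by (simp add: A_def B_def scalar_prod_def)
    also have "\<dots> = (\<Sum>j\<in>{0..<n}. if e j = l then V $$ (k, l) * s j else 0)"
      by (intro sum.cong) auto
    also have "\<dots> = (\<Sum>j | j < n \<and> e j = l. V $$ (k, l) * s j)"
      by (subst sum.inter_filter[symmetric]) auto
    also have "\<dots> = V $$ (k, l) * (\<Sum>i | i < n \<and> e i = l. s i)" by (simp add: sum_distrib_left)
    also have "\<dots> = (V * mat_diag m (\<lambda>k. \<Sum>i | i < n \<and> e i = k. s i)) $$ (k, l)"
      using kl V by (subst mat_diag_mult_right[OF V]) auto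
    finally show "(B * A) $$ (k, l) = (V * mat_diag m (\<lambda>k. \<Sum>i | i < n \<and> e i = k. s i)) $$ (k, l)" .
  qed (use V in \<open>auto simp: A_def B_def mat_diag_def\<close>)
  ultimately show ?thesis using det_one_plus_mult_commute[OF A B] by simp
qed

section \<open>Positive concave functions on the half-line\<close>

locale pos_concave =
  fixes f :: "real \<Rightarrow> real"
  assumes positive_f: "\<And>t. t > 0 \<Longrightarrow> f t > 0" and f_concave: "concave_on {0<..} f"
begin

lemma slopes_decrease:
  assumes "0 < r" "r < s" "s < t"
  shows "(f t - f s) / (t - s) \<le> (f s - f r) / (s - r)"
proof -
  have c: "convex_on {0<..} (\<lambda>x. - f x)" using f_concave by (simp add: concave_on_def)
  have "(- f r - - f s) / (r - s) \<le> (- f r - - f t) / (r - t)"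
    and "(- f r - - f t) / (r - t) \<le> (- f s - - f t) / (s - t)"
    using convex_on_slope_le[OF c, of r t s] assms by auto
  then have "(- f r - - f s) / (r - s) \<le> (- f s - - f t) / (s - t)" by linarith
  moreover have "(- f r - - f s) / (r - s) = - ((f s - f r) / (s - r))"
    "(- f s - - f t) / (s - t) = - ((f t - f s) / (t - s))"
    using assms by (auto simp: field_simps)
  ultimately show ?thesis by linarith
qed

text \<open>
If \<open>f\<close> decreased along one chord, it would lie on or below the line through that chord from there on,
and hence become negative.
\<close>
lemma f_mono:
  assumes "0 < s" "s \<le> t" shows "f s \<le> f t"
proof (rule ccontr)
  assume n: "\<not> f s \<le> f t"
  with assms have st: "s < t" by (cases "s = t") auto
  define m where "m = (f s - f t) / (t - s)"
  have m: "m > 0" using n st by (simp add: m_def)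
  define T where "T = t + f t / m"
  have ft: "f t > 0" using assms positive_f by simp
  then have T: "T > t" using m by (simp add: T_def)
  have "(f T - f t) / (T - t) \<le> - m"
    using slopes_decrease[OF assms(1) st T] by (simp add: m_def minus_divide_left)
  then have "f T - f t \<le> - m * (T - t)" using T by (simp add: divide_le_eq)
  moreover have "m * (T - t) = f t" using m by (simp add: T_def)
  ultimately have "f T \<le> 0" by simp
  then show False using positive_f[of T] T assms by simp
qed

text \<open>
A chord to the right of \<open>s\<close> is at most as steep as the chord from \<open>r\<close> to \<open>s\<close> for \<open>r < s\<close>, whose slope
is at most \<open>f s / (s - r)\<close> since \<open>f r > 0\<close>. Then \<open>r\<close> tends to 0.
\<close>
lemma increment_le:
  assumes "0 < s" "s < t" shows "f t - f s \<le> (t - s) * (f s / s)"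
proof -
  define m where "m = (f t - f s) / (t - s)"
  have m: "m \<ge> 0" using f_mono[of s t] assms by (simp add: m_def)
  have "m * s \<le> f s"
  proof (rule field_le_epsilon)
    fix e :: real assume e: "e > 0"
    define r where "r = min (s / 2) (e / (m + 1))"
    have "r \<le> s / 2" unfolding r_def by (rule min.cobounded1)
    then have r: "0 < r" "r < s" "r \<le> e / (m + 1)" using assms e m by (auto simp: r_def)
    have "m * r \<le> (m + 1) * (e / (m + 1))" using r m by (intro mult_mono) auto
    then have mr: "m * r \<le> e" using m by simp
    have "m \<le> (f s - f r) / (s - r)"
      using slopes_decrease[OF r(1,2) assms(2)] by (simp add: m_def)
    also have "\<dots> \<le> f s / (s - r)" using positive_f[OF r(1)] r by (intro divide_right_mono) auto
    finally have "m * (s - r) \<le> f s" using r by (simp add: le_divide_eq)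
    then show "m * s \<le> f s + e" using mr by (simp add: algebra_simps)
  qed
  then have "m \<le> f s / s" using assms by (simp add: le_divide_eq)
  then have "(t - s) * m \<le> (t - s) * (f s / s)" using assms by (intro mult_left_mono) auto
  then show ?thesis using assms by (simp add: m_def)
qed

lemma ratio_antimono:
  assumes "0 < s" "s \<le> t" shows "f t / t \<le> f s / s"
proof (cases "s = t")
  case False
  then have "f t \<le> f s + (t - s) * (f s / s)" using increment_le[of s t] assms by simp
  also have "\<dots> = t * (f s / s)" using assms by (simp add: field_simps)
  finally show ?thesis using assms by (simp add: divide_le_eq mult.commute)
qed simp

lemma f_continuous: "continuous_on {0<..} f"
proof -
  have "continuous_on {0<..} (\<lambda>x. - f x)"
    using f_concave by (intro convex_on_continuous) (auto simp: concave_on_def)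
  then show ?thesis using continuous_on_minus by fastforce
qed

lemma grid:
  assumes "0 < t 0" "strict_mono t" shows "concave_grid f t"
proof
  have pos: "0 < t k" for k using assms strict_mono_less_eq[OF assms(2), of 0 k] by simp
  have lt: "t k < t (Suc k)" for k using assms(2) by (simp add: strict_mono_def)
  show "0 < f (t k)" for k using positive_f pos by blast
  show "0 \<le> slope f t k" for k
    unfolding slope_def gap_def using f_mono[OF pos[of k], of "t (Suc k)"] lt[of k] by simp
  show "slope f t (Suc k) \<le> slope f t k" for k
    unfolding slope_def gap_def by (rule slopes_decrease[OF pos lt lt])
qed fact+

end

section \<open>Laws and exponential moments of permanental processes\<close>

lemma det_u_tilde_kernel:
  "Determinant.det (1\<^sub>m n + Matrix.mat n n (\<lambda>(i, j). u_tilde f (t i) (t j)) * mat_diag n s) =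
     kernel_det n t s (\<lambda>j. f (t j) * s j)"
proof -
  have "1\<^sub>m n + Matrix.mat n n (\<lambda>(i, j). u_tilde f (t i) (t j)) * mat_diag n s =
      Matrix.mat n n (\<lambda>(i, j). (if i = j then 1 else 0) + min (t i) (t j) * s j + f (t j) * s j)"
    by (subst mat_diag_mult_right[of _ n]) (auto simp: u_tilde_def algebra_simps)
  then show ?thesis by (simp add: kernel_det_def)
qed

lemma permanental_processD:
  assumes "permanental_process M \<alpha> T u X"
  shows permanental_process_prob: "prob_space M" "\<alpha> > 0"
    and permanental_process_meas: "\<And>t. t \<in> T \<Longrightarrow> X t \<in> borel_measurable M"
    and permanental_process_nonneg: "\<And>t \<omega>. t \<in> T \<Longrightarrow> \<omega> \<in> space M \<Longrightarrow> 0 \<le> X t \<omega>"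
    and permanental_process_laplace: "\<And>n t s. (\<And>i. i < n \<Longrightarrow> t i \<in> T) \<Longrightarrow> (\<And>i. i < n \<Longrightarrow> s i > 0) \<Longrightarrow>
      (\<integral>\<omega>. exp (- (\<Sum>i<n. s i * X (t i) \<omega>)) \<partial>M) =
        Determinant.det (1\<^sub>m n + Matrix.mat n n (\<lambda>(i, j). u (t i) (t j)) * mat_diag n s) powr (- \<alpha>)"
proof -
  have v: "permanental_vector M \<alpha> n (Matrix.mat n n (\<lambda>(i, j). u (t i) (t j))) (\<lambda>i. X (t i))"
    if "\<And>i. i < n \<Longrightarrow> t i \<in> T" for n t
    using assms that unfolding permanental_process_def by blast
  show "prob_space M" "\<alpha> > 0" using v[of 0 undefined] by (auto simp: permanental_vector_def)
  show "X t \<in> borel_measurable M" if "t \<in> T" for t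
    using v[of 1 "\<lambda>_. t"] that by (simp add: permanental_vector_def)
  show "0 \<le> X t \<omega>" if "t \<in> T" "\<omega> \<in> space M" for t \<omega>
    using v[of 1 "\<lambda>_. t"] that by (simp add: permanental_vector_def)
  show "(\<integral>\<omega>. exp (- (\<Sum>i<n. s i * X (t i) \<omega>)) \<partial>M) =
        Determinant.det (1\<^sub>m n + Matrix.mat n n (\<lambda>(i, j). u (t i) (t j)) * mat_diag n s) powr (- \<alpha>)"
    if "\<And>i. i < n \<Longrightarrow> t i \<in> T" "\<And>i. i < n \<Longrightarrow> s i > 0" for n t s
    using v[of n t] that unfolding permanental_vector_def by blast
qed

text \<open>
A permanental process has the Laplace transform of the gamma mixture at positive weights, hence the
same law on the grid. This extends the formula to all weights with positive pivots and carries the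
domination over.
\<close>
lemma (in concave_grid) law_on_grid:
  assumes X: "permanental_process M \<alpha> T (u_tilde f) X" and tT: "\<And>i. i \<le> n \<Longrightarrow> t i \<in> T"
  shows "\<lbrakk>\<forall>i\<le>n. 0 < a i + s i; pivots_pos t n s (\<lambda>i. f (t i) * s i)\<rbrakk> \<Longrightarrow>
       (\<integral>\<^sup>+\<omega>. ennreal (exp (- (\<Sum>i\<le>n. s i * X (t i) \<omega>))) \<partial>M) =
         ennreal (kernel_det (Suc n) t s (\<lambda>i. f (t i) * s i) powr (- \<alpha>))" (is "?A1 \<Longrightarrow> ?A2 \<Longrightarrow> ?L")
    and "emeasure M {\<omega> \<in> space M. \<forall>i\<le>n. X (t i) \<omega> \<le> c i} \<le>
       (\<Prod>i\<le>n. gamma_cdf \<alpha> (a i) (c i))"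
proof -
  note XD = permanental_processD[OF X]
  interpret prob_space M by (rule XD(1))
  obtain \<mu> where \<mu>: "prob_space \<mu>" "sets \<mu> = sets (PiM {..n} (\<lambda>_. borel))" "AE x in \<mu>. \<forall>i\<le>n. 0 \<le> x i"
    and lap: "\<And>s. \<forall>i\<le>n. 0 < a i + s i \<Longrightarrow> pivots_pos t n s (\<lambda>i. f (t i) * s i) \<Longrightarrow>
       laplace {..n} \<mu> s =
         ennreal (kernel_det (Suc n) t s (\<lambda>i. f (t i) * s i) powr (- \<alpha>))"
    and dom: "\<And>c. emeasure \<mu> {x \<in> space \<mu>. \<forall>i\<le>n. x i \<le> c i} \<le>
       (\<Prod>i\<le>n. gamma_cdf \<alpha> (a i) (c i))"
    using gamma_mixture[OF XD(2), of n] by auto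
  let ?Z = "\<lambda>\<omega>. \<lambda>i\<in>{..n}. X (t i) \<omega>"
  let ?P = "PiM {..n} (\<lambda>_. borel :: real measure)"
  have Z[measurable]: "?Z \<in> M \<rightarrow>\<^sub>M ?P"
    using XD(3) tT by (intro measurable_restrict) auto
  have meas: "(\<lambda>x. ennreal (exp (- (\<Sum>i\<le>n. s i * x i)))) \<in> borel_measurable ?P" for s :: "nat \<Rightarrow> real"
    by measurable
  have ZI: "laplace {..n} (distr M ?P ?Z) s =
      (\<integral>\<^sup>+\<omega>. ennreal (exp (- (\<Sum>i\<le>n. s i * X (t i) \<omega>))) \<partial>M)" for s
    by (subst nn_integral_distr[OF Z], use meas in simp) (auto intro!: nn_integral_cong arg_cong[where f = ennreal] sum.cong)
  have eq: "distr M ?P ?Z = \<mu>"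
  proof (rule laplace_determines_measure_PiM)
    show "finite_measure (distr M ?P ?Z)" using prob_space_distr[OF Z] by (simp add: prob_space_def)
    show "finite_measure \<mu>" using \<mu>(1) by (simp add: prob_space_def)
    show "AE x in distr M ?P ?Z. \<forall>i\<in>{..n}. 0 \<le> x i"
    proof (subst AE_distr_iff[OF Z])
      show "{x \<in> space ?P. \<forall>i\<in>{..n}. 0 \<le> x i} \<in> sets ?P" by measurable
      show "AE \<omega> in M. \<forall>i\<in>{..n}. 0 \<le> ?Z \<omega> i" using XD(4) tT by auto
    qed
  next
    fix s :: "nat \<Rightarrow> real" assume s: "\<And>i. i \<in> {..n} \<Longrightarrow> s i > 0"
    have ft: "0 \<le> f (t i)" for i using f_pos[of i] by simp
    have "(\<integral>\<^sup>+\<omega>. ennreal (exp (- (\<Sum>i\<le>n. s i * X (t i) \<omega>))) \<partial>M) =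
        ennreal (\<integral>\<omega>. exp (- (\<Sum>i\<le>n. s i * X (t i) \<omega>)) \<partial>M)"
    proof (rule nn_integral_eq_integral)
      have [measurable]: "X (t i) \<in> borel_measurable M" if "i \<in> {..n}" for i using that XD(3) tT by auto
      have "0 \<le> (\<Sum>i\<le>n. s i * X (t i) \<omega>)" if "\<omega> \<in> space M" for \<omega>
      proof (intro sum_nonneg mult_nonneg_nonneg)
        fix i assume "i \<in> {..n}"
        then show "0 \<le> s i" "0 \<le> X (t i) \<omega>" using s[of i] XD(4)[OF tT[of i] that] by auto
      qed
      then show "integrable M (\<lambda>\<omega>. exp (- (\<Sum>i\<le>n. s i * X (t i) \<omega>)))"
        by (intro integrable_const_bound[where B = 1] AE_I2) auto
    qed auto
    also have "\<dots> = ennreal (kernel_det (Suc n) t s (\<lambda>i. f (t i) * s i) powr (- \<alpha>))"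
      using XD(5)[of "Suc n" t s] s tT by (simp add: lessThan_Suc_atMost det_u_tilde_kernel)
    also have "\<dots> = laplace {..n} \<mu> s"
    proof (rule lap[symmetric])
      show "\<forall>i\<le>n. 0 < a i + s i" using s gamma_rate_pos by (simp add: add_pos_pos)
      show "pivots_pos t n s (\<lambda>i. f (t i) * s i)"
      proof (rule pivots_pos_nonneg[OF strict_mono_t t0_pos])
        show "0 \<le> s i" if "i \<le> n" for i using s[of i] that by simp
        then show "0 \<le> f (t i) * s i" if "i \<le> n" for i using ft[of i] that by simp
      qed
    qed
    finally show "(\<integral>\<^sup>+x. ennreal (exp (- (\<Sum>i\<in>{..n}. s i * x i))) \<partial>distr M ?P ?Z) =
        (\<integral>\<^sup>+x. ennreal (exp (- (\<Sum>i\<in>{..n}. s i * x i))) \<partial>\<mu>)"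
      unfolding ZI .
  qed (use \<mu> in auto)
  show ?L if ?A1 ?A2
    using lap[OF that] unfolding ZI[symmetric] eq .
  have "{x \<in> space ?P. \<forall>i\<le>n. x i \<le> c i} \<in> sets ?P" by measurable
  then have "emeasure (distr M ?P ?Z) {x \<in> space ?P. \<forall>i\<le>n. x i \<le> c i} =
      emeasure M (?Z -` {x \<in> space ?P. \<forall>i\<le>n. x i \<le> c i} \<inter> space M)"
    by (rule emeasure_distr[OF Z])
  also have "?Z -` {x \<in> space ?P. \<forall>i\<le>n. x i \<le> c i} \<inter> space M = {\<omega> \<in> space M. \<forall>i\<le>n. X (t i) \<omega> \<le> c i}"
    by (auto simp: space_PiM)
  finally show "emeasure M {\<omega> \<in> space M. \<forall>i\<le>n. X (t i) \<omega> \<le> c i} \<le>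
       (\<Prod>i\<le>n. gamma_cdf \<alpha> (a i) (c i))"
    using dom[of c] unfolding eq[symmetric] by (simp only: space_distr)
qed

context pos_concave
begin

lemma mgf_one:
  assumes X: "permanental_process M \<alpha> T (u_tilde f) X" and t: "t \<in> T" "t > 0" and l: "l * (t + f t) < 1"
  shows "(\<integral>\<^sup>+\<omega>. ennreal (exp (l * X t \<omega>)) \<partial>M) = ennreal ((1 - l * (t + f t)) powr (- \<alpha>))"
proof -
  \<comment> \<open>The times after the first one are arbitrary.\<close>
  define \<tau> where "\<tau> k = t + real k" for k
  interpret concave_grid f \<tau> by (rule grid) (use t in \<open>auto simp: \<tau>_def strict_mono_def\<close>)
  let ?s = "\<lambda>_ :: nat. - l"
  have u: "0 < t + f t" using t positive_f by (simp add: add_pos_pos)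
  have "1 / (t + f t) \<le> a 0"
    using gap_pos[of 0] slope_nonneg[of 0] u unfolding gamma_rate_def
    by (auto simp: \<tau>_def intro!: divide_right_mono)
  moreover have "l < 1 / (t + f t)" using l u by (simp add: field_simps)
  ultimately have "0 < a 0 + ?s 0" by simp
  moreover have "pivots_pos \<tau> 0 ?s (\<lambda>i. f (\<tau> i) * ?s i)"
    using l by (simp add: \<tau>_def algebra_simps)
  ultimately show ?thesis
    using law_on_grid(1)[OF X, of 0 ?s] t by (simp add: \<tau>_def kernel_det_1 algebra_simps)
qed

text \<open>
The case of two times with opposite weights; \<open>1 - l (t - s + f t - f s) - l\<^sup>2 (t - s) (s + f s)\<close> is the
determinant.
\<close>
lemma mgf_increment:
  assumes X: "permanental_process M \<alpha> T (u_tilde f) X" and st: "s \<in> T" "t \<in> T" "0 < s" "s < t"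
    and l: "\<bar>l\<bar> < 1 / (t - s)" and pos: "0 < 1 - l * (t - s + f t - f s) - l\<^sup>2 * (t - s) * (s + f s)" (is "0 < ?D")
  shows "(\<integral>\<^sup>+\<omega>. ennreal (exp (l * (X t \<omega> - X s \<omega>))) \<partial>M) = ennreal (?D powr (- \<alpha>))"
proof -
  define \<tau> where "\<tau> k = (if k = 0 then s else t + real (k - 1))" for k :: nat
  have sm: "strict_mono \<tau>" using st by (auto simp: \<tau>_def strict_mono_Suc_iff)
  interpret concave_grid f \<tau> by (rule grid) (use st sm in \<open>auto simp: \<tau>_def\<close>)
  have \<tau>: "\<tau> 0 = s" "\<tau> (Suc 0) = t" by (auto simp: \<tau>_def)
  define v where "v = (\<lambda>k :: nat. if k = 0 then l else - l :: real)" 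
  have u: "0 < s + f s" using st positive_f by (simp add: add_pos_pos)
  have g: "gap \<tau> 0 = t - s" by (simp add: gap_def \<tau>)
  define p where "p = 1 - (t - s) * l"
  have p: "p > 0"
  proof -
    have "(t - s) * l \<le> (t - s) * \<bar>l\<bar>" using st by (intro mult_left_mono) auto
    also have "\<dots> < 1" using l st by (simp add: field_simps)
    finally show ?thesis by (simp add: p_def)
  qed
  have av: "0 < a i + v i" if "i \<le> Suc 0" for i
  proof (cases i)
    case 0
    have "1 / (t - s) = ((s + f s) / (t - s)) / (s + f s)" using u by simp
    also have "\<dots> \<le> (1 + (s + f s) / (t - s) + slope f \<tau> 0) / (s + f s)"
      using slope_nonneg[of 0] u by (intro divide_right_mono) auto
    also have "\<dots> = a 0" by (simp add: gamma_rate_def \<tau> g)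
    finally show ?thesis using l 0 by (simp add: v_def)
  next
    case (Suc j)
    then have ai: "a i = 1 / (t - s) + 1 / gap \<tau> 1" using that by (simp add: gamma_rate_def g)
    have gp: "0 < 1 / gap \<tau> 1" using gap_pos[of 1] by simp
    have vi: "v i = - l" using Suc by (simp add: v_def)
    show ?thesis unfolding ai vi using l gp by linarith
  qed
  have kd: "kernel_det (Suc (Suc 0)) \<tau> v (\<lambda>i. f (\<tau> i) * v i) =
      p * (1 + s * (l + - l / p) + (f s * l + f t * - l / p))"
    using kernel_det_Suc_Suc[OF sm, of 0 v "\<lambda>i. f (\<tau> i) * v i"] p
    by (simp add: p_def \<tau> v_def kernel_det_1)
  have pD: "p * (1 + s * (l + - l / p) + (f s * l + f t * - l / p)) = ?D"
  proof -
    have "p * (1 + s * (l + - l / p) + (f s * l + f t * - l / p)) = p * (1 + s * l + f s * l) - s * l - f t * l"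
      using p by (simp add: algebra_simps)
    also have "\<dots> = ?D" by (simp add: p_def power2_eq_square algebra_simps)
    finally show ?thesis .
  qed
  have piv: "pivots_pos \<tau> (Suc 0) v (\<lambda>i. f (\<tau> i) * v i)"
  proof -
    have "0 < 1 + s * (l + - l / p) + (f s * l + f t * - l / p)"
      using pD pos p by (metis zero_less_mult_pos)
    then show ?thesis using p by (simp add: \<tau> v_def p_def)
  qed
  have \<tau>T: "\<tau> i \<in> T" if "i \<le> Suc 0" for i using that st by (auto simp: \<tau> le_Suc_eq)
  have "(\<integral>\<^sup>+\<omega>. ennreal (exp (- (\<Sum>i\<le>Suc 0. v i * X (\<tau> i) \<omega>))) \<partial>M) = ennreal (?D powr (- \<alpha>))"
    unfolding pD[symmetric] kd[symmetric] using av by (intro law_on_grid(1)[OF X \<tau>T _ piv]) blast+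
  then show ?thesis by (simp add: v_def \<tau> algebra_simps)
qed

end

context pos_concave
begin

text \<open>
Increments over a distance \<open>h\<close> in \<open>[c, 2 c]\<close> have exponential tails on the scale \<open>sqrt (c h)\<close>: for
\<open>l = 1 / (4 R sqrt (c h))\<close> the linear and the quadratic term of the determinant in \<open>mgf_increment\<close> are
at most \<open>1 / 4\<close> each, so \<open>exp (l \<bar>X t - X s\<bar>)\<close> has a bounded expectation.
\<close>
lemma increment_tail:
  assumes X: "permanental_process M \<alpha> T (u_tilde f) X" and st: "s \<in> T" "t \<in> T" "0 < c" "c \<le> s" "s < t" "t \<le> 2 * c"
    and R: "1 + f c / c \<le> R"
  shows "measure M {\<omega> \<in> space M. x \<le> \<bar>X t \<omega> - X s \<omega>\<bar>} \<le> 2 powr (\<alpha> + 1) * exp (- x / (4 * R * sqrt (c * (t - s))))"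
proof -
  note XD = permanental_processD[OF X]
  interpret prob_space M by (rule XD(1))
  have [measurable]: "X t \<in> borel_measurable M" "X s \<in> borel_measurable M" using XD(3) st by auto
  define h where "h = t - s"
  have h: "0 < h" "h \<le> c" using st by (auto simp: h_def)
  have fc: "f c / c > 0" using positive_f[of c] st by simp
  have R1: "R \<ge> 1" using R fc by simp
  define S where "S = sqrt (c * h)"
  have S: "S > 0" "S\<^sup>2 = c * h" using h st by (auto simp: S_def)
  have hS: "h \<le> S"
    unfolding S_def using h by (intro real_le_rsqrt) (simp add: power2_eq_square)
  define l where "l = 1 / (4 * R * S)"
  have l: "l > 0" using R1 S by (simp add: l_def)
  have hl: "l * h < 1"
  proof -
    have "l * h \<le> l * S" using hS l by simp
    also have "\<dots> = 1 / (4 * R)" using S by (simp add: l_def)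
    also have "\<dots> < 1" using R1 by simp
    finally show ?thesis .
  qed
  have fs: "f s / s \<le> f c / c" using ratio_antimono st by simp
  define d where "d = h + f t - f s"
  define D where "D = h * (s + f s)"
  have "f t - f s \<le> h * (f s / s)" unfolding h_def using st by (intro increment_le) auto
  also have "\<dots> \<le> h * (f c / c)" using fs h by (intro mult_left_mono) auto
  finally have "d \<le> h * (1 + f c / c)" by (simp add: d_def algebra_simps)
  also have "\<dots> \<le> h * R" using R h by (intro mult_left_mono) auto
  also have "\<dots> \<le> S * R" using hS R1 by (intro mult_right_mono) auto
  finally have dS: "d \<le> S * R" .
  have d0: "0 \<le> d" unfolding d_def using f_mono[of s t] st h by simp
  have ld: "l * d \<le> 1 / 4"
  proof -
    have "l * d \<le> l * (S * R)" using dS l by simp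
    also have "\<dots> = 1 / 4" using S R1 by (simp add: l_def)
    finally show ?thesis .
  qed
  have lD: "l\<^sup>2 * D \<le> 1 / 4"
  proof -
    have "s + f s = s * (1 + f s / s)" using st by (simp add: field_simps)
    also have "\<dots> \<le> (2 * c) * R" using st R fs fc positive_f[of s] by (intro mult_mono) auto
    finally have "D \<le> h * ((2 * c) * R)" unfolding D_def using h by (intro mult_left_mono) auto
    also have "\<dots> = 2 * R * S\<^sup>2" using S by simp
    finally have "l\<^sup>2 * D \<le> l\<^sup>2 * (2 * R * S\<^sup>2)" by (intro mult_left_mono) auto
    also have "\<dots> = 1 / (8 * R)" using S R1 h st by (simp add: l_def power2_eq_square field_simps)
    also have "\<dots> \<le> 1 / 4" using R1 by (simp add: field_simps)
    finally show ?thesis .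
  qed
  have mgf: "(\<integral>\<^sup>+\<omega>. ennreal (exp (k * (X t \<omega> - X s \<omega>))) \<partial>M) \<le> ennreal (2 powr \<alpha>)"
    if k: "k = l \<or> k = - l" for k
  proof -
    have "0 \<le> l * d" using l d0 by simp
    then have "k * d \<le> 1 / 4" using k ld by auto
    moreover have "k\<^sup>2 * D \<le> 1 / 4" using k lD by auto
    ultimately have kd: "k * d \<le> 1 / 4" "k\<^sup>2 * D \<le> 1 / 4" by blast+
    let ?E = "1 - k * (t - s + f t - f s) - k\<^sup>2 * (t - s) * (s + f s)"
    have E: "?E = 1 - k * d - k\<^sup>2 * D" by (simp add: d_def D_def h_def)
    have Epos: "1 / 2 \<le> ?E" unfolding E using kd by linarith
    have "\<bar>k\<bar> = l" using k l by auto
    moreover have "l < 1 / h" using hl h by (simp add: less_divide_eq)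
    ultimately have kh: "\<bar>k\<bar> < 1 / (t - s)" by (simp add: h_def)
    have E0: "0 < ?E" using Epos by linarith
    have s0: "0 < s" using st by simp
    have "(\<integral>\<^sup>+\<omega>. ennreal (exp (k * (X t \<omega> - X s \<omega>))) \<partial>M) = ennreal (?E powr (- \<alpha>))"
      by (rule mgf_increment[OF X st(1,2) s0 st(5) kh E0])
    also have "\<dots> \<le> ennreal ((1 / 2) powr (- \<alpha>))"
      using XD(2) by (intro ennreal_leI powr_mono2'[OF _ _ Epos]) simp_all
    also have "(1 / 2 :: real) powr (- \<alpha>) = 2 powr \<alpha>" by (simp add: powr_minus powr_divide)
    finally show ?thesis .
  qed
  have "emeasure M {\<omega> \<in> space M. x \<le> \<bar>X t \<omega> - X s \<omega>\<bar>} \<le>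
      ennreal (exp (- l * x)) * (\<integral>\<^sup>+\<omega>. ennreal (exp (l * \<bar>X t \<omega> - X s \<omega>\<bar>)) * indicator (space M) \<omega> \<partial>M)"
    by (rule Chernoff_ineq_nn_integral_ge) (use l in auto)
  also have "(\<integral>\<^sup>+\<omega>. ennreal (exp (l * \<bar>X t \<omega> - X s \<omega>\<bar>)) * indicator (space M) \<omega> \<partial>M) \<le>
      (\<integral>\<^sup>+\<omega>. ennreal (exp (l * (X t \<omega> - X s \<omega>))) + ennreal (exp (- l * (X t \<omega> - X s \<omega>))) \<partial>M)"
  proof (intro nn_integral_mono)
    fix \<omega>
    have "exp (l * \<bar>z\<bar>) \<le> exp (l * z) + exp (- l * z)" for z :: real
      by (cases "z \<ge> 0") auto
    then show "ennreal (exp (l * \<bar>X t \<omega> - X s \<omega>\<bar>)) * indicator (space M) \<omega> \<le>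
        ennreal (exp (l * (X t \<omega> - X s \<omega>))) + ennreal (exp (- l * (X t \<omega> - X s \<omega>)))"
      by (auto simp: indicator_def simp flip: ennreal_plus)
  qed
  also have "\<dots> = (\<integral>\<^sup>+\<omega>. ennreal (exp (l * (X t \<omega> - X s \<omega>))) \<partial>M) + (\<integral>\<^sup>+\<omega>. ennreal (exp (- l * (X t \<omega> - X s \<omega>))) \<partial>M)"
    by (intro nn_integral_add) auto
  also have "\<dots> \<le> ennreal (2 powr \<alpha>) + ennreal (2 powr \<alpha>)"
    by (intro add_mono mgf) auto
  also have "\<dots> = ennreal (2 powr (\<alpha> + 1))" by (simp add: powr_add flip: ennreal_plus)
  finally have "emeasure M {\<omega> \<in> space M. x \<le> \<bar>X t \<omega> - X s \<omega>\<bar>} \<le>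
      ennreal (exp (- l * x)) * ennreal (2 powr (\<alpha> + 1))"
    by (simp add: mult_left_mono)
  also have "\<dots> = ennreal (2 powr (\<alpha> + 1) * exp (- (l * x)))"
    by (simp add: mult.commute flip: ennreal_mult)
  finally have "emeasure M {\<omega> \<in> space M. x \<le> \<bar>X t \<omega> - X s \<omega>\<bar>} \<le> ennreal (2 powr (\<alpha> + 1) * exp (- (l * x)))" .
  then have "measure M {\<omega> \<in> space M. x \<le> \<bar>X t \<omega> - X s \<omega>\<bar>} \<le> 2 powr (\<alpha> + 1) * exp (- (l * x))"
    by (simp add: emeasure_eq_measure)
  then show ?thesis by (simp add: l_def S_def h_def)
qed

lemma marginal_tail:
  assumes X: "permanental_process M \<alpha> T (u_tilde f) X" and t: "t \<in> T" "t > 0" and l: "0 < l" "l * (t + f t) < 1"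
  shows "measure M {\<omega> \<in> space M. x \<le> X t \<omega>} \<le> (1 - l * (t + f t)) powr (- \<alpha>) * exp (- l * x)"
proof -
  note XD = permanental_processD[OF X]
  interpret prob_space M by (rule XD(1))
  have [measurable]: "X t \<in> borel_measurable M" using XD(3) t by auto
  have "emeasure M {\<omega> \<in> space M. x \<le> X t \<omega>} \<le>
      ennreal (exp (- l * x)) * (\<integral>\<^sup>+\<omega>. ennreal (exp (l * X t \<omega>)) * indicator (space M) \<omega> \<partial>M)"
    by (rule Chernoff_ineq_nn_integral_ge) (use l in auto)
  also have "(\<integral>\<^sup>+\<omega>. ennreal (exp (l * X t \<omega>)) * indicator (space M) \<omega> \<partial>M) = ennreal ((1 - l * (t + f t)) powr (- \<alpha>))"
  proof -
    have "(\<integral>\<^sup>+\<omega>. ennreal (exp (l * X t \<omega>)) * indicator (space M) \<omega> \<partial>M) = (\<integral>\<^sup>+\<omega>. ennreal (exp (l * X t \<omega>)) \<partial>M)"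
      by (intro nn_integral_cong) simp
    then show ?thesis using mgf_one[OF X t l(2)] by simp
  qed
  finally show ?thesis
    by (simp add: emeasure_eq_measure mult.commute flip: ennreal_mult)
qed

end

section \<open>Chaining\<close>

text \<open>
A dyadic point of level \<open>m\<close> is either of level \<open>m - 1\<close> or the right neighbour of such a point on
level \<open>m\<close>, so it is reached from \<open>c\<close> with at most one step on each level.
\<close>
lemma chaining_grid:
  fixes g :: "real \<Rightarrow> real" and x :: "nat \<Rightarrow> real"
  assumes inc: "\<And>m k. k < 2 ^ m \<Longrightarrow> \<bar>g (c + L * (real (Suc k) / 2 ^ m)) - g (c + L * (real k / 2 ^ m))\<bar> \<le> x m"
  shows "k \<le> 2 ^ m \<Longrightarrow> \<bar>g (c + L * (real k / 2 ^ m)) - g c\<bar> \<le> (\<Sum>j\<le>m. x j)"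
proof (induction m arbitrary: k)
  case 0
  have "0 \<le> x 0" using order_trans[OF abs_ge_zero inc[of 0 0]] by simp
  then show ?case using 0 inc[of 0 0] by (cases "k = 0") (auto simp: le_Suc_eq)
next
  case (Suc m)
  have "0 \<le> x (Suc m)" using order_trans[OF abs_ge_zero inc[of 0 "Suc m"]] by simp
  define j where "j = k div 2"
  have j: "j \<le> 2 ^ m" using Suc.prems by (simp add: j_def)
  have IH: "\<bar>g (c + L * (real (2 * j) / 2 ^ Suc m)) - g c\<bar> \<le> (\<Sum>i\<le>m. x i)"
    using Suc.IH[OF j] by simp
  show ?case
  proof (cases "even k")
    case True
    then have "k = 2 * j" by (simp add: j_def)
    then show ?thesis using IH \<open>0 \<le> x (Suc m)\<close> by simp
  next
    case False
    then have k: "k = Suc (2 * j)" by (simp add: j_def)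
    then have "2 * j < 2 ^ Suc m" using Suc.prems by simp
    from inc[OF this] IH show ?thesis unfolding k by simp
  qed
qed

lemma chaining:
  fixes g :: "real \<Rightarrow> real" and x :: "nat \<Rightarrow> real"
  assumes inc: "\<And>m k. k < 2 ^ m \<Longrightarrow> \<bar>g (c + L * (real (Suc k) / 2 ^ m)) - g (c + L * (real k / 2 ^ m))\<bar> \<le> x m"
    and x: "summable x" and L: "L > 0" and cont: "continuous_on {c..c + L} g" and t: "t \<in> {c..c + L}"
  shows "\<bar>g t - g c\<bar> \<le> suminf x"
proof -
  define v where "v = (t - c) / L"
  have v: "0 \<le> v" "v \<le> 1" "t = c + L * v" using t L by (auto simp: v_def)
  define k where "k m = nat \<lfloor>v * 2 ^ m\<rfloor>" for m
  have kb: "real (k m) \<le> v * 2 ^ m" "v * 2 ^ m < real (k m) + 1" for m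
    using v by (auto simp: k_def)
  have k2: "k m \<le> 2 ^ m" for m
  proof -
    have "v * 2 ^ m \<le> 1 * 2 ^ m" using v by (intro mult_right_mono) auto
    then have "real (k m) \<le> 2 ^ m" using kb(1)[of m] by linarith
    then show ?thesis by simp
  qed
  define p where "p m = c + L * (real (k m) / 2 ^ m)" for m
  have "(\<lambda>m. real (k m) / 2 ^ m) \<longlonglongrightarrow> v"
  proof (rule tendsto_sandwich)
    show "(\<lambda>m. v - (1 / 2) ^ m) \<longlonglongrightarrow> v"
      using tendsto_diff[OF tendsto_const LIMSEQ_power_zero[of "1 / 2 :: real"]] by simp
    show "\<forall>\<^sub>F m in sequentially. v - (1 / 2) ^ m \<le> real (k m) / 2 ^ m"
    proof (intro always_eventually allI)
      fix m
      have "v < (real (k m) + 1) / 2 ^ m" using kb(2)[of m] by (simp add: less_divide_eq)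
      then show "v - (1 / 2) ^ m \<le> real (k m) / 2 ^ m" by (simp add: add_divide_distrib power_one_over)
    qed
    show "\<forall>\<^sub>F m in sequentially. real (k m) / 2 ^ m \<le> v"
      using kb(1) by (intro always_eventually allI) (simp add: divide_le_eq)
  qed auto
  then have plim: "p \<longlonglongrightarrow> t"
    unfolding p_def v(3) by (intro tendsto_intros)
  have pin: "p m \<in> {c..c + L}" for m
  proof -
    have "real (k m) \<le> real (2 ^ m)" using k2[of m] by (simp only: of_nat_le_iff)
    then have "real (k m) / 2 ^ m \<le> 1" by simp
    then have "L * (real (k m) / 2 ^ m) \<le> L * 1" using L by (intro mult_left_mono) auto
    then show ?thesis using L by (simp add: p_def)
  qed
  have gl: "(\<lambda>m. g (p m)) \<longlonglongrightarrow> g t"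
    using cont plim pin t unfolding continuous_on_sequentially by (auto simp: comp_def)
  have x0: "0 \<le> x m" for m using order_trans[OF abs_ge_zero inc[of 0 m]] by simp
  have "\<bar>g (p m) - g c\<bar> \<le> suminf x" for m
  proof -
    have "\<bar>g (p m) - g c\<bar> \<le> (\<Sum>j\<le>m. x j)"
      unfolding p_def by (rule chaining_grid[OF inc k2])
    also have "\<dots> \<le> suminf x" using x0 by (intro sum_le_suminf x) auto
    finally show ?thesis .
  qed
  moreover have "(\<lambda>m. \<bar>g (p m) - g c\<bar>) \<longlonglongrightarrow> \<bar>g t - g c\<bar>" using gl by (intro tendsto_intros)
  ultimately show ?thesis by (intro LIMSEQ_le_const2) auto
qed

abbreviation "sqrt_half \<equiv> sqrt (1 / 2 :: real)"

lemma sqrt_half: "0 < sqrt_half" "sqrt_half < 1" by (auto simp: real_sqrt_less_iff)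

lemma summable_mult_sqrt_half: "summable (\<lambda>m. real m * sqrt_half ^ m)"
proof -
  have "summable (\<lambda>n. of_nat (Suc n) * sqrt_half ^ n)"
    using sqrt_half geometric_deriv_sums[of sqrt_half] by (auto simp: sums_iff)
  then have "summable (\<lambda>n. of_nat (Suc n) * sqrt_half ^ n - sqrt_half ^ n)"
    using sqrt_half by (intro summable_diff summable_geometric) auto
  then show ?thesis by (simp add: algebra_simps)
qed

text \<open>
The sum of the thresholds for the increments over all levels, in units of the scale of the interval.
\<close>
definition chain_const :: real where
  "chain_const = (\<Sum>m. real m * sqrt_half ^ m) + (\<Sum>m. sqrt_half ^ m)"

lemma chain_const_sum:
  assumes "q \<ge> 0" "y \<ge> 0"
  shows "summable (\<lambda>m. q * sqrt_half ^ m * (real m + y))"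
    and "(\<Sum>m. q * sqrt_half ^ m * (real m + y)) \<le> q * chain_const * (1 + y)"
proof -
  have s2: "summable (\<lambda>m. sqrt_half ^ m)" using sqrt_half by (intro summable_geometric) auto
  note s1 = summable_mult_sqrt_half
  have e: "(\<lambda>m. q * sqrt_half ^ m * (real m + y)) = (\<lambda>m. q * (real m * sqrt_half ^ m) + q * y * sqrt_half ^ m)"
    by (auto simp: algebra_simps)
  show "summable (\<lambda>m. q * sqrt_half ^ m * (real m + y))"
    unfolding e by (intro summable_add summable_mult s1 s2)
  have "(\<Sum>m. q * sqrt_half ^ m * (real m + y)) = q * (\<Sum>m. real m * sqrt_half ^ m) + q * y * (\<Sum>m. sqrt_half ^ m)"
    unfolding e by (subst suminf_add[symmetric]) (auto intro!: summable_mult s1 s2 simp: suminf_mult[OF s1] suminf_mult[OF s2])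
  also have "\<dots> = q * ((\<Sum>m. real m * sqrt_half ^ m) + y * (\<Sum>m. sqrt_half ^ m))" by (simp add: algebra_simps)
  also have "\<dots> \<le> q * (chain_const * (1 + y))"
  proof -
    have "0 \<le> (\<Sum>m. real m * sqrt_half ^ m)" "0 \<le> (\<Sum>m. sqrt_half ^ m)"
      using sqrt_half by (auto intro!: suminf_nonneg s1 s2)
    then show ?thesis using assms by (intro mult_left_mono) (auto simp: chain_const_def algebra_simps)
  qed
  finally show "(\<Sum>m. q * sqrt_half ^ m * (real m + y)) \<le> q * chain_const * (1 + y)" by (simp add: mult.assoc)
qed

definition level_event :: "'w measure \<Rightarrow> (real \<Rightarrow> 'w \<Rightarrow> real) \<Rightarrow> real \<Rightarrow> real \<Rightarrow> nat \<Rightarrow> real \<Rightarrow> 'w set" where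
  "level_event M X c L m b = (\<Union>k\<in>{..<2 ^ m}. {\<omega> \<in> space M.
     b \<le> \<bar>X (c + L * (real (Suc k) / 2 ^ m)) \<omega> - X (c + L * (real k / 2 ^ m)) \<omega>\<bar>})"

text \<open>
The threshold exceeds the scale of a level-\<open>m\<close> increment by a factor proportional to \<open>m + y\<close>, so each
increment exceeds it with probability of order \<open>exp (- m - y)\<close>; there are \<open>2 ^ m\<close> of them, and \<open>2 < exp 1\<close>.
\<close>
lemma (in pos_concave) level_event_bound:
  assumes X: "permanental_process M \<alpha> T (u_tilde f) X"
    and c: "0 < c" "0 < L" "L \<le> c" and R: "1 + f c / c \<le> R"
    and T: "\<And>k. k \<le> 2 ^ m \<Longrightarrow> c + L * (real k / 2 ^ m) \<in> T"
  shows "level_event M X c L m (4 * R * sqrt (c * L) * sqrt_half ^ m * (real m + y)) \<in> sets M"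
    and "measure M (level_event M X c L m (4 * R * sqrt (c * L) * sqrt_half ^ m * (real m + y)))
      \<le> 2 powr (\<alpha> + 1) * exp (- y) * (2 / exp 1) ^ m"
proof -
  note XD = permanental_processD[OF X]
  interpret prob_space M by (rule XD(1))
  let ?b = "4 * R * sqrt (c * L) * sqrt_half ^ m * (real m + y)"
  let ?p = "\<lambda>k :: nat. c + L * (real k / 2 ^ m)"
  let ?A = "\<lambda>k. {\<omega> \<in> space M. ?b \<le> \<bar>X (?p (Suc k)) \<omega> - X (?p k) \<omega>\<bar>}"
  have fc: "f c / c > 0" using positive_f[of c] c by simp
  have R1: "R \<ge> 1" using R fc by simp
  define A where "A = ?A"
  have lev: "level_event M X c L m ?b = (\<Union>k\<in>{..<2 ^ m}. A k)"
    by (simp only: level_event_def A_def)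
  have A: "A k \<in> sets M \<and> measure M (A k) \<le> 2 powr (\<alpha> + 1) * exp (- (real m + y))" if k: "k < 2 ^ m" for k
  proof -
    have in_T: "?p k \<in> T" "?p (Suc k) \<in> T" using k T[of k] T[of "Suc k"] by auto
    then have [measurable]: "X (?p k) \<in> borel_measurable M" "X (?p (Suc k)) \<in> borel_measurable M" using XD(3) by auto
    have d: "?p (Suc k) - ?p k = L / 2 ^ m" by (simp add: algebra_simps add_divide_distrib)
    have "real (Suc k) / 2 ^ m \<le> 1"
    proof -
      have "real (Suc k) \<le> real (2 ^ m)" using k by (subst of_nat_le_iff) simp
      then show ?thesis by simp
    qed
    then have "L * (real (Suc k) / 2 ^ m) \<le> L * 1" using c by (intro mult_left_mono) auto
    then have le: "?p (Suc k) \<le> 2 * c" using c by simp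
    have lt: "?p k < ?p (Suc k)" using d c by (smt (verit) divide_pos_pos zero_less_power)
    have ge: "c \<le> ?p k" using c by simp
    have S: "sqrt (c * (L / 2 ^ m)) = sqrt (c * L) * sqrt_half ^ m"
      by (simp add: real_sqrt_divide real_sqrt_mult real_sqrt_power power_divide)
    have Spos: "sqrt (c * L) * sqrt_half ^ m > 0" using c by simp
    have "measure M (?A k) \<le> 2 powr (\<alpha> + 1) * exp (- ?b / (4 * R * sqrt (c * (L / 2 ^ m))))"
      using increment_tail[OF X in_T c(1) ge lt le R, of ?b] unfolding d .
    also have "- ?b / (4 * R * sqrt (c * (L / 2 ^ m))) = - (real m + y)"
    proof -
      have "4 * R * (sqrt (c * L) * sqrt_half ^ m) > 0" by (rule mult_pos_pos[OF _ Spos]) (use R1 in simp)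
      then have nz: "4 * R * (sqrt (c * L) * sqrt_half ^ m) \<noteq> 0" by (rule less_imp_neq[THEN not_sym])
      have b: "?b = 4 * R * (sqrt (c * L) * sqrt_half ^ m) * (real m + y)" by (simp only: mult.assoc)
      show ?thesis
        unfolding S b minus_divide_left[symmetric] nonzero_mult_div_cancel_left[OF nz] by (rule refl)
    qed
    finally have "measure M (?A k) \<le> 2 powr (\<alpha> + 1) * exp (- (real m + y))" .
    moreover have "?A k \<in> sets M" by measurable
    ultimately show ?thesis unfolding A_def by (rule conjI[rotated])
  qed
  show "level_event M X c L m ?b \<in> sets M"
    unfolding lev using A by (intro sets.finite_UN) auto
  have "measure M (level_event M X c L m ?b) \<le> (\<Sum>k<(2 :: nat) ^ m. measure M (A k))"
    unfolding lev using A by (intro finite_measure_subadditive_finite) auto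
  also have "\<dots> \<le> (\<Sum>k<(2 :: nat) ^ m. 2 powr (\<alpha> + 1) * exp (- (real m + y)))"
    using A by (intro sum_mono) auto
  also have "\<dots> = 2 powr (\<alpha> + 1) * exp (- y) * (2 / exp 1) ^ m"
  proof -
    have "exp (- (real m + y)) = exp (- y - real m * 1)" by simp
    also have "\<dots> = exp (- y) / exp 1 ^ m" by (simp only: exp_diff exp_of_nat_mult)
    finally have "exp (- (real m + y)) = exp (- y) / exp 1 ^ m" .
    then show ?thesis by (simp add: power_divide)
  qed
  finally show "measure M (level_event M X c L m ?b) \<le> 2 powr (\<alpha> + 1) * exp (- y) * (2 / exp 1) ^ m" .
qed

lemma two_less_exp_1: "(2 :: real) < exp 1"
  using exp_ge_add_one_self[of "1 :: real"] exp_ge_one_plus_x_over_n_power_n[of 2 1] by (simp add: power2_eq_square)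

lemma (in pos_concave) oscillation_tail:
  assumes X: "permanental_process M \<alpha> {0<..} (u_tilde f) X" and cont: "continuous_paths_on M {0<..} X"
    and c: "0 < c" "0 < L" "L \<le> c" and R: "1 + f c / c \<le> R" and y: "y \<ge> 0"
  shows "\<exists>B\<in>sets M. measure M B \<le> 2 powr (\<alpha> + 1) / (1 - 2 / exp 1) * exp (- y) \<and>
    (\<forall>\<omega>\<in>space M - B. \<forall>t\<in>{c..c + L}. \<bar>X t \<omega> - X c \<omega>\<bar> \<le> 4 * R * sqrt (c * L) * chain_const * (1 + y))"
proof -
  note XD = permanental_processD[OF X]
  interpret prob_space M by (rule XD(1))
  let ?q = "4 * R * sqrt (c * L)"
  let ?b = "\<lambda>m. ?q * sqrt_half ^ m * (real m + y)"
  let ?E = "\<lambda>m. level_event M X c L m (?b m)"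
  have fc: "f c / c > 0" using positive_f[of c] c by simp
  have q: "?q \<ge> 0" using R fc c by simp
  have T: "c + L * (real k / 2 ^ m) \<in> {0<..}" for k m using c by (simp add: add_pos_nonneg)
  note E = level_event_bound[OF X c R T, where y = y]
  have g: "(\<lambda>m. (2 / exp 1 :: real) ^ m) sums (1 / (1 - 2 / exp 1))"
    using two_less_exp_1 by (intro geometric_sums) auto
  have s: "summable (\<lambda>m. measure M (?E m))"
    by (rule summable_comparison_test[OF _ summable_mult[OF sums_summable[OF g]]]) (use E(2) in \<open>auto intro!: exI[of _ 0]\<close>)
  let ?B = "\<Union>m. ?E m"
  have "measure M ?B \<le> (\<Sum>m. measure M (?E m))"
    using E(1) s by (intro finite_measure_subadditive_countably) auto
  also have "\<dots> \<le> (\<Sum>m. 2 powr (\<alpha> + 1) * exp (- y) * (2 / exp 1) ^ m)"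
    using E(2) by (intro suminf_le s summable_mult sums_summable[OF g]) auto
  also have "\<dots> = 2 powr (\<alpha> + 1) / (1 - 2 / exp 1) * exp (- y)"
    by (subst suminf_mult[OF sums_summable[OF g]]) (simp add: sums_unique[OF g, symmetric])
  finally have "measure M ?B \<le> 2 powr (\<alpha> + 1) / (1 - 2 / exp 1) * exp (- y)" .
  moreover have "?B \<in> sets M" using E(1) by auto
  moreover have "\<bar>X t \<omega> - X c \<omega>\<bar> \<le> ?q * chain_const * (1 + y)" if \<omega>: "\<omega> \<in> space M - ?B" and t: "t \<in> {c..c + L}" for \<omega> t
  proof -
    have "\<bar>X t \<omega> - X c \<omega>\<bar> \<le> suminf ?b"
    proof (rule chaining[where g = "\<lambda>t. X t \<omega>" and L = L])
      show "\<bar>X (c + L * (real (Suc k) / 2 ^ m)) \<omega> - X (c + L * (real k / 2 ^ m)) \<omega>\<bar> \<le> ?b m" if "k < 2 ^ m" for m k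
        using \<omega> that unfolding level_event_def by (auto simp: not_le intro!: less_imp_le)
      show "continuous_on {c..c + L} (\<lambda>t. X t \<omega>)"
        using cont \<omega> c unfolding continuous_paths_on_def
        by (auto intro: continuous_on_subset[where s = "{0<..}"])
      show "summable ?b" by (rule chain_const_sum(1)[OF q y])
    qed (use c t in auto)
    also have "\<dots> \<le> ?q * chain_const * (1 + y)" by (rule chain_const_sum(2)[OF q y])
    finally show ?thesis .
  qed
  ultimately show ?thesis by blast
qed

section \<open>The upper bound\<close>

text \<open>
With \<open>\<theta> = 1 + d\<close>, the marginals at \<open>\<theta> ^ n\<close> contribute \<open>(1 + d)\<^sup>2 (1 + C)\<close>, the
oscillation over \<open>[\<theta> ^ n, \<theta> ^ Suc n]\<close> contributes the multiple of \<open>sqrt d\<close>, and the last \<open>d\<close> makes room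
for passing from a limit to an eventual bound.
\<close>
lemma (in pos_concave) limsup_upper_grid:
  assumes X: "permanental_process M \<alpha> {0<..} (u_tilde f) X" and cont: "continuous_paths_on M {0<..} X"
    and C: "((\<lambda>t. f t / t) \<longlongrightarrow> C) at_top" and d: "0 < d" "d \<le> 1"
  shows "AE \<omega> in M. limsup_ratio X \<omega> \<le>
    ereal ((1 + d)\<^sup>2 * (1 + C) + 8 * (1 + f 1) * sqrt d * chain_const + d)"
proof -
  note XD = permanental_processD[OF X]
  interpret prob_space M by (rule XD(1))
  define \<theta> where "\<theta> = 1 + d"
  have \<theta>: "\<theta> > 1" using d by (simp add: \<theta>_def)
  define c where "c n = \<theta> ^ n" for n :: nat
  have c1: "c n \<ge> 1" for n using \<theta> by (simp add: c_def)
  have c0: "c n > 0" for n using c1[of n] by linarith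
  define R where "R = 1 + f 1"
  have R: "1 + f (c n) / c n \<le> R" for n
    using ratio_antimono[of 1 "c n"] c1[of n] by (simp add: R_def)
  define K where "K = 2 powr (\<alpha> + 1) / (1 - 2 / exp 1)"
  \<comment> \<open>This makes \<open>exp (- y n)\<close> summable; at \<open>n = 0\<close> the convention \<open>ln 0 = 0\<close> gives \<open>y 0 = 0\<close>.\<close>
  define y where "y n = 2 * ln (real n)" for n :: nat
  have y: "y n \<ge> 0" for n by (cases "n = 0") (auto simp: y_def)
  define good where "good n B \<longleftrightarrow> B \<in> sets M \<and> measure M B \<le> K * exp (- y n) \<and>
    (\<forall>\<omega>\<in>space M - B. \<forall>t\<in>{c n..c n + d * c n}.
       \<bar>X t \<omega> - X (c n) \<omega>\<bar> \<le> 4 * R * sqrt (c n * (d * c n)) * chain_const * (1 + y n))" for n B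
  have "\<exists>B. good n B" for n
  proof -
    have "0 < d * c n" "d * c n \<le> c n" using d c0[of n] by auto
    from oscillation_tail[OF X cont c0 this R y] show ?thesis
      unfolding good_def K_def Bex_def .
  qed
  then obtain B where good: "\<And>n. good n (B n)" by metis
  have B: "B n \<in> sets M" "measure M (B n) \<le> K * exp (- y n)" for n
    using good[of n] by (simp_all only: good_def)
  have osc: "\<bar>X t \<omega> - X (c n) \<omega>\<bar> \<le> 4 * R * sqrt (c n * (d * c n)) * chain_const * (1 + y n)"
    if "\<omega> \<in> space M - B n" "t \<in> {c n..c n + d * c n}" for n \<omega> t
    using good[of n] that by (simp only: good_def)
  have sB: "summable (\<lambda>n. measure M (B n))"
  proof (rule summable_comparison_test_ev)
    show "summable (\<lambda>n. K * (1 / real n ^ 2))"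
      using inverse_power_summable[of 2] by (intro summable_mult) (simp add: divide_inverse)
    show "\<forall>\<^sub>F n in sequentially. norm (measure M (B n)) \<le> K * (1 / real n ^ 2)"
      using eventually_gt_at_top[of 0]
    proof eventually_elim
      case (elim n)
      have "exp (- y n) = 1 / real n ^ 2"
        using elim by (simp only: y_def exp_minus exp_double exp_ln of_nat_0_less_iff inverse_eq_divide)
      then show ?case using B(2)[of n] by simp
    qed
  qed
  define u where "u n = c n + f (c n)" for n
  have u: "u n > 0" for n using c0[of n] positive_f[of "c n"] by (simp add: u_def add_pos_pos)
  define x where "x n = (1 + d)\<^sup>2 * u n * ln (real n)" for n :: nat
  define D where "D n = {\<omega> \<in> space M. x n \<le> X (c n) \<omega>}" for n
  have Dm: "D n \<in> sets M" for n
  proof -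
    have [measurable]: "X (c n) \<in> borel_measurable M" using XD(3) c0 by auto
    show ?thesis unfolding D_def by measurable
  qed
  define K' where "K' = (1 - 1 / (1 + d)) powr (- \<alpha>)"
  have sD: "summable (\<lambda>n. measure M (D n))"
  proof (rule summable_comparison_test_ev)
    show "summable (\<lambda>n. K' * real n powr (- (1 + d)))"
      using d by (intro summable_mult) (simp add: summable_real_powr_iff)
    show "\<forall>\<^sub>F n in sequentially. norm (measure M (D n)) \<le> K' * real n powr (- (1 + d))"
      using eventually_gt_at_top[of 0]
    proof eventually_elim
      case (elim n)
      \<comment> \<open>Slightly below the critical value \<open>1 / u n\<close> of the exponential moment.\<close>
      define l where "l = 1 / ((1 + d) * u n)"
      have l0: "0 < l" using u[of n] d by (simp add: l_def)
      have lu: "l * (c n + f (c n)) = 1 / (1 + d)" using u[of n] d by (simp add: l_def flip: u_def)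
      have l1: "l * (c n + f (c n)) < 1" unfolding lu using d by simp
      have cT: "c n \<in> {0<..}" using c0 by simp
      have "measure M (D n) \<le> K' * exp (- l * x n)"
        using marginal_tail[OF X cT c0 l0 l1, of "x n"] unfolding D_def K'_def lu .
      also have "- l * x n = - ((1 + d) * ln (real n))"
        using u[of n] d by (simp add: l_def x_def power2_eq_square)
      also have "exp (- ((1 + d) * ln (real n))) = real n powr (- (1 + d))"
        using elim by (simp add: powr_def algebra_simps)
      finally show ?case by simp
    qed
  qed
  have evB: "AE \<omega> in M. eventually (\<lambda>n. \<omega> \<in> space M - B n) sequentially"
    using B(1) sB by (intro borel_cantelli_AE1) (auto simp: emeasure_eq_measure)
  have evD: "AE \<omega> in M. eventually (\<lambda>n. \<omega> \<in> space M - D n) sequentially"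
    using Dm sD by (intro borel_cantelli_AE1) (auto simp: emeasure_eq_measure)
  define L where "L = (1 + d)\<^sup>2 * (1 + C) + 8 * (1 + f 1) * sqrt d * chain_const"
  define \<rho> where "\<rho> n = ((1 + d)\<^sup>2 * (u n / c n) * ln (real n) + 4 * R * sqrt d * chain_const * (1 + 2 * ln (real n)))
      / ln (real n * ln \<theta>)" for n :: nat
  have \<rho>: "\<rho> \<longlonglongrightarrow> L"
  proof -
    have l\<theta>: "ln \<theta> > 0" using \<theta> by simp
    have cinf: "filterlim c at_top sequentially"
      unfolding c_def[abs_def] using \<theta> by real_asymp
    have "(\<lambda>n. 1 + f (c n) / c n) \<longlonglongrightarrow> 1 + C"
      by (intro tendsto_intros filterlim_compose[OF C cinf])
    moreover have "1 + f (c n) / c n = u n / c n" for n using c0[of n] by (simp add: u_def add_divide_distrib)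
    ultimately have uc: "(\<lambda>n. u n / c n) \<longlonglongrightarrow> 1 + C" by simp
    have l1: "(\<lambda>n. ln (real n) / ln (real n * ln \<theta>)) \<longlonglongrightarrow> 1"
      and l2: "(\<lambda>n. (1 + 2 * ln (real n)) / ln (real n * ln \<theta>)) \<longlonglongrightarrow> 2"
      using l\<theta> by real_asymp+
    have e: "\<rho> = (\<lambda>n. (1 + d)\<^sup>2 * (u n / c n) * (ln (real n) / ln (real n * ln \<theta>)) +
        4 * R * sqrt d * chain_const * ((1 + 2 * ln (real n)) / ln (real n * ln \<theta>)))"
    proof -
      have "(p * x + p' * x') / q = p * (x / q) + p' * (x' / q)" for p x p' x' q :: real
        by (simp add: add_divide_distrib)
      then show ?thesis by (intro ext) (simp only: \<rho>_def)
    qed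
    have "\<rho> \<longlonglongrightarrow> (1 + d)\<^sup>2 * (1 + C) * 1 + 4 * R * sqrt d * chain_const * 2"
      unfolding e by (intro tendsto_intros uc l1 l2)
    then show ?thesis by (simp add: L_def R_def algebra_simps)
  qed
  have pos: "\<forall>\<^sub>F n in sequentially. real n * ln \<theta> > 1"
  proof -
    have "ln \<theta> > 0" using \<theta> by simp
    then show ?thesis by real_asymp
  qed
  have ev\<rho>: "\<forall>\<^sub>F n in sequentially. \<rho> n < L + d"
    using \<rho> d by (intro order_tendstoD) auto
  show ?thesis
    using evB evD AE_space
  proof eventually_elim
    case (elim \<omega>)
    from elim(1,2) pos ev\<rho> have "\<forall>\<^sub>F n in sequentially. \<omega> \<in> space M - B n \<and> \<omega> \<in> space M - D n \<and> real n * ln \<theta> > 1 \<and> \<rho> n < L + d"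
      by eventually_elim auto
    then obtain N where N: "\<And>n. n \<ge> N \<Longrightarrow> \<omega> \<in> space M - B n \<and> \<omega> \<in> space M - D n \<and> real n * ln \<theta> > 1 \<and> \<rho> n < L + d"
      unfolding eventually_sequentially by blast
    have "X t \<omega> / (t * ln (ln t)) \<le> L + d" if t: "t \<ge> c N" for t
    proof -
      have "\<exists>k. t < c k" unfolding c_def using real_arch_pow[OF \<theta>] by blast
      \<comment> \<open>The grid cell that contains \<open>t\<close>.\<close>
      define k where "k = (LEAST k. t < c k)"
      have k: "t < c k" unfolding k_def by (rule LeastI_ex) fact
      have "N < k"
      proof (rule ccontr)
        assume "\<not> N < k"
        then have "c k \<le> c N" unfolding c_def using \<theta> by (intro power_increasing) auto
        then show False using k t by simp
      qed
      define n where "n = k - 1"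
      have n: "n \<ge> N" "k = Suc n" using \<open>N < k\<close> by (auto simp: n_def)
      have "\<not> t < c n" using not_less_Least[of n "\<lambda>k. t < c k"] n(2) unfolding k_def[symmetric] by simp
      then have tn: "c n \<le> t" by simp
      have "c k = c n + d * c n" unfolding n(2) c_def by (simp add: \<theta>_def algebra_simps)
      then have tI: "t \<in> {c n..c n + d * c n}" using tn k by auto
      note Nn = N[OF n(1)]
      have "sqrt (c n * (d * c n)) = c n * sqrt d"
        using c0[of n] by (simp add: real_sqrt_mult mult_ac)
      then have "\<bar>X t \<omega> - X (c n) \<omega>\<bar> \<le> 4 * R * (c n * sqrt d) * chain_const * (1 + y n)"
        using osc[OF conjunct1[OF Nn] tI] by simp
      moreover have "X (c n) \<omega> < x n" using Nn by (auto simp: D_def not_le)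
      ultimately have Xt: "X t \<omega> \<le> x n + 4 * R * (c n * sqrt d) * chain_const * (1 + y n)" by linarith
      also have "\<dots> = c n * (\<rho> n * ln (real n * ln \<theta>))"
      proof -
        have "ln (real n * ln \<theta>) > 0" using Nn by simp
        then have "\<rho> n * ln (real n * ln \<theta>) =
            (1 + d)\<^sup>2 * (u n / c n) * ln (real n) + 4 * R * sqrt d * chain_const * (1 + 2 * ln (real n))"
          by (simp add: \<rho>_def)
        then show ?thesis using c0[of n] by (simp add: x_def y_def algebra_simps)
      qed
      finally have Xt: "X t \<omega> \<le> \<rho> n * (c n * ln (real n * ln \<theta>))" by (simp add: mult_ac)
      have lc: "ln (c n) = real n * ln \<theta>" using \<theta> by (simp add: c_def ln_realpow)
      have "ln (c n) \<le> ln t" using tn c0[of n] by simp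
      then have ll: "ln (real n * ln \<theta>) \<le> ln (ln t)" "0 < ln (real n * ln \<theta>)" using Nn lc by auto
      have den: "c n * ln (real n * ln \<theta>) \<le> t * ln (ln t)" using ll tn c0[of n] by (intro mult_mono) auto
      have dpos: "0 < c n * ln (real n * ln \<theta>)" using ll c0[of n] by simp
      have X0: "0 \<le> X t \<omega>" using XD(4)[of t \<omega>] elim(3) tn c0[of n] by simp
      have "X t \<omega> / (t * ln (ln t)) \<le> X t \<omega> / (c n * ln (real n * ln \<theta>))"
        using den dpos X0 by (intro divide_left_mono) auto
      also have "\<dots> \<le> \<rho> n" using Xt dpos by (simp add: divide_le_eq)
      finally show ?thesis using Nn by linarith
    qed
    then have "\<forall>\<^sub>F t in at_top. ereal (X t \<omega> / (t * ln (ln t))) \<le> ereal (L + d)"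
      unfolding eventually_at_top_linorder by auto
    then show ?case unfolding limsup_ratio_def L_def by (rule Limsup_bounded)
  qed
qed

lemma (in pos_concave) limsup_upper:
  assumes X: "permanental_process M \<alpha> {0<..} (u_tilde f) X" and cont: "continuous_paths_on M {0<..} X"
    and C: "((\<lambda>t. f t / t) \<longlongrightarrow> C) at_top"
  shows "AE \<omega> in M. limsup_ratio X \<omega> \<le> ereal (1 + C)"
proof -
  define d where "d j = 1 / (real j + 1)" for j :: nat
  define L where "L d = (1 + d)\<^sup>2 * (1 + C) + 8 * (1 + f 1) * sqrt d * chain_const + d" for d
  have dj: "0 < d j" "d j \<le> 1" for j by (auto simp: d_def)
  have "d \<longlonglongrightarrow> 0" unfolding d_def by real_asymp
  then have "(\<lambda>j. L (d j)) \<longlonglongrightarrow> (1 + 0)\<^sup>2 * (1 + C) + 8 * (1 + f 1) * sqrt 0 * chain_const + 0"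
    unfolding L_def by (intro tendsto_intros)
  then have lim: "(\<lambda>j. ereal (L (d j))) \<longlonglongrightarrow> ereal (1 + C)" by simp
  have "AE \<omega> in M. limsup_ratio X \<omega> \<le> ereal (L (d j))" for j
    unfolding L_def by (rule limsup_upper_grid[OF X cont C dj])
  then have "AE \<omega> in M. \<forall>j. limsup_ratio X \<omega> \<le> ereal (L (d j))" by (simp add: AE_all_countable)
  then show ?thesis
    by eventually_elim (auto intro: LIMSEQ_le_const[OF lim])
qed

section \<open>The lower bound\<close>

text \<open>
A lower bound for the upper tail: on \<open>[x, x + 1 / b]\<close> the density at \<open>z\<close> is at least a multiple of
\<open>b exp (- (1 + e) b z)\<close>, where the factor \<open>1 + e\<close> absorbs the power of \<open>b z\<close>.
\<close>
lemma gamma_cdf_upper: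
  assumes \<alpha>: "\<alpha> > 0" and e: "e > 0"
  shows "\<exists>K>0. \<forall>b x. b > 0 \<longrightarrow> 1 \<le> b * x \<longrightarrow>
    gamma_cdf \<alpha> b x \<le> ennreal (exp (- (K * exp (- (1 + e) * (b * x)))))"
proof -
  define K where "K = e * exp (- (1 + e)) / Gamma \<alpha>"
  have G: "Gamma \<alpha> > 0" using \<alpha> by (rule Gamma_real_pos)
  have K: "K > 0" using e G by (simp add: K_def)
  have "gamma_cdf \<alpha> b x \<le> ennreal (exp (- (K * exp (- (1 + e) * (b * x)))))"
    if b: "b > 0" and bx: "1 \<le> b * x" for b x
  proof -
    let ?F = "gamma_cdf \<alpha> b x"
    let ?T = "\<integral>\<^sup>+z. indicator {x<..} z * gamma_dens \<alpha> b z \<partial>lborel"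
    define v where "v = K * exp (- (1 + e) * (b * x))"
    have v: "v > 0" using K by (simp add: v_def)
    have x: "x > 0"
    proof (rule ccontr)
      assume "\<not> x > 0"
      then have "b * x \<le> 0" using b by (simp add: mult_nonneg_nonpos)
      then show False using bx by simp
    qed
    have "?F + ?T = (\<integral>\<^sup>+z. indicator {..x} z * gamma_dens \<alpha> b z + indicator {x<..} z * gamma_dens \<alpha> b z \<partial>lborel)"
      by (intro nn_integral_add[symmetric]) auto
    also have "\<dots> = (\<integral>\<^sup>+z. gamma_dens \<alpha> b z \<partial>lborel)"
      by (intro nn_integral_cong) (auto simp: indicator_def)
    finally have FT: "?F + ?T = 1" using nn_integral_gamma_dens[OF \<alpha> b] by simp
    have "ennreal v = ennreal (b * v) * ennreal (1 / b)" using b v by (simp flip: ennreal_mult)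
    also have "ennreal (1 / b) = emeasure lborel {x<..x + 1 / b}" using b by simp
    also have "ennreal (b * v) * emeasure lborel {x<..x + 1 / b} = (\<integral>\<^sup>+z. ennreal (b * v) * indicator {x<..x + 1 / b} z \<partial>lborel)"
      by (rule nn_integral_cmult_indicator[symmetric]) simp
    also have "\<dots> \<le> ?T"
    proof (intro nn_integral_mono)
      fix z :: real
      show "ennreal (b * v) * indicator {x<..x + 1 / b} z \<le> indicator {x<..} z * gamma_dens \<alpha> b z"
      proof (cases "z \<in> {x<..x + 1 / b}")
        case True
        have z: "z > 0" "b * z \<le> b * x + 1" using True x b
          by (auto simp: field_simps)
        have bz: "1 \<le> b * z"
        proof -
          have "b * x \<le> b * z" using True b by (intro mult_left_mono) auto
          then show ?thesis using bx by linarith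
        qed
        have "e * exp (- e * (b * z)) \<le> (b * z) powr (\<alpha> - 1)"
        proof -
          have "e * (b * z) \<le> exp (e * (b * z))" using exp_ge_add_one_self[of "e * (b * z)"] by linarith
          then have "e * (b * z) * exp (- e * (b * z)) \<le> exp (e * (b * z)) * exp (- e * (b * z))"
            by (intro mult_right_mono) auto
          also have "\<dots> = 1" by (simp flip: exp_add)
          finally have "e * exp (- e * (b * z)) \<le> 1 / (b * z)"
            using bz by (simp add: le_divide_eq mult_ac)
          also have "\<dots> = (b * z) powr (- 1)" using bz by (simp add: powr_minus_divide)
          also have "\<dots> \<le> (b * z) powr (\<alpha> - 1)" using bz \<alpha> by (intro powr_mono) auto
          finally show ?thesis .
        qed
        then have "e * exp (- e * (b * z)) * exp (- (b * z)) \<le> (b * z) powr (\<alpha> - 1) * exp (- (b * z))"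
          by (intro mult_right_mono) auto
        moreover have "e * exp (- e * (b * z)) * exp (- (b * z)) = e * exp (- (1 + e) * (b * z))"
          by (simp add: algebra_simps flip: exp_add)
        moreover have "e * exp (- (1 + e) * (b * x + 1)) \<le> e * exp (- (1 + e) * (b * z))"
        proof -
          have "(1 + e) * (b * z) \<le> (1 + e) * (b * x + 1)" using z e by (intro mult_left_mono) auto
          then show ?thesis using e by (intro mult_left_mono) auto
        qed
        ultimately have "e * exp (- (1 + e) * (b * x + 1)) \<le> (b * z) powr (\<alpha> - 1) * exp (- (b * z))" by linarith
        moreover have "e * exp (- (1 + e) * (b * x + 1)) = v * Gamma \<alpha>"
          unfolding v_def K_def using G by (simp add: distrib_left exp_add exp_diff exp_minus mult_ac)
        ultimately have vG: "v * Gamma \<alpha> \<le> (b * z) powr (\<alpha> - 1) * exp (- (b * z))" by simp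
        have "b * v \<le> b * ((b * z) powr (\<alpha> - 1) * exp (- (b * z)) / Gamma \<alpha>)"
          using vG G b by (intro mult_left_mono) (auto simp: le_divide_eq)
        also have "\<dots> = b powr \<alpha> * z powr (\<alpha> - 1) * exp (- b * z) / Gamma \<alpha>"
          using b z by (simp add: powr_mult powr_diff)
        finally show ?thesis using True z by (auto simp: gamma_dens_def intro: ennreal_leI)
      qed simp
    qed
    finally have "ennreal v \<le> ?T" .
    then have "?F + ennreal v \<le> 1" unfolding FT[symmetric] by (rule add_left_mono)
    moreover have "ennreal v \<noteq> \<infinity>" by simp
    ultimately have "?F \<le> 1 - ennreal v"
      by (metis ennreal_add_diff_cancel_right ennreal_minus_mono infinity_ennreal_def order_refl)
    also have "\<dots> = ennreal (1 - v)" using v by (simp add: ennreal_minus flip: ennreal_1)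
    also have "\<dots> \<le> ennreal (exp (- v))" using exp_ge_add_one_self[of "- v"] by (intro ennreal_leI) simp
    finally show ?thesis by (simp add: v_def)
  qed
  with K show ?thesis by blast
qed

text \<open>
For \<open>\<theta> = 1 + 2 / e\<^sup>2\<close> the rate at a grid time \<open>t\<close> other than the first is \<open>(1 + e\<^sup>2) / t\<close>. With the
loss \<open>1 + e\<close> of \<open>gamma_cdf_upper\<close>, the independent gamma variable at \<open>t\<close> exceeds \<open>(1 - e) t ln (ln t)\<close> with
probability at least a multiple of \<open>ln t\<close> to the power \<open>- (1 + e) (1 + e\<^sup>2) (1 - e) = - (1 - e ^ 4)\<close>. Since
\<open>ln t\<close> grows linearly in the index, these probabilities are bounded below by a harmonic series.
\<close>
lemma (in pos_concave) exceeds_on_geometric_grid: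
  assumes X: "permanental_process M \<alpha> {0<..} (u_tilde f) X" and e: "0 < e" "e < 1"
    and \<theta>: "\<theta> = 1 + 2 / e\<^sup>2" and K: "1 \<le> (1 - e) * ln (real K * ln \<theta>)"
  shows "AE \<omega> in M. \<exists>k. (1 - e) * (\<theta> ^ (K + k) * ln (ln (\<theta> ^ (K + k)))) < X (\<theta> ^ (K + k)) \<omega>"
proof -
  note XD = permanental_processD[OF X]
  interpret prob_space M by (rule XD(1))
  have \<theta>1: "\<theta> > 1" using e by (simp add: \<theta>)
  define t where "t k = \<theta> ^ (K + k)" for k
  have t0: "t k > 0" for k using \<theta>1 by (simp add: t_def)
  interpret concave_grid f t
    by (rule grid) (use \<theta>1 t0 in \<open>auto simp: t_def strict_mono_Suc_iff\<close>)
  define \<kappa> where "\<kappa> = 1 + e\<^sup>2"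
  have a_eq: "a (Suc k) = \<kappa> / t (Suc k)" for k
  proof -
    have g: "gap t k = t (Suc k) * ((\<theta> - 1) / \<theta>)" "gap t (Suc k) = t (Suc k) * (\<theta> - 1)"
      using \<theta>1 by (auto simp: gap_def t_def field_simps)
    have "\<theta> / (\<theta> - 1) + 1 / (\<theta> - 1) = \<kappa>" using e by (simp add: \<theta> \<kappa>_def field_simps)
    then have "\<kappa> / t (Suc k) = (\<theta> / (\<theta> - 1) + 1 / (\<theta> - 1)) / t (Suc k)" by simp
    also have "\<dots> = a (Suc k)" unfolding gamma_rate_def using g \<theta>1 t0[of "Suc k"]
      by (simp add: add_divide_distrib mult_ac)
    finally show ?thesis by simp
  qed
  define w where "w k = real (K + k) * ln \<theta>" for k
  have lnt: "ln (t k) = w k" for k using \<theta>1 by (simp add: t_def w_def ln_realpow)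
  have l\<theta>: "ln \<theta> > 0" using \<theta>1 by simp
  have lw: "1 \<le> (1 - e) * ln (w k)" "1 < w k" for k
  proof -
    have "0 < ln (real K * ln \<theta>)" proof (rule ccontr)
      assume "\<not> 0 < ln (real K * ln \<theta>)"
      then have "(1 - e) * ln (real K * ln \<theta>) \<le> 0" using e by (intro mult_nonneg_nonpos) auto
      then show False using K by linarith
    qed
    then have K1: "1 < real K * ln \<theta>" using l\<theta> by (cases "K = 0") auto
    moreover have le: "real K * ln \<theta> \<le> w k" unfolding w_def using l\<theta> by (intro mult_right_mono) auto
    ultimately show "1 < w k" by linarith
    have "ln (real K * ln \<theta>) \<le> ln (w k)" using le K1 by simp
    then have "(1 - e) * ln (real K * ln \<theta>) \<le> (1 - e) * ln (w k)" using e by (intro mult_left_mono) auto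
    then show "1 \<le> (1 - e) * ln (w k)" using K by linarith
  qed
  define c where "c k = (1 - e) * (t k * ln (ln (t k)))" for k
  obtain G where G: "G > 0" and cdf: "\<And>b x. b > 0 \<Longrightarrow> 1 \<le> b * x \<Longrightarrow>
    gamma_cdf \<alpha> b x \<le> ennreal (exp (- (G * exp (- (1 + e) * (b * x)))))"
    using gamma_cdf_upper[OF XD(2) e(1)] by blast
  \<comment> \<open>The first time, whose rate depends on \<open>f\<close>, is discarded by the trivial bound.\<close>
  define v where "v k = (if k = 0 then 0 else G / w k)" for k
  have v0: "v k \<ge> 0" for k using G lw(2)[of k] by (simp add: v_def)
  have F: "gamma_cdf \<alpha> (a k) (c k) \<le> ennreal (exp (- v k))" for k
  proof (cases k)
    case 0
    have "gamma_cdf \<alpha> (a k) (c k) \<le> (\<integral>\<^sup>+z. gamma_dens \<alpha> (a k) z \<partial>lborel)"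
      by (intro nn_integral_mono) (auto simp: indicator_def)
    also have "\<dots> = 1" using XD(2) gamma_rate_pos by (intro nn_integral_gamma_dens)
    finally show ?thesis using 0 by (simp add: v_def)
  next
    case (Suc j)
    have ac: "a k * c k = \<kappa> * ((1 - e) * ln (w k))"
      using t0[of k] Suc by (simp add: a_eq c_def lnt)
    have \<kappa>1: "\<kappa> \<ge> 1" using e by (simp add: \<kappa>_def)
    have "1 * 1 \<le> \<kappa> * ((1 - e) * ln (w k))" using \<kappa>1 lw(1)[of k] by (intro mult_mono) auto
    then have "1 \<le> a k * c k" using ac by simp
    from cdf[OF gamma_rate_pos this]
    have "gamma_cdf \<alpha> (a k) (c k) \<le>
        ennreal (exp (- (G * exp (- (1 + e) * (a k * c k)))))" .
    also have "\<dots> \<le> ennreal (exp (- v k))"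
    proof -
      have "(1 + e) * (a k * c k) = (1 - e ^ 4) * ln (w k)"
        unfolding ac \<kappa>_def by (simp add: algebra_simps power2_eq_square power4_eq_xxxx)
      also have "\<dots> \<le> 1 * ln (w k)" using e lw(2)[of k] by (intro mult_right_mono) auto
      finally have "- ln (w k) \<le> - (1 + e) * (a k * c k)"
        by (simp only: mult_minus_left neg_le_iff_le mult_1_left)
      then have "exp (- ln (w k)) \<le> exp (- (1 + e) * (a k * c k))" by simp
      moreover have "exp (- ln (w k)) = 1 / w k" using lw(2)[of k] by (simp add: exp_minus inverse_eq_divide)
      ultimately have "G * (1 / w k) \<le> G * exp (- (1 + e) * (a k * c k))" using G by (intro mult_left_mono) auto
      then show ?thesis using Suc by (intro ennreal_leI) (simp add: v_def)
    qed
    finally show ?thesis .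
  qed
  have nsum: "\<not> summable v"
  proof
    assume "summable v"
    then have "summable (\<lambda>k. ln \<theta> / G * v (Suc k))" by (intro summable_mult) (simp add: summable_Suc_iff)
    moreover have "(\<lambda>k. ln \<theta> / G * v (Suc k)) = (\<lambda>k. 1 / real (Suc (k + K)))"
    proof
      fix k
      have "v (Suc k) = G / (real (Suc (k + K)) * ln \<theta>)" by (simp add: v_def w_def add.commute)
      then show "ln \<theta> / G * v (Suc k) = 1 / real (Suc (k + K))"
        using G l\<theta> by (simp del: of_nat_Suc)
    qed
    ultimately have "summable (\<lambda>k. 1 / real (Suc (k + K)))" by (simp only:)
    then have "summable (\<lambda>k. 1 / real (Suc k))"
      using summable_iff_shift[of "\<lambda>k. 1 / real (Suc k)" K] by simp
    then have "summable (\<lambda>k. 1 / real k)" using summable_Suc_iff[of "\<lambda>k. 1 / real k"] by simp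
    then show False using not_summable_harmonic[where 'a = real] by (simp add: inverse_eq_divide)
  qed
  let ?E = "{\<omega> \<in> space M. \<forall>k. X (t k) \<omega> \<le> c k}"
  have Xm [measurable]: "X (t k) \<in> borel_measurable M" for k using XD(3) t0 by auto
  have Em: "?E \<in> sets M" by measurable
  have bnd: "measure M ?E \<le> exp (- (\<Sum>k\<le>n. v k))" for n
  proof -
    have "emeasure M ?E \<le> emeasure M {\<omega> \<in> space M. \<forall>i\<le>n. X (t i) \<omega> \<le> c i}"
      by (intro emeasure_mono) auto
    also have "\<dots> \<le> (\<Prod>i\<le>n. gamma_cdf \<alpha> (a i) (c i))"
      using t0 by (intro law_on_grid(2)[OF X]) auto
    also have "\<dots> \<le> (\<Prod>i\<le>n. ennreal (exp (- v i)))" by (intro prod_mono_ennreal F)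
    also have "\<dots> = ennreal (exp (- (\<Sum>k\<le>n. v k)))" by (simp add: prod_ennreal exp_sum flip: sum_negf)
    finally show ?thesis by (simp add: emeasure_eq_measure)
  qed
  have "measure M ?E = 0"
  proof (rule ccontr)
    assume "measure M ?E \<noteq> 0"
    then have m: "measure M ?E > 0" using measure_nonneg[of M ?E] by linarith
    have "(\<Sum>k<n. v k) \<le> - ln (measure M ?E)" for n
    proof -
      have "ln (measure M ?E) \<le> - (\<Sum>k\<le>n. v k)" 
        using ln_le_cancel_iff[THEN iffD2, OF m exp_gt_zero bnd[of n]] by (simp only: ln_exp)
      moreover have "(\<Sum>k<n. v k) \<le> (\<Sum>k\<le>n. v k)" using v0 by (intro sum_mono2) auto
      ultimately show ?thesis by linarith
    qed
    then have "summable v" using v0 by (intro summableI_nonneg_bounded) auto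
    then show False using nsum by simp
  qed
  then have "?E \<in> null_sets M" using Em by (intro null_setsI) (simp_all add: emeasure_eq_measure)
  then show ?thesis
    by (rule AE_I') (auto simp: c_def t_def not_less)
qed

lemma (in pos_concave) limsup_lower:
  assumes X: "permanental_process M \<alpha> {0<..} (u_tilde f) X"
  shows "AE \<omega> in M. 1 \<le> limsup_ratio X \<omega>"
proof -
  have eps: "AE \<omega> in M. ereal (1 - e) \<le> limsup_ratio X \<omega>" if e: "0 < e" "e < 1" for e :: real
  proof -
    define \<theta> where "\<theta> = 1 + 2 / e\<^sup>2"
    have \<theta>1: "\<theta> > 1" using e by (simp add: \<theta>_def)
    then have l\<theta>: "ln \<theta> > 0" by simp
    have "\<forall>\<^sub>F K in sequentially. 1 \<le> (1 - e) * ln (real K * ln \<theta>)"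
      using l\<theta> e by real_asymp
    then obtain K0 where K0: "\<And>K. K \<ge> K0 \<Longrightarrow> 1 \<le> (1 - e) * ln (real K * ln \<theta>)"
      unfolding eventually_sequentially by blast
    have "AE \<omega> in M. \<forall>K. K \<ge> K0 \<longrightarrow> (\<exists>k. (1 - e) * (\<theta> ^ (K + k) * ln (ln (\<theta> ^ (K + k)))) < X (\<theta> ^ (K + k)) \<omega>)"
      unfolding AE_all_countable using exceeds_on_geometric_grid[OF X e \<theta>_def] K0 by (auto intro!: AE_impI)
    then show ?thesis
    proof eventually_elim
      case (elim \<omega>)
      show ?case
      proof (rule ccontr)
        assume "\<not> ereal (1 - e) \<le> limsup_ratio X \<omega>"
        then have "Limsup at_top (\<lambda>t. ereal (X t \<omega> / (t * ln (ln t)))) < ereal (1 - e)"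
          by (simp add: limsup_ratio_def not_le)
        then have "\<forall>\<^sub>F t in at_top. ereal (X t \<omega> / (t * ln (ln t))) < ereal (1 - e)" by (rule Limsup_lessD)
        then obtain T where T: "\<And>t. t \<ge> T \<Longrightarrow> X t \<omega> / (t * ln (ln t)) < 1 - e"
          unfolding eventually_at_top_linorder by auto
        obtain K1 where K1: "T < \<theta> ^ K1" using real_arch_pow[OF \<theta>1] by blast
        obtain K2 :: nat where K2: "1 / ln \<theta> < real K2" using reals_Archimedean2 by blast
        define K where "K = max K0 (max K1 K2)"
        obtain k where k: "(1 - e) * (\<theta> ^ (K + k) * ln (ln (\<theta> ^ (K + k)))) < X (\<theta> ^ (K + k)) \<omega>"
          using elim[rule_format, of K] by (auto simp: K_def)
        let ?t = "\<theta> ^ (K + k)"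
        have "\<theta> ^ K1 \<le> ?t" using \<theta>1 by (intro power_increasing) (auto simp: K_def)
        then have tT: "?t \<ge> T" using K1 by simp
        have "1 < real K2 * ln \<theta>" using K2 l\<theta> by (simp add: divide_less_eq)
        also have "\<dots> \<le> real (K + k) * ln \<theta>" using l\<theta> by (intro mult_right_mono) (auto simp: K_def)
        also have "\<dots> = ln ?t" using \<theta>1 by (simp add: ln_realpow)
        finally have "0 < ln (ln ?t)" by simp
        moreover have "?t > 0" using \<theta>1 by simp
        ultimately have "0 < ?t * ln (ln ?t)" by simp
        then have "1 - e < X ?t \<omega> / (?t * ln (ln ?t))" using k by (simp add: less_divide_eq)
        then show False using T[OF tT] by linarith
      qed
    qed
  qed
  define d where "d j = 1 / (real j + 2)" for j :: nat
  have "d \<longlonglongrightarrow> 0" unfolding d_def by real_asymp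
  then have "(\<lambda>j. 1 - d j) \<longlonglongrightarrow> 1 - 0" by (intro tendsto_intros)
  from tendsto_ereal[OF this] have lim: "(\<lambda>j. ereal (1 - d j)) \<longlonglongrightarrow> 1"
    by (simp only: diff_zero one_ereal_def)
  have "AE \<omega> in M. ereal (1 - d j) \<le> limsup_ratio X \<omega>" for j by (rule eps) (auto simp: d_def)
  then have "AE \<omega> in M. \<forall>j. ereal (1 - d j) \<le> limsup_ratio X \<omega>" by (simp add: AE_all_countable)
  then show ?thesis by eventually_elim (auto intro: LIMSEQ_le_const2[OF lim])
qed

section \<open>Existence of the process\<close>

lemma kernel_det_cong:
  assumes "\<And>i. i < n \<Longrightarrow> t i = t' i" "\<And>i. i < n \<Longrightarrow> s i = s' i" "\<And>i. i < n \<Longrightarrow> w i = w' i"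
  shows "kernel_det n t s w = kernel_det n t' s' w'"
proof -
  have "Matrix.mat n n (\<lambda>(i, j). (if i = j then 1 else 0) + min (t i) (t j) * s j + w j) =
      Matrix.mat n n (\<lambda>(i, j). (if i = j then 1 else 0) + min (t' i) (t' j) * s' j + w' j)"
    using assms by (intro eq_matI) auto
  then show ?thesis unfolding kernel_det_def by simp
qed

definition enum_set :: "real set \<Rightarrow> nat \<Rightarrow> real" where
  "enum_set J k = sorted_list_of_set J ! k"

lemma enum_set:
  assumes "finite J"
  shows bij_enum_set: "bij_betw (enum_set J) {..<card J} J"
    and enum_set_less: "\<And>k l. k < l \<Longrightarrow> l < card J \<Longrightarrow> enum_set J k < enum_set J l"
proof -
  have "bij_betw (\<lambda>k. sorted_list_of_set J ! k) {..<card J} (set (sorted_list_of_set J))"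
    by (rule bij_betw_nth) auto
  then show "bij_betw (enum_set J) {..<card J} J"
    using assms by (simp add: enum_set_def[abs_def])
  have "sorted_wrt (<) (sorted_list_of_set J)" by (rule strict_sorted_list_of_set)
  then show "enum_set J k < enum_set J l" if "k < l" "l < card J" for k l
    unfolding enum_set_def using that by (auto intro: sorted_wrt_nth_less)
qed

text \<open>
The determinant of \<open>I + U S\<close> for a finite set of times with the weights \<open>s\<close> attached to the times
themselves rather than to their indices.
\<close>
definition law_det :: "(real \<Rightarrow> real) \<Rightarrow> real set \<Rightarrow> (real \<Rightarrow> real) \<Rightarrow> real" where
  "law_det f J s = kernel_det (card J) (enum_set J) (\<lambda>k. s (enum_set J k)) (\<lambda>k. f (enum_set J k) * s (enum_set J k))"

text \<open>
For an arbitrary list of times the weights of equal times are added.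
\<close>
lemma law_det_merge:
  assumes J: "finite J" and t: "\<And>i. i < n \<Longrightarrow> t i \<in> J"
  shows "Determinant.det (1\<^sub>m n + Matrix.mat n n (\<lambda>(i, j). u_tilde f (t i) (t j)) * mat_diag n s) =
     law_det f J (\<lambda>x. \<Sum>i | i < n \<and> t i = x. s i)"
proof -
  let ?e = "enum_set J" and ?m = "card J"
  note bij = bij_enum_set[OF J]
  define \<iota> where "\<iota> i = the_inv_into {..<?m} ?e (t i)" for i
  have e: "?e (\<iota> i) = t i" "\<iota> i < ?m" if "i < n" for i
  proof -
    have im: "t i \<in> ?e ` {..<?m}" using bij t[OF that] by (simp add: bij_betw_def)
    have inj: "inj_on ?e {..<?m}" using bij by (simp add: bij_betw_def)
    show "?e (\<iota> i) = t i" unfolding \<iota>_def by (rule f_the_inv_into_f[OF inj im])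
    show "\<iota> i < ?m" unfolding \<iota>_def using the_inv_into_into[OF inj im subset_refl] by simp
  qed
  define V where "V = Matrix.mat ?m ?m (\<lambda>(k, l). u_tilde f (?e k) (?e l))"
  have V: "V \<in> carrier_mat ?m ?m" by (simp add: V_def)
  have "Matrix.mat n n (\<lambda>(i, j). u_tilde f (t i) (t j)) = Matrix.mat n n (\<lambda>(i, j). V $$ (\<iota> i, \<iota> j))"
    by (rule eq_matI) (auto simp: V_def e)
  then have "Determinant.det (1\<^sub>m n + Matrix.mat n n (\<lambda>(i, j). u_tilde f (t i) (t j)) * mat_diag n s) =
      Determinant.det (1\<^sub>m ?m + V * mat_diag ?m (\<lambda>k. \<Sum>i | i < n \<and> \<iota> i = k. s i))"
    using det_merge_times[OF V, of n \<iota> s] e(2) by simp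
  also have "\<dots> = kernel_det ?m ?e (\<lambda>k. \<Sum>i | i < n \<and> \<iota> i = k. s i) (\<lambda>k. f (?e k) * (\<Sum>i | i < n \<and> \<iota> i = k. s i))"
    unfolding V_def by (rule det_u_tilde_kernel)
  also have "\<dots> = law_det f J (\<lambda>x. \<Sum>i | i < n \<and> t i = x. s i)"
  proof -
    have "(\<Sum>i | i < n \<and> \<iota> i = k. s i) = (\<Sum>i | i < n \<and> t i = ?e k. s i)" if k: "k < ?m" for k
    proof (intro sum.cong refl Collect_cong conj_cong)
      fix i assume "i < n"
      then show "\<iota> i = k \<longleftrightarrow> t i = ?e k"
        using e[of i] k bij by (metis bij_betw_def inj_onD lessThan_iff)
    qed
    then show ?thesis unfolding law_det_def by (intro kernel_det_cong) auto
  qed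
  finally show ?thesis .
qed

text \<open>
Times of weight 0 can be omitted; this is the consistency of the finite-dimensional laws.
\<close>
lemma law_det_subset:
  assumes J: "finite J" and K: "K \<subseteq> J" and s: "\<And>j. j \<in> J - K \<Longrightarrow> s j = 0"
  shows "law_det f K s = law_det f J s"
proof -
  have fK: "finite K" using J K by (rule finite_subset[rotated])
  note bij = bij_enum_set[OF fK]
  let ?e = "enum_set K"
  have eK: "?e i \<in> K" if "i < card K" for i using bij that by (auto simp: bij_betw_def)
  have "law_det f K s = Determinant.det (1\<^sub>m (card K) +
      Matrix.mat (card K) (card K) (\<lambda>(i, j). u_tilde f (?e i) (?e j)) * mat_diag (card K) (\<lambda>i. s (?e i)))"
    unfolding law_det_def det_u_tilde_kernel ..
  also have "\<dots> = law_det f J (\<lambda>x. \<Sum>i | i < card K \<and> ?e i = x. s (?e i))"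
    using eK K by (intro law_det_merge J) auto
  also have "\<dots> = law_det f J s"
  proof -
    have "(\<Sum>i | i < card K \<and> ?e i = x. s (?e i)) = s x" if "x \<in> J" for x
    proof (cases "x \<in> K")
      case True
      then have "x \<in> ?e ` {..<card K}" using bij by (simp add: bij_betw_def)
      then obtain i where i: "i < card K" "?e i = x" by blast
      then have "{i. i < card K \<and> ?e i = x} = {i}"
        using bij by (auto simp: bij_betw_def inj_on_def)
      then show ?thesis using i by simp
    next
      case False
      then have "{i. i < card K \<and> ?e i = x} = {}" using eK by auto
      then show ?thesis using s that False by simp
    qed
    moreover have "enum_set J k \<in> J" if "k < card J" for k
      using bij_enum_set[OF J] that by (auto simp: bij_betw_def)
    ultimately show ?thesis unfolding law_det_def by (intro kernel_det_cong) auto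
  qed
  finally show ?thesis .
qed

definition is_fd_law :: "(real \<Rightarrow> real) \<Rightarrow> real \<Rightarrow> real set \<Rightarrow> (real \<Rightarrow> real) measure \<Rightarrow> bool" where
  "is_fd_law f \<alpha> J \<mu> \<longleftrightarrow> prob_space \<mu> \<and> sets \<mu> = sets (PiM J (\<lambda>_. borel)) \<and>
     (AE x in \<mu>. \<forall>j\<in>J. 0 \<le> x j) \<and>
     (\<forall>s. (\<forall>j\<in>J. 0 \<le> s j) \<longrightarrow>
        laplace J \<mu> s = ennreal (law_det f J s powr (- \<alpha>)))"

lemma is_fd_law_unique:
  assumes "finite J" "is_fd_law f \<alpha> J \<mu>" "is_fd_law f \<alpha> J \<nu>" shows "\<mu> = \<nu>"
proof (rule laplace_determines_measure_PiM[OF assms(1)])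
  fix s :: "real \<Rightarrow> real" assume "\<And>i. i \<in> J \<Longrightarrow> s i > 0"
  then have "\<forall>j\<in>J. 0 \<le> s j" by (auto intro: less_imp_le)
  then show "laplace J \<mu> s = laplace J \<nu> s"
    using assms unfolding is_fd_law_def by simp
qed (use assms in \<open>auto simp: is_fd_law_def prob_space_def\<close>)

lemma is_fd_law_restrict:
  assumes H: "finite H" and J: "J \<subseteq> H" and \<mu>: "is_fd_law f \<alpha> H \<mu>"
  shows "is_fd_law f \<alpha> J (distr \<mu> (PiM J (\<lambda>_. borel)) (\<lambda>x. restrict x J))"
proof -
  have s: "sets \<mu> = sets (PiM H (\<lambda>_. borel))" and ps: "prob_space \<mu>" and nn: "AE x in \<mu>. \<forall>j\<in>H. 0 \<le> x j"
    using \<mu> by (auto simp: is_fd_law_def)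
  have R [measurable]: "(\<lambda>x. restrict x J) \<in> \<mu> \<rightarrow>\<^sub>M PiM J (\<lambda>_. borel)"
    unfolding measurable_cong_sets[OF s refl] by (rule measurable_restrict_subset[OF J])
  have fJ: "finite J" using H J by (rule finite_subset[rotated])
  have "laplace J (distr \<mu> (PiM J (\<lambda>_. borel)) (\<lambda>x. restrict x J)) v =
      ennreal (law_det f J v powr (- \<alpha>))" if v: "\<forall>j\<in>J. 0 \<le> v j" for v
  proof -
    define v' where "v' j = (if j \<in> J then v j else 0)" for j
    have "(\<lambda>x. ennreal (exp (- (\<Sum>j\<in>J. v j * x j)))) \<in> borel_measurable (PiM J (\<lambda>_. borel))" by measurable
    then have "laplace J (distr \<mu> (PiM J (\<lambda>_. borel)) (\<lambda>x. restrict x J)) v =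
        (\<integral>\<^sup>+x. ennreal (exp (- (\<Sum>j\<in>J. v j * restrict x J j))) \<partial>\<mu>)"
      by (intro nn_integral_distr[OF R]) simp
    also have "\<dots> = laplace H \<mu> v'"
    proof (intro nn_integral_cong)
      fix x
      have "(\<Sum>j\<in>H. v' j * x j) = (\<Sum>j\<in>J. v' j * x j)"
        using H J by (intro sum.mono_neutral_right) (auto simp: v'_def)
      also have "\<dots> = (\<Sum>j\<in>J. v j * restrict x J j)" by (intro sum.cong) (auto simp: v'_def)
      finally show "ennreal (exp (- (\<Sum>j\<in>J. v j * restrict x J j))) = ennreal (exp (- (\<Sum>j\<in>H. v' j * x j)))" by simp
    qed
    also have "\<dots> = ennreal (law_det f H v' powr (- \<alpha>))"
    proof -
      have "\<forall>j\<in>H. 0 \<le> v' j" using v by (simp add: v'_def)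
      then show ?thesis using \<mu> unfolding is_fd_law_def by blast
    qed
    also have "law_det f H v' = law_det f J v'"
      by (rule law_det_subset[symmetric, OF H J]) (auto simp: v'_def)
    also have "\<dots> = law_det f J v"
    proof -
      have "enum_set J k \<in> J" if "k < card J" for k
        using bij_enum_set[OF fJ] that by (auto simp: bij_betw_def)
      then show ?thesis unfolding law_det_def by (intro kernel_det_cong) (auto simp: v'_def)
    qed
    finally show ?thesis .
  qed
  moreover have "AE x in distr \<mu> (PiM J (\<lambda>_. borel)) (\<lambda>x. restrict x J). \<forall>j\<in>J. 0 \<le> x j"
  proof (subst AE_distr_iff[OF R])
    show "{x \<in> space (PiM J (\<lambda>_. borel)). \<forall>j\<in>J. 0 \<le> x j} \<in> sets (PiM J (\<lambda>_. borel :: real measure))"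
      using fJ by measurable
    show "AE x in \<mu>. \<forall>j\<in>J. 0 \<le> restrict x J j" using nn J by (auto elim!: eventually_mono)
  qed
  ultimately show ?thesis
    unfolding is_fd_law_def using prob_space.prob_space_distr[OF ps R] by simp
qed

lemma (in pos_concave) is_fd_law_exists:
  assumes \<alpha>: "\<alpha> > 0" and J: "finite J" "J \<subseteq> {0<..}"
  shows "\<exists>\<mu>. is_fd_law f \<alpha> J \<mu>"
proof (cases "J = {}")
  case True
  have p: "prob_space (PiM {} (\<lambda>_. borel) :: (real \<Rightarrow> real) measure)" by (rule prob_spaceI) (simp add: space_PiM_empty)
  then have "is_fd_law f \<alpha> J (PiM {} (\<lambda>_. borel))"
    unfolding is_fd_law_def True
    by (auto simp: law_det_def kernel_det_def prob_space.emeasure_space_1)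
  then show ?thesis ..
next
  case False
  define n where "n = card J - 1"
  have n: "card J = Suc n" using False J by (simp add: n_def card_gt_0_iff)
  let ?e = "enum_set J"
  note bij = bij_enum_set[OF J(1)]
  \<comment> \<open>The finite set of times is extended to an infinite grid.\<close>
  define t where "t k = (if k \<le> n then ?e k else ?e n + real (k - n))" for k
  have te: "t k = ?e k" if "k \<le> n" for k using that by (simp add: t_def)
  have "t k < t (Suc k)" for k
    using enum_set_less[OF J(1), of k "Suc k"] n
    by (cases "Suc k \<le> n") (auto simp: t_def not_less_eq_eq le_Suc_eq)
  then have sm: "strict_mono t" by (simp add: strict_mono_Suc_iff)
  have "?e 0 \<in> J" using bij n by (auto simp: bij_betw_def)
  then have t0: "0 < t 0" using J te[of 0] by auto
  interpret concave_grid f t by (rule grid[OF t0 sm])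
  obtain \<mu> where \<mu>: "prob_space \<mu>" "sets \<mu> = sets (PiM {..n} (\<lambda>_. borel))" "AE x in \<mu>. \<forall>i\<le>n. 0 \<le> x i"
    and lap: "\<And>s. \<forall>i\<le>n. 0 < a i + s i \<Longrightarrow> pivots_pos t n s (\<lambda>i. f (t i) * s i) \<Longrightarrow>
       laplace {..n} \<mu> s =
         ennreal (kernel_det (Suc n) t s (\<lambda>i. f (t i) * s i) powr (- \<alpha>))"
    using gamma_mixture[OF \<alpha>, of n] by auto
  have bij': "bij_betw ?e {..n} J" using bij n by (simp add: lessThan_Suc_atMost)
  define \<iota> where "\<iota> = the_inv_into {..n} ?e"
  have inj: "inj_on ?e {..n}" and im: "?e ` {..n} = J" using bij' by (auto simp: bij_betw_def)
  have \<iota>: "\<iota> j \<le> n" if "j \<in> J" for j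
    using the_inv_into_into[OF inj _ subset_refl, of j] that im by (simp add: \<iota>_def)
  have \<iota>e: "\<iota> (?e i) = i" if "i \<le> n" for i
    using the_inv_into_f_f[OF inj, of i] that by (simp add: \<iota>_def)
  let ?g = "\<lambda>x. \<lambda>j\<in>J. x (\<iota> j)"
  let ?N = "PiM J (\<lambda>_. borel :: real measure)"
  have g [measurable]: "?g \<in> \<mu> \<rightarrow>\<^sub>M ?N"
    unfolding measurable_cong_sets[OF \<mu>(2) refl] by (intro measurable_restrict measurable_component_singleton) (use \<iota> in auto)
  have "is_fd_law f \<alpha> J (distr \<mu> ?N ?g)"
    unfolding is_fd_law_def
  proof (intro conjI allI impI)
    show "prob_space (distr \<mu> ?N ?g)" by (rule prob_space.prob_space_distr[OF \<mu>(1) g])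
    show "AE x in distr \<mu> ?N ?g. \<forall>j\<in>J. 0 \<le> x j"
    proof (subst AE_distr_iff[OF g])
      show "{x \<in> space ?N. \<forall>j\<in>J. 0 \<le> x j} \<in> sets ?N" using J by measurable
      show "AE x in \<mu>. \<forall>j\<in>J. 0 \<le> ?g x j" using \<mu>(3) by eventually_elim (simp add: \<iota>)
    qed
  next
    fix s :: "real \<Rightarrow> real" assume s: "\<forall>j\<in>J. 0 \<le> s j"
    define v where "v i = s (?e i)" for i
    have v: "0 \<le> v i" if "i \<le> n" for i using s im that by (auto simp: v_def)
    have "(\<lambda>x. ennreal (exp (- (\<Sum>j\<in>J. s j * x j)))) \<in> borel_measurable ?N" by measurable
    then have "laplace J (distr \<mu> ?N ?g) s =
        (\<integral>\<^sup>+x. ennreal (exp (- (\<Sum>j\<in>J. s j * ?g x j))) \<partial>\<mu>)"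
      by (intro nn_integral_distr[OF g]) simp
    also have "\<dots> = laplace {..n} \<mu> v"
    proof (intro nn_integral_cong)
      fix x
      have "(\<Sum>j\<in>J. s j * ?g x j) = (\<Sum>j\<in>J. s j * x (\<iota> j))" by (intro sum.cong) auto
      also have "\<dots> = (\<Sum>i\<le>n. s (?e i) * x (\<iota> (?e i)))"
        by (rule sum.reindex_bij_betw[OF bij', symmetric])
      also have "\<dots> = (\<Sum>i\<le>n. v i * x i)" by (intro sum.cong) (auto simp: v_def \<iota>e)
      finally show "ennreal (exp (- (\<Sum>j\<in>J. s j * ?g x j))) = ennreal (exp (- (\<Sum>i\<le>n. v i * x i)))" by simp
    qed
    also have "\<dots> = ennreal (kernel_det (Suc n) t v (\<lambda>i. f (t i) * v i) powr (- \<alpha>))"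
    proof (rule lap)
      show "\<forall>i\<le>n. 0 < a i + v i" using v gamma_rate_pos by (simp add: add_pos_nonneg)
      show "pivots_pos t n v (\<lambda>i. f (t i) * v i)"
      proof (rule pivots_pos_nonneg[OF strict_mono_t t0_pos])
        show "0 \<le> v i" if "i \<le> n" for i using v[OF that] .
        then show "0 \<le> f (t i) * v i" if "i \<le> n" for i using f_pos[of i] that by simp
      qed
    qed
    also have "kernel_det (Suc n) t v (\<lambda>i. f (t i) * v i) = law_det f J s"
      unfolding law_det_def n by (intro kernel_det_cong) (auto simp: te v_def)
    finally show "laplace J (distr \<mu> ?N ?g) s = ennreal (law_det f J s powr (- \<alpha>))" .
  qed simp
  then show ?thesis ..
qed

text \<open>
Kolmogorov's extension theorem on the half-line. In the coordinate process the values are nonnegative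
almost surely only; taking \<open>max 0\<close> makes them nonnegative everywhere without changing the laws.
\<close>
lemma (in pos_concave) permanental_process_exists:
  assumes \<alpha>: "\<alpha> > 0"
  shows "\<exists>(M :: (real \<Rightarrow> real) measure) X. permanental_process M \<alpha> {0<..} (u_tilde f) X"
proof -
  let ?I = "{0<..} :: real set"
  define P where "P J = (SOME \<mu>. is_fd_law f \<alpha> J \<mu>)" for J
  have lawP: "is_fd_law f \<alpha> J (P J)" if "finite J" "J \<subseteq> ?I" for J
    unfolding P_def by (rule someI_ex[OF is_fd_law_exists[OF \<alpha> that]])
  interpret polish_projective ?I P
  proof (intro polish_projective.intro projective_family.intro)
    fix J H :: "real set" assume JH: "J \<subseteq> H" "finite H" "H \<subseteq> ?I"
    then have J: "finite J" "J \<subseteq> ?I" by (auto intro: finite_subset)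
    show "P J = distr (P H) (PiM J (\<lambda>_. borel)) (\<lambda>f. restrict f J)"
      by (rule is_fd_law_unique[OF J(1) lawP[OF J] is_fd_law_restrict[OF JH(2,1) lawP[OF JH(2,3)]]])
  next
    fix J :: "real set" assume "finite J" "J \<subseteq> ?I"
    then show "prob_space (P J)" using lawP[of J] by (simp add: is_fd_law_def)
  qed
  let ?M = "lim :: (real \<Rightarrow> real) measure"
  define X where "X t \<omega> = max 0 (\<omega> t)" for t and \<omega> :: "real \<Rightarrow> real"
  have ps: "prob_space ?M" by (rule P.prob_space_axioms)
  have Mm: "(\<lambda>\<omega>. \<omega> t) \<in> borel_measurable ?M" if "t \<in> ?I" for t
    unfolding measurable_cong_sets[OF sets_lim refl] using that by simp
  have Xm: "X t \<in> borel_measurable ?M" if "t \<in> ?I" for t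
    unfolding X_def[abs_def] using Mm[OF that] by measurable
  have marg: "distr ?M (PiM J (\<lambda>_. borel)) (\<lambda>\<omega>. restrict \<omega> J) = P J" if J: "finite J" "J \<subseteq> ?I" for J
  proof (rule measure_eqI)
    have R: "(\<lambda>\<omega>. restrict \<omega> J) \<in> ?M \<rightarrow>\<^sub>M PiM J (\<lambda>_. borel)"
      unfolding measurable_cong_sets[OF sets_lim refl] by (rule measurable_restrict_subset[OF J(2)])
    show "sets (distr ?M (PiM J (\<lambda>_. borel)) (\<lambda>\<omega>. restrict \<omega> J)) = sets (P J)"
      using lawP[OF J] by (simp add: is_fd_law_def)
    fix A assume "A \<in> sets (distr ?M (PiM J (\<lambda>_. borel)) (\<lambda>\<omega>. restrict \<omega> J))"
    then have A: "A \<in> sets (PiM J (\<lambda>_. borel))" by simp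
    have "emeasure (distr ?M (PiM J (\<lambda>_. borel)) (\<lambda>\<omega>. restrict \<omega> J)) A = emeasure ?M ((\<lambda>\<omega>. restrict \<omega> J) -` A \<inter> space ?M)"
      by (rule emeasure_distr[OF R A])
    also have "(\<lambda>\<omega>. restrict \<omega> J) -` A \<inter> space ?M = prod_emb ?I (\<lambda>_. borel) J A"
      by (simp add: prod_emb_def space_PiM)
    also have "emeasure ?M \<dots> = emeasure (P J) A" by (rule emeasure_lim_emb[OF J(2,1) A])
    finally show "emeasure (distr ?M (PiM J (\<lambda>_. borel)) (\<lambda>\<omega>. restrict \<omega> J)) A = emeasure (P J) A" .
  qed
  have lap: "(\<integral>\<omega>. exp (- (\<Sum>i<n. s i * X (t i) \<omega>)) \<partial>?M) =
      Determinant.det (1\<^sub>m n + Matrix.mat n n (\<lambda>(i, j). u_tilde f (t i) (t j)) * mat_diag n s) powr (- \<alpha>)"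
    if t: "\<forall>i<n. t i \<in> ?I" and s: "\<forall>i<n. s i > 0" for n t s
  proof -
    define J where "J = t ` {..<n}"
    have J: "finite J" "J \<subseteq> ?I" using t by (auto simp: J_def)
    let ?N = "PiM J (\<lambda>_. borel :: real measure)"
    have R: "(\<lambda>\<omega>. restrict \<omega> J) \<in> ?M \<rightarrow>\<^sub>M ?N"
      unfolding measurable_cong_sets[OF sets_lim refl] by (rule measurable_restrict_subset[OF J(2)])
    define v where "v x = (\<Sum>i | i < n \<and> t i = x. s i)" for x
    have "0 \<le> s i" if "i < n" for i using s that by (simp add: less_imp_le)
    then have v: "\<forall>x\<in>J. 0 \<le> v x" unfolding v_def by (intro ballI sum_nonneg) auto
    have ss: "(\<Sum>i<n. s i * z (t i)) = (\<Sum>x\<in>J. v x * z x)" for z :: "real \<Rightarrow> real"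
    proof -
      have "(\<Sum>i<n. s i * z (t i)) = (\<Sum>x\<in>J. \<Sum>i\<in>{i \<in> {..<n}. t i = x}. s i * z (t i))"
        by (rule sum.group[symmetric]) (auto simp: J_def)
      also have "\<dots> = (\<Sum>x\<in>J. v x * z x)"
        unfolding v_def sum_distrib_right by (intro sum.cong) auto
      finally show ?thesis .
    qed
    have nn: "AE \<omega> in ?M. \<forall>x\<in>J. 0 \<le> \<omega> x"
    proof -
      have "AE x in distr ?M ?N (\<lambda>\<omega>. restrict \<omega> J). \<forall>j\<in>J. 0 \<le> x j"
        unfolding marg[OF J] using lawP[OF J] by (simp add: is_fd_law_def)
      moreover have "{x \<in> space ?N. \<forall>j\<in>J. 0 \<le> x j} \<in> sets ?N" using J by measurable
      ultimately have "AE \<omega> in ?M. \<forall>j\<in>J. 0 \<le> restrict \<omega> J j" by (subst (asm) AE_distr_iff[OF R])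
      then show ?thesis by eventually_elim auto
    qed
    have m: "(\<lambda>x. ennreal (exp (- (\<Sum>j\<in>J. v j * x j)))) \<in> borel_measurable ?N" by measurable
    have [measurable]: "X (t i) \<in> borel_measurable ?M" if "i \<in> {..<n}" for i using t that by (intro Xm) auto
    have "(\<integral>\<omega>. exp (- (\<Sum>i<n. s i * X (t i) \<omega>)) \<partial>?M) = enn2real (\<integral>\<^sup>+\<omega>. ennreal (exp (- (\<Sum>i<n. s i * X (t i) \<omega>))) \<partial>?M)"
      by (intro integral_eq_nn_integral) auto
    also have "(\<integral>\<^sup>+\<omega>. ennreal (exp (- (\<Sum>i<n. s i * X (t i) \<omega>))) \<partial>?M) =
        (\<integral>\<^sup>+\<omega>. ennreal (exp (- (\<Sum>j\<in>J. v j * restrict \<omega> J j))) \<partial>?M)"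
    proof (intro nn_integral_cong_AE, use nn in eventually_elim)
      fix \<omega> :: "real \<Rightarrow> real" assume "\<forall>x\<in>J. 0 \<le> \<omega> x"
      then have "(\<Sum>x\<in>J. v x * X x \<omega>) = (\<Sum>x\<in>J. v x * restrict \<omega> J x)"
        by (intro sum.cong) (auto simp: X_def)
      then show "ennreal (exp (- (\<Sum>i<n. s i * X (t i) \<omega>))) = ennreal (exp (- (\<Sum>j\<in>J. v j * restrict \<omega> J j)))"
        using ss[of "\<lambda>x. X x \<omega>"] by simp
    qed
    also have "\<dots> = laplace J (distr ?M ?N (\<lambda>\<omega>. restrict \<omega> J)) v"
      by (intro nn_integral_distr[OF R, symmetric]) (use m in simp)
    also have "\<dots> = ennreal (law_det f J v powr (- \<alpha>))"
      unfolding marg[OF J] using lawP[OF J] v by (simp add: is_fd_law_def)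
    also have "law_det f J v = Determinant.det (1\<^sub>m n + Matrix.mat n n (\<lambda>(i, j). u_tilde f (t i) (t j)) * mat_diag n s)"
      unfolding v_def by (rule law_det_merge[symmetric]) (auto simp: J_def)
    finally show ?thesis by simp
  qed
  have "permanental_process ?M \<alpha> ?I (u_tilde f) X"
    unfolding permanental_process_def permanental_vector_def
    using ps \<alpha> Xm lap by (auto simp: X_def)
  then show ?thesis by blast
qed

section \<open>Continuous paths\<close>

lemma kernel_det_tendsto:
  assumes "\<And>i. i < n \<Longrightarrow> (\<lambda>m. t m i) \<longlonglongrightarrow> t' i" "\<And>i. i < n \<Longrightarrow> (\<lambda>m. w m i) \<longlonglongrightarrow> w' i"
  shows "(\<lambda>m. kernel_det n (t m) s (w m)) \<longlonglongrightarrow> kernel_det n t' s w'"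
proof -
  let ?A = "\<lambda>t w. Matrix.mat n n (\<lambda>(i, j). (if i = j then 1 else 0) + min (t i) (t j) * s j + w j) :: real mat"
  have e: "kernel_det n t s w = (\<Sum>p | p permutes {0..<n}. signof p * (\<Prod>i = 0..<n. (if i = p i then 1 else 0) + min (t i) (t (p i)) * s (p i) + w (p i)))"
    for t w
  proof -
    have "kernel_det n t s w = (\<Sum>p | p permutes {0..<n}. signof p * (\<Prod>i = 0..<n. ?A t w $$ (i, p i)))"
      unfolding kernel_det_def by (rule det_def') simp
    also have "\<dots> = (\<Sum>p | p permutes {0..<n}. signof p * (\<Prod>i = 0..<n. (if i = p i then 1 else 0) + min (t i) (t (p i)) * s (p i) + w (p i)))"
    proof (intro sum.cong refl arg_cong2[where f = "(*)"] prod.cong)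
      fix p i assume "p \<in> {p. p permutes {0..<n}}" "i \<in> {0..<n}"
      then have "i < n" "p i < n" using permutes_in_image[of p "{0..<n}" i] by auto
      then show "?A t w $$ (i, p i) = (if i = p i then 1 else 0) + min (t i) (t (p i)) * s (p i) + w (p i)" by simp
    qed
    finally show ?thesis .
  qed
  show ?thesis
    unfolding e
  proof (intro tendsto_sum tendsto_mult tendsto_const tendsto_prod tendsto_add tendsto_min)
    fix p i assume "p \<in> {p. p permutes {0..<n}}" "i \<in> {0..<n}"
    then have "i < n" "p i < n" using permutes_in_image[of p "{0..<n}" i] by auto
    then show "(\<lambda>m. t m i) \<longlonglongrightarrow> t' i" "(\<lambda>m. t m (p i)) \<longlonglongrightarrow> t' (p i)" "(\<lambda>m. w m (p i)) \<longlonglongrightarrow> w' (p i)"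
      using assms by auto
  qed
qed

lemma floor_double: "\<lfloor>2 * x\<rfloor> = 2 * \<lfloor>x\<rfloor> \<or> \<lfloor>2 * x\<rfloor> = 2 * \<lfloor>x\<rfloor> + 1" for x :: real
  by linarith

text \<open>
Each approximant evaluates \<open>g\<close> at the right end of a dyadic cell. Passing to the next level either
keeps that point or moves it one step of the new level to the left, so the summable bounds make
the approximants converge uniformly; two points at distance less than \<open>1 / 2 ^ m\<close> lie in equal or
neighbouring cells of level \<open>m\<close>, which gives the continuity of the limit.
\<close>
lemma grid_limit:
  fixes g :: "real \<Rightarrow> real" and x :: "nat \<Rightarrow> real" and c L :: real
  defines "G \<equiv> \<lambda>m (v :: real). g (c + L * (real (Suc (nat \<lfloor>v * 2 ^ m\<rfloor>)) / 2 ^ m))"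
  assumes inc: "\<And>m k. m \<ge> m0 \<Longrightarrow> k < 2 ^ m \<Longrightarrow>
      \<bar>g (c + L * (real (Suc k) / 2 ^ m)) - g (c + L * (real k / 2 ^ m))\<bar> \<le> x m"
    and x: "summable x"
  shows "\<exists>h. (\<forall>v\<in>{0..<1}. (\<lambda>m. G m v) \<longlonglongrightarrow> h v) \<and> continuous_on {0..<1} h"
proof -
  have x0: "0 \<le> x m" if "m \<ge> m0" for m using order_trans[OF abs_ge_zero inc[OF that, of 0]] by simp
  define k where "k m v = nat \<lfloor>v * 2 ^ m\<rfloor>" for m :: nat and v :: real
  have G: "G m v = g (c + L * (real (Suc (k m v)) / 2 ^ m))" for m v by (simp only: G_def k_def)
  have k_less: "k m v < 2 ^ m" if "v \<in> {0..<1}" for m v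
  proof -
    have "v * 2 ^ m < 1 * 2 ^ m" using that by (intro mult_strict_right_mono) auto
    then have "\<lfloor>v * 2 ^ m\<rfloor> < 2 ^ m" by (simp add: floor_less_iff)
    then show ?thesis unfolding k_def by (simp add: nat_less_iff)
  qed
  have step: "\<bar>G (Suc m) v - G m v\<bar> \<le> x (Suc m)" if v: "v \<in> {0..<1}" and m: "m \<ge> m0" for m v
  proof -
    have f0: "0 \<le> \<lfloor>v * 2 ^ m\<rfloor>" using v by simp
    have "v * 2 ^ Suc m = 2 * (v * 2 ^ m)" by simp
    with floor_double[of "v * 2 ^ m"]
    have "\<lfloor>v * 2 ^ Suc m\<rfloor> = 2 * \<lfloor>v * 2 ^ m\<rfloor> \<or> \<lfloor>v * 2 ^ Suc m\<rfloor> = 2 * \<lfloor>v * 2 ^ m\<rfloor> + 1" by (simp only:)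
    then have "k (Suc m) v = 2 * k m v \<or> k (Suc m) v = Suc (2 * k m v)"
      using f0 unfolding k_def by linarith
    then show ?thesis
    proof
      assume a: "k (Suc m) v = Suc (2 * k m v)"
      have "real (Suc (Suc (2 * k m v))) / 2 ^ Suc m = real (Suc (k m v)) / 2 ^ m" by (simp add: field_simps)
      then have "G (Suc m) v = G m v" unfolding G a by (simp only:)
      then show ?thesis using x0[of "Suc m"] m by simp
    next
      assume a: "k (Suc m) v = 2 * k m v"
      have e: "real (Suc (Suc (2 * k m v))) / 2 ^ Suc m = real (Suc (k m v)) / 2 ^ m" by (simp add: field_simps)
      have "Suc (2 * k m v) < 2 ^ Suc m" using k_less[OF v, of m] by simp
      from inc[OF _ this] m show ?thesis unfolding G a e by (simp add: abs_minus_commute)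
    qed
  qed
  define r where "r m = (\<Sum>i. x (i + Suc m))" for m
  have sx: "summable (\<lambda>i. x (i + n))" for n using x by (simp add: summable_iff_shift)
  have tele: "\<bar>G (m + n) v - G m v\<bar> \<le> r m" if v: "v \<in> {0..<1}" and m: "m \<ge> m0" for m n v
  proof -
    have "\<bar>G (m + n) v - G m v\<bar> \<le> (\<Sum>i<n. x (i + Suc m))"
    proof (induction n)
      case (Suc n)
      have "\<bar>G (Suc (m + n)) v - G (m + n) v\<bar> \<le> x (Suc (m + n))" using m by (intro step v) simp
      with Suc show ?case by (simp add: add_ac)
    qed simp
    also have "\<dots> \<le> r m"
      unfolding r_def using x0 m by (intro sum_le_suminf sx) auto
    finally show ?thesis .
  qed
  have r0: "r \<longlonglongrightarrow> 0"
    unfolding r_def using suminf_exist_split2[OF x] by (rule LIMSEQ_Suc)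
  have conv: "convergent (\<lambda>m. G m v)" if v: "v \<in> {0..<1}" for v
  proof (rule Cauchy_convergent, rule metric_CauchyI)
    fix e :: real assume e: "e > 0"
    have "\<forall>\<^sub>F m in sequentially. r m < e / 2" using order_tendstoD(2)[OF r0, of "e / 2"] e by simp
    then obtain N where N: "\<And>m. m \<ge> N \<Longrightarrow> r m < e / 2" unfolding eventually_sequentially by blast
    define M where "M = max N m0"
    have "dist (G i v) (G j v) < e" if "i \<ge> M" "j \<ge> M" for i j
    proof -
      have "\<bar>G i v - G M v\<bar> \<le> r M" "\<bar>G j v - G M v\<bar> \<le> r M"
        using tele[OF v, of M "i - M"] tele[OF v, of M "j - M"] that by (auto simp: M_def)
      moreover have "r M < e / 2" using N by (simp add: M_def)
      ultimately show ?thesis unfolding dist_real_def by linarith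
    qed
    then show "\<exists>M. \<forall>i\<ge>M. \<forall>j\<ge>M. dist (G i v) (G j v) < e" by blast
  qed
  define h where "h v = lim (\<lambda>m. G m v)" for v
  have h: "(\<lambda>m. G m v) \<longlonglongrightarrow> h v" if "v \<in> {0..<1}" for v
    using conv[OF that] unfolding h_def by (simp add: convergent_LIMSEQ_iff)
  have hr: "\<bar>h v - G m v\<bar> \<le> r m" if v: "v \<in> {0..<1}" and m: "m \<ge> m0" for m v
  proof -
    have "(\<lambda>n. \<bar>G (n + m) v - G m v\<bar>) \<longlonglongrightarrow> \<bar>h v - G m v\<bar>"
      by (intro tendsto_intros LIMSEQ_ignore_initial_segment h v)
    then show ?thesis using tele[OF v m] by (intro LIMSEQ_le_const2) (auto simp: add.commute)
  qed
  have near: "\<bar>G m v - G m v'\<bar> \<le> x m"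
    if v: "v \<in> {0..<1}" "v' \<in> {0..<1}" and m: "m \<ge> m0" and le: "v \<le> v'" and d: "v' - v < 1 / 2 ^ m" for m v v'
  proof -
    have a: "v * 2 ^ m \<le> v' * 2 ^ m" using le by (intro mult_right_mono) auto
    have "(v' - v) * 2 ^ m < 1 / 2 ^ m * 2 ^ m" using d by (intro mult_strict_right_mono) auto
    then have b: "v' * 2 ^ m < v * 2 ^ m + 1" by (simp add: algebra_simps)
    have "\<lfloor>v' * 2 ^ m\<rfloor> = \<lfloor>v * 2 ^ m\<rfloor> \<or> \<lfloor>v' * 2 ^ m\<rfloor> = \<lfloor>v * 2 ^ m\<rfloor> + 1" using a b by linarith
    moreover have "0 \<le> \<lfloor>v * 2 ^ m\<rfloor>" using v by simp
    ultimately have "k m v' = k m v \<or> k m v' = Suc (k m v)" unfolding k_def by (auto simp: nat_add_distrib)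
    then show ?thesis
    proof
      assume "k m v' = k m v" then show ?thesis using x0[OF m] by (simp add: G)
    next
      assume a: "k m v' = Suc (k m v)"
      then have "Suc (k m v) < 2 ^ m" using k_less[OF v(2), of m] by simp
      from inc[OF m this] show ?thesis unfolding G a by (simp add: abs_minus_commute)
    qed
  qed
  have x_lim: "x \<longlonglongrightarrow> 0" using x by (rule summable_LIMSEQ_zero)
  have "continuous_on {0..<1} h"
    unfolding continuous_on_iff
  proof (intro ballI allI impI)
    fix v e :: real assume v: "v \<in> {0..<1}" and e: "e > 0"
    have "\<forall>\<^sub>F m in sequentially. r m < e / 3" "\<forall>\<^sub>F m in sequentially. x m < e / 3"
      using order_tendstoD(2)[OF r0, of "e / 3"] order_tendstoD(2)[OF x_lim, of "e / 3"] e by simp_all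
    then have "\<forall>\<^sub>F m in sequentially. r m < e / 3 \<and> x m < e / 3 \<and> m \<ge> m0"
      using eventually_ge_at_top[of m0] by eventually_elim auto
    then obtain m where m: "r m < e / 3" "x m < e / 3" "m \<ge> m0"
      unfolding eventually_sequentially by blast
    show "\<exists>d>0. \<forall>v'\<in>{0..<1}. dist v' v < d \<longrightarrow> dist (h v') (h v) < e"
    proof (intro exI conjI ballI impI)
      show "0 < 1 / (2 :: real) ^ m" by simp
      fix v' assume v': "v' \<in> {0..<1}" "dist v' v < 1 / 2 ^ m"
      have "\<bar>G m v - G m v'\<bar> \<le> x m"
      proof (cases "v \<le> v'")
        case True
        then show ?thesis using v'(2) by (intro near v v'(1) m(3)) (auto simp: dist_real_def)
      next
        case False
        then have "\<bar>G m v' - G m v\<bar> \<le> x m" using v'(2) by (intro near v v'(1) m(3)) (auto simp: dist_real_def)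
        then show ?thesis by (simp add: abs_minus_commute)
      qed
      then show "dist (h v') (h v) < e"
        using hr[OF v m(3)] hr[OF v'(1) m(3)] m(1,2) unfolding dist_real_def by linarith
    qed
  qed
  with h show ?thesis by blast
qed

text \<open>
The point is strictly above \<open>t\<close>, hence positive for positive \<open>t\<close> on every level; the dyadic point below
\<open>t\<close> may be 0, where the process is not defined.
\<close>
definition dyadic_above :: "nat \<Rightarrow> real \<Rightarrow> real" where
  "dyadic_above m t = real_of_int (\<lfloor>t * 2 ^ m\<rfloor> + 1) / 2 ^ m"

lemma dyadic_above_gt: "t < dyadic_above m t"
  unfolding dyadic_above_def by (simp add: less_divide_eq)

lemma dyadic_above_tendsto: "(\<lambda>m. dyadic_above m t) \<longlonglongrightarrow> t"
proof (rule tendsto_sandwich)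
  show "(\<lambda>_. t) \<longlonglongrightarrow> t" by simp
  show "(\<lambda>m. t + (1 / 2) ^ m) \<longlonglongrightarrow> t"
    using tendsto_add[OF tendsto_const LIMSEQ_power_zero[of "1 / 2 :: real"]] by simp
  show "\<forall>\<^sub>F m in sequentially. t \<le> dyadic_above m t"
    using dyadic_above_gt by (intro always_eventually allI less_imp_le)
  show "\<forall>\<^sub>F m in sequentially. dyadic_above m t \<le> t + (1 / 2) ^ m"
  proof (intro always_eventually allI)
    fix m
    have "real_of_int (\<lfloor>t * 2 ^ m\<rfloor> + 1) \<le> t * 2 ^ m + 1" by simp
    also have "\<dots> = (t + (1 / 2) ^ m) * 2 ^ m" by (simp add: algebra_simps power_one_over)
    finally show "dyadic_above m t \<le> t + (1 / 2) ^ m" unfolding dyadic_above_def by (simp add: divide_le_eq)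
  qed
qed

text \<open>
Every \<open>t > 0\<close> is an interior point of an interval \<open>[j / 2 ^ p, (j + 2) / 2 ^ p]\<close> with \<open>2 \<le> j\<close>, and on the
interior of such an interval \<open>grid_limit\<close> applies. The length of the interval is at most its left
endpoint, as the bound on level events requires.
\<close>
lemma dyadic_limit_continuous:
  fixes g :: "real \<Rightarrow> real"
  assumes good: "\<And>p j. 2 \<le> j \<Longrightarrow> \<exists>x m0. summable x \<and> (\<forall>m\<ge>m0. \<forall>k<2 ^ m.
      \<bar>g (real j / 2 ^ p + 2 / 2 ^ p * (real (Suc k) / 2 ^ m)) - g (real j / 2 ^ p + 2 / 2 ^ p * (real k / 2 ^ m))\<bar> \<le> x m)"
  shows "t > 0 \<Longrightarrow> convergent (\<lambda>m. g (dyadic_above m t))"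
    and "continuous_on {0<..} (\<lambda>t. lim (\<lambda>m. g (dyadic_above m t)))"
proof -
  let ?Z = "\<lambda>t. lim (\<lambda>m. g (dyadic_above m t))"
  have key: "convergent (\<lambda>m. g (dyadic_above m t)) \<and> isCont ?Z t" if t: "t > 0" for t
  proof -
    obtain p :: nat where p: "3 / t < 2 ^ p" using real_arch_pow[of 2 "3 / t"] by auto
    then have tp: "t * 2 ^ p > 3" using t by (simp add: divide_less_eq mult.commute)
    define j where "j = nat (\<lceil>t * 2 ^ p\<rceil> - 1)"
    have rj: "real j = real_of_int (\<lceil>t * 2 ^ p\<rceil> - 1)" using tp unfolding j_def by linarith
    have j: "2 \<le> j" "real j < t * 2 ^ p" "t * 2 ^ p < real j + 2"
      using tp rj by linarith+
    define c where "c = real j / 2 ^ p"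
    define L where "L = 2 / (2 :: real) ^ p"
    have L: "L > 0" by (simp add: L_def)
    define V where "V s = (s - c) / L" for s
    have ct: "c < t" "t < c + L" using j by (auto simp: c_def L_def field_simps)
    have VI: "V s \<in> {0..<1}" if "s \<in> {c<..<c + L}" for s using that L by (auto simp: V_def divide_less_eq)
    obtain x m0 where x: "summable x" "\<And>m k. m \<ge> m0 \<Longrightarrow> k < 2 ^ m \<Longrightarrow>
      \<bar>g (c + L * (real (Suc k) / 2 ^ m)) - g (c + L * (real k / 2 ^ m))\<bar> \<le> x m"
      using good[OF j(1), of p] unfolding c_def L_def by blast
    have "\<exists>h. (\<forall>v\<in>{0..<1}. (\<lambda>m. g (c + L * (real (Suc (nat \<lfloor>(v :: real) * 2 ^ m\<rfloor>)) / 2 ^ m))) \<longlonglongrightarrow> h v) \<and>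
        continuous_on {0..<1} h"
    proof (rule grid_limit[of m0 g c L x])
      show "\<bar>g (c + L * (real (Suc k) / 2 ^ m)) - g (c + L * (real k / 2 ^ m))\<bar> \<le> x m"
        if "m0 \<le> m" "k < 2 ^ m" for m k
        using that by (rule x(2))
    qed (rule x(1))
    then obtain h :: "real \<Rightarrow> real" where h: "\<And>v. v \<in> {0..<1} \<Longrightarrow> (\<lambda>m. g (c + L * (real (Suc (nat \<lfloor>v * 2 ^ m\<rfloor>)) / 2 ^ m))) \<longlonglongrightarrow> h v"
      and hc: "continuous_on {0..<1} h"
      by blast
    have lim: "(\<lambda>m. g (dyadic_above m s)) \<longlonglongrightarrow> h (V s)" if s: "s \<in> {c<..<c + L}" for s
    proof -
      have e: "c + L * (real (Suc (nat \<lfloor>V s * 2 ^ Suc l\<rfloor>)) / 2 ^ Suc l) = dyadic_above (l + p) s" for l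
      proof -
        have c': "c * 2 ^ (l + p) = real_of_int (int j * 2 ^ l)" by (simp add: c_def power_add)
        have "V s * 2 ^ Suc l = (s - c) * 2 ^ (l + p)" by (simp add: V_def L_def power_add)
        also have "\<dots> = s * 2 ^ (l + p) - real_of_int (int j * 2 ^ l)" by (simp only: left_diff_distrib c')
        finally have fl: "\<lfloor>V s * 2 ^ Suc l\<rfloor> = \<lfloor>s * 2 ^ (l + p)\<rfloor> - int j * 2 ^ l" by (simp only: floor_diff_of_int)
        have "0 \<le> \<lfloor>V s * 2 ^ Suc l\<rfloor>" using VI[OF s] by simp
        then have "real (Suc (nat \<lfloor>V s * 2 ^ Suc l\<rfloor>)) = real_of_int \<lfloor>s * 2 ^ (l + p)\<rfloor> - real j * 2 ^ l + 1"
          unfolding fl by simp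
        then have "c + L * (real (Suc (nat \<lfloor>V s * 2 ^ Suc l\<rfloor>)) / 2 ^ Suc l) =
            real j / 2 ^ p + 2 / 2 ^ p * ((real_of_int \<lfloor>s * 2 ^ (l + p)\<rfloor> - real j * 2 ^ l + 1) / 2 ^ Suc l)"
          by (simp only: c_def L_def)
        also have "\<dots> = dyadic_above (l + p) s"
          by (simp add: dyadic_above_def power_add field_simps)
        finally show ?thesis .
      qed
      have "(\<lambda>l. g (c + L * (real (Suc (nat \<lfloor>V s * 2 ^ Suc l\<rfloor>)) / 2 ^ Suc l))) \<longlonglongrightarrow> h (V s)"
        by (rule LIMSEQ_Suc[OF h[OF VI[OF s]]])
      then have "(\<lambda>l. g (dyadic_above (l + p) s)) \<longlonglongrightarrow> h (V s)" unfolding e .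
      then show ?thesis by (rule LIMSEQ_offset)
    qed
    have Zh: "?Z s = h (V s)" if "s \<in> {c<..<c + L}" for s using lim[OF that] by (rule limI)
    have "continuous_on {c<..<c + L} (\<lambda>s. h (V s))"
    proof (rule continuous_on_compose2[OF hc])
      show "continuous_on {c<..<c + L} V" unfolding V_def using L by (intro continuous_intros) auto
    qed (use VI in auto)
    then have "continuous_on {c<..<c + L} ?Z" by (subst continuous_on_cong[OF refl Zh]) auto
    then have "isCont ?Z t" using ct by (simp add: continuous_on_eq_continuous_at)
    moreover have "convergent (\<lambda>m. g (dyadic_above m t))" using lim[of t] ct by (auto intro: convergentI)
    ultimately show ?thesis by blast
  qed
  then show "t > 0 \<Longrightarrow> convergent (\<lambda>m. g (dyadic_above m t))" by blast
  show "continuous_on {0<..} ?Z" using key by (intro continuous_at_imp_continuous_on) auto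
qed

text \<open>
By the Borel--Cantelli lemma, almost surely only finitely many level events occur on each of the countably
many intervals of \<open>dyadic_limit_continuous\<close>. On this event the new process is the limit of the
old one along dyadic points, elsewhere it is 0. It has the right laws because the determinant depends continuously on
the times.
\<close>
lemma (in pos_concave) continuous_version:
  assumes X: "permanental_process M \<alpha> {0<..} (u_tilde f) X"
  shows "\<exists>Z. permanental_process M \<alpha> {0<..} (u_tilde f) Z \<and> continuous_paths_on M {0<..} Z"
proof -
  note XD = permanental_processD[OF X]
  interpret prob_space M by (rule XD(1))
  define c where "c p j = real j / (2 :: real) ^ p" for p j :: nat
  define L where "L p = 2 / (2 :: real) ^ p" for p :: nat
  define R where "R p j = 1 + f (c p j) / c p j" for p j
  define q where "q p j = 4 * R p j * sqrt (c p j * L p)" for p j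
  define E where "E p j m = level_event M X (c p j) (L p) m (q p j * sqrt_half ^ m * (real m + 0))" for p j m
  have L0: "0 < L p" for p by (simp add: L_def)
  have cL: "0 < c p j" "L p \<le> c p j" if "2 \<le> j" for p j using that by (auto simp: c_def L_def divide_right_mono)
  have Em: "E p j m \<in> sets M" "measure M (E p j m) \<le> 2 powr (\<alpha> + 1) * exp (- 0) * (2 / exp 1) ^ m" if j: "2 \<le> j" for p j m
  proof -
    have T: "c p j + L p * (real k / 2 ^ m) \<in> {0<..}" for k using cL(1)[OF j, of p] L0[of p] by (simp add: add_pos_nonneg)
    have R1: "1 + f (c p j) / c p j \<le> R p j" by (simp add: R_def)
    note b = level_event_bound[OF X cL(1)[OF j] L0 cL(2)[OF j] R1 T, where y = 0]
    show "E p j m \<in> sets M" using b(1) by (simp only: E_def q_def)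
    show "measure M (E p j m) \<le> 2 powr (\<alpha> + 1) * exp (- 0) * (2 / exp 1) ^ m" using b(2) by (simp only: E_def q_def)
  qed
  have evE: "AE \<omega> in M. eventually (\<lambda>m. \<omega> \<in> space M - E p j m) sequentially" if j: "2 \<le> j" for p j
  proof (rule borel_cantelli_AE1)
    have "summable (\<lambda>m. (2 / exp 1 :: real) ^ m)" using two_less_exp_1 by (intro summable_geometric) auto
    then have "summable (\<lambda>m. 2 powr (\<alpha> + 1) * exp (- 0) * (2 / exp 1 :: real) ^ m)" by (rule summable_mult)
    then show "summable (\<lambda>m. measure M (E p j m))"
      by (rule summable_comparison_test_ev[rotated]) (use Em(2)[OF j] in simp)
  qed (use Em[OF j] in \<open>auto simp: emeasure_eq_measure\<close>)
  define Good where "Good = {\<omega> \<in> space M. \<forall>p j. 2 \<le> j \<longrightarrow> (\<exists>m0. \<forall>m\<ge>m0. \<omega> \<notin> E p j m)}"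
  have GoodAE: "AE \<omega> in M. \<omega> \<in> Good"
  proof -
    have "AE \<omega> in M. \<forall>p j. 2 \<le> j \<longrightarrow> eventually (\<lambda>m. \<omega> \<in> space M - E p j m) sequentially"
      unfolding AE_all_countable using evE by (auto intro!: AE_impI)
    then show ?thesis
      using AE_space by eventually_elim (auto simp: Good_def eventually_sequentially)
  qed
  have [measurable]: "Good \<in> sets M"
  proof -
    have "Good = space M \<inter> (\<Inter>p. \<Inter>j\<in>{2..}. \<Union>m0. \<Inter>m\<in>{m0..}. space M - E p j m)"
      unfolding Good_def by fastforce
    also have "\<dots> \<in> sets M"
      using Em(1) by (intro sets.Int sets.top sets.countable_INT'' sets.countable_UN sets.countable_INT' image_subsetI) auto
    finally show ?thesis .
  qed
  define Z where "Z t \<omega> = (if \<omega> \<in> Good then lim (\<lambda>m. X (dyadic_above m t) \<omega>) else 0)" for t \<omega>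
  have da0: "0 < dyadic_above m t" if "0 < t" for m t using dyadic_above_gt[of t m] that by linarith
  have good: "\<exists>x m0. summable x \<and> (\<forall>m\<ge>m0. \<forall>k<2 ^ m.
      \<bar>X (real j / 2 ^ p + 2 / 2 ^ p * (real (Suc k) / 2 ^ m)) \<omega> - X (real j / 2 ^ p + 2 / 2 ^ p * (real k / 2 ^ m)) \<omega>\<bar> \<le> x m)"
    if \<omega>: "\<omega> \<in> Good" and j: "2 \<le> j" for \<omega> p j
  proof -
    obtain m0 where m0: "\<And>m. m \<ge> m0 \<Longrightarrow> \<omega> \<notin> E p j m" using \<omega> j unfolding Good_def by blast
    have sp: "\<omega> \<in> space M" using \<omega> by (simp add: Good_def)
    have q0: "q p j \<ge> 0"
      using cL(1)[OF j, of p] positive_f[of "c p j"] L0[of p] unfolding q_def R_def by simp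
    let ?x = "\<lambda>m. q p j * sqrt_half ^ m * (real m + 0)"
    have "summable ?x" by (rule chain_const_sum(1)[OF q0]) simp
    moreover have "\<bar>X (c p j + L p * (real (Suc k) / 2 ^ m)) \<omega> - X (c p j + L p * (real k / 2 ^ m)) \<omega>\<bar> \<le> ?x m"
      if m: "m \<ge> m0" and k: "k < 2 ^ m" for m k
    proof (rule ccontr)
      assume "\<not> ?thesis"
      then have "?x m \<le> \<bar>X (c p j + L p * (real (Suc k) / 2 ^ m)) \<omega> - X (c p j + L p * (real k / 2 ^ m)) \<omega>\<bar>" by linarith
      then have "\<omega> \<in> E p j m" unfolding E_def level_event_def using sp k by blast
      then show False using m0[OF m] by blast
    qed
    ultimately show ?thesis unfolding c_def L_def by blast
  qed
  have conv: "(\<lambda>m. X (dyadic_above m t) \<omega>) \<longlonglongrightarrow> Z t \<omega>" if \<omega>: "\<omega> \<in> Good" and t: "t > 0" for \<omega> t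
    using dyadic_limit_continuous(1)[OF good[OF \<omega>] t] \<omega> by (simp add: Z_def convergent_LIMSEQ_iff)
  have Zc: "continuous_on {0<..} (\<lambda>t. Z t \<omega>)" for \<omega>
  proof (cases "\<omega> \<in> Good")
    case True
    then show ?thesis using dyadic_limit_continuous(2)[OF good[OF True]] by (simp add: Z_def)
  qed (simp add: Z_def)
  have Xm: "X (dyadic_above m t) \<in> borel_measurable M" if "t > 0" for m t using XD(3) da0[OF that] by simp
  have Zm: "Z t \<in> borel_measurable M" if "t > 0" for t
  proof -
    have [measurable]: "(\<lambda>\<omega>. lim (\<lambda>m. X (dyadic_above m t) \<omega>)) \<in> borel_measurable M"
      by (rule borel_measurable_lim_metric) (rule Xm[OF that])
    show ?thesis unfolding Z_def[abs_def] by measurable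
  qed
  have Z0: "0 \<le> Z t \<omega>" if t: "t > 0" and \<omega>: "\<omega> \<in> space M" for t \<omega>
  proof (cases "\<omega> \<in> Good")
    case True
    show ?thesis
      by (rule LIMSEQ_le_const[OF conv[OF True t]]) (use XD(4) \<omega> da0[OF t] in auto)
  qed (simp add: Z_def)
  have lap: "(\<integral>\<omega>. exp (- (\<Sum>i<n. s i * Z (t i) \<omega>)) \<partial>M) =
      Determinant.det (1\<^sub>m n + Matrix.mat n n (\<lambda>(i, j). u_tilde f (t i) (t j)) * mat_diag n s) powr (- \<alpha>)"
    if t: "\<forall>i<n. t i \<in> {0<..}" and s: "\<forall>i<n. s i > 0" for n t s
  proof -
    let ?t = "\<lambda>m i. dyadic_above m (t i)"
    let ?K = "\<lambda>t. kernel_det n t s (\<lambda>j. f (t j) * s j)"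
    have tT: "?t m i \<in> {0<..}" if "i < n" for m i using t that da0 by auto
    have [measurable]: "X (?t m i) \<in> borel_measurable M" "Z (t i) \<in> borel_measurable M" if "i \<in> {..<n}" for m i
      using t that by (auto intro: Xm Zm)
    have l: "(\<integral>\<omega>. exp (- (\<Sum>i<n. s i * X (?t m i) \<omega>)) \<partial>M) = ?K (?t m) powr (- \<alpha>)" for m
      using XD(5)[of n "?t m" s] tT s by (simp add: det_u_tilde_kernel)
    have "(\<lambda>m. \<integral>\<omega>. exp (- (\<Sum>i<n. s i * X (?t m i) \<omega>)) \<partial>M) \<longlonglongrightarrow> (\<integral>\<omega>. exp (- (\<Sum>i<n. s i * Z (t i) \<omega>)) \<partial>M)"
    proof (rule integral_dominated_convergence[where w = "\<lambda>_. 1"])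
      show "AE \<omega> in M. (\<lambda>m. exp (- (\<Sum>i<n. s i * X (?t m i) \<omega>))) \<longlonglongrightarrow> exp (- (\<Sum>i<n. s i * Z (t i) \<omega>))"
        using GoodAE by eventually_elim (intro tendsto_intros conv, use t in auto)
      have "0 \<le> (\<Sum>i<n. s i * X (?t m i) \<omega>)" if "\<omega> \<in> space M" for m \<omega>
      proof (intro sum_nonneg mult_nonneg_nonneg)
        fix i assume "i \<in> {..<n}"
        then show "0 \<le> s i" "0 \<le> X (?t m i) \<omega>" using s XD(4)[OF tT[of i m] that] by (auto simp: less_imp_le)
      qed
      then show "AE \<omega> in M. norm (exp (- (\<Sum>i<n. s i * X (?t m i) \<omega>))) \<le> 1" for m by (intro AE_I2) simp
    qed auto
    then have lim1: "(\<lambda>m. ?K (?t m) powr (- \<alpha>)) \<longlonglongrightarrow> (\<integral>\<omega>. exp (- (\<Sum>i<n. s i * Z (t i) \<omega>)) \<partial>M)"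
      unfolding l .
    have "(\<lambda>m. f (?t m i)) \<longlonglongrightarrow> f (t i)" if "i < n" for i
      by (rule continuous_on_tendsto_compose[OF f_continuous dyadic_above_tendsto]) (use t tT that in auto)
    then have "(\<lambda>m. ?K (?t m)) \<longlonglongrightarrow> ?K t"
      by (intro kernel_det_tendsto tendsto_mult tendsto_const dyadic_above_tendsto)
    \<comment> \<open>Otherwise the value of \<open>powr\<close> at base 0 would make the expectation of a positive variable vanish.\<close>
    moreover have "?K t \<noteq> 0"
    proof
      assume 0: "?K t = 0"
      have [measurable]: "X (t i) \<in> borel_measurable M" if "i \<in> {..<n}" for i using t that XD(3) by auto
      have "(\<integral>\<omega>. exp (- (\<Sum>i<n. s i * X (t i) \<omega>)) \<partial>M) = ?K t powr (- \<alpha>)"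
        using XD(5)[of n t s] t s by (simp add: det_u_tilde_kernel)
      then have I0: "(\<integral>\<omega>. exp (- (\<Sum>i<n. s i * X (t i) \<omega>)) \<partial>M) = 0" using 0 by simp
      have p: "0 \<le> (\<Sum>i<n. s i * X (t i) \<omega>)" if "\<omega> \<in> space M" for \<omega>
      proof (intro sum_nonneg mult_nonneg_nonneg)
        fix i assume "i \<in> {..<n}"
        then show "0 \<le> s i" "0 \<le> X (t i) \<omega>" using s t XD(4)[of "t i", OF _ that] by (simp_all add: less_imp_le)
      qed
      have "integrable M (\<lambda>\<omega>. exp (- (\<Sum>i<n. s i * X (t i) \<omega>)))"
        using p by (intro integrable_const_bound[where B = 1] AE_I2) auto
      then have "AE \<omega> in M. exp (- (\<Sum>i<n. s i * X (t i) \<omega>)) = 0"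
        using I0 by (subst (asm) integral_nonneg_eq_0_iff_AE) auto
      then have "AE \<omega> in M. False" by eventually_elim simp
      then show False by simp
    qed
    ultimately have "(\<lambda>m. ?K (?t m) powr (- \<alpha>)) \<longlonglongrightarrow> ?K t powr (- \<alpha>)"
      by (intro tendsto_powr tendsto_const)
    with lim1 have "(\<integral>\<omega>. exp (- (\<Sum>i<n. s i * Z (t i) \<omega>)) \<partial>M) = ?K t powr (- \<alpha>)"
      by (rule LIMSEQ_unique)
    then show ?thesis by (simp add: det_u_tilde_kernel)
  qed
  have "permanental_process M \<alpha> {0<..} (u_tilde f) Z"
    unfolding permanental_process_def permanental_vector_def
    using prob_space_axioms XD(2) Zm Z0 lap by auto
  moreover have "continuous_paths_on M {0<..} Z" unfolding continuous_paths_on_def using Zc by blast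
  ultimately show ?thesis by blast
qed

section \<open>Sublinearity of potentials, and the theorem\<close>

lemma (in pos_concave) ratio_converges: "\<exists>C. ((\<lambda>t. f t / t) \<longlongrightarrow> C) at_top"
proof -
  define C where "C = Inf ((\<lambda>t. f t / t) ` {0<..})"
  have pos: "0 \<le> f t / t" if "t > 0" for t using positive_f[OF that] that by simp
  have bdd: "bdd_below ((\<lambda>t. f t / t) ` {0<..})" using pos by (intro bdd_belowI[of _ 0]) auto
  have lower: "C \<le> f t / t" if "t > 0" for t unfolding C_def using that by (intro cInf_lower[OF _ bdd]) auto
  have "((\<lambda>t. f t / t) \<longlongrightarrow> C) at_top"
  proof (rule order_tendstoI)
    fix x assume x: "x < C"
    show "\<forall>\<^sub>F t in at_top. x < f t / t"
      using eventually_gt_at_top[of 0]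
    proof eventually_elim
      case (elim t)
      then show ?case using lower[of t] x by linarith
    qed
  next
    fix x assume "C < x"
    then obtain t0 where t0: "t0 > 0" "f t0 / t0 < x"
      unfolding C_def using cInf_less_iff[OF _ bdd, of x] by auto
    show "\<forall>\<^sub>F t in at_top. f t / t < x"
      using eventually_ge_at_top[of t0]
    proof eventually_elim
      case (elim t)
      then show ?case using ratio_antimono[OF t0(1) elim] t0(2) by linarith
    qed
  qed
  then show ?thesis ..
qed

text \<open>
\<open>f t / t\<close> is the integral of \<open>2 min 1 (y / t) h y\<close>, dominated by \<open>2 h\<close>.
\<close>
lemma potential_sublinear:
  assumes h: "h \<in> L1_plus" and f: "is_potential_of f h"
  shows "((\<lambda>t. f t / t) \<longlongrightarrow> 0) at_top"
proof -
  have hi: "integrable lebesgue (\<lambda>y. indicator {0<..} y * h y)"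
    using h by (simp add: L1_plus_def set_integrable_def)
  have hm: "(\<lambda>y. indicator {0<..} y * h y) \<in> borel_measurable lebesgue" using hi by (rule borel_measurable_integrable)
  have h0: "0 \<le> indicator {0<..} y * h y" for y using h by (auto simp: L1_plus_def indicator_def)
  define g where "g t y = 2 * min t y / t * (indicator {0<..} y * h y)" for t y :: real
  have "((\<lambda>t. \<integral>y. g t y \<partial>lebesgue) \<longlongrightarrow> (\<integral>y. 0 \<partial>(lebesgue :: real measure))) at_top"
  proof (rule integral_dominated_convergence_at_top[where s = g and f = "\<lambda>_. 0" and w = "\<lambda>y. 2 * (indicator {0<..} y * h y)"])
    show "g t \<in> borel_measurable lebesgue" for t
    proof -
      have "(\<lambda>y. 2 * min t y / t) \<in> borel_measurable lebesgue"
        by (intro measurable_completion) measurable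
      then show ?thesis unfolding g_def using hm by (rule borel_measurable_times)
    qed
    show "integrable lebesgue (\<lambda>y. 2 * (indicator {0<..} y * h y))" using hi by simp
    show "\<forall>\<^sub>F t in at_top. AE y in lebesgue. norm (g t y) \<le> 2 * (indicator {0<..} y * h y)"
      using eventually_gt_at_top[of 0]
    proof eventually_elim
      case (elim t)
      have "norm (g t y) \<le> 2 * (indicator {0<..} y * h y)" for y
      proof (cases "y > 0")
        case True
        have "0 \<le> 2 * min t y / t" "2 * min t y / t \<le> 2" using elim True by (auto simp: field_simps)
        then have "\<bar>2 * min t y / t\<bar> * (indicator {0<..} y * h y) \<le> 2 * (indicator {0<..} y * h y)"
          using h0[of y] by (intro mult_right_mono) auto
        moreover have "\<bar>indicator {0<..} y * h y\<bar> = indicator {0<..} y * h y" using h0[of y] by (rule abs_of_nonneg)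
        ultimately show ?thesis unfolding g_def real_norm_def by (simp only: abs_mult)
      qed (simp add: g_def)
      then show ?case by simp
    qed
    show "AE y in lebesgue. ((\<lambda>t. g t y) \<longlongrightarrow> 0) at_top"
    proof (intro AE_I2)
      fix y :: real
      have "((\<lambda>t. 2 * y / t * (indicator {0<..} y * h y)) \<longlongrightarrow> 0 * (indicator {0<..} y * h y)) at_top"
        by (intro tendsto_mult tendsto_const tendsto_divide_0[OF tendsto_const] filterlim_at_top_imp_at_infinity filterlim_ident)
      moreover have "\<forall>\<^sub>F t in at_top. 2 * y / t * (indicator {0<..} y * h y) = g t y"
        using eventually_ge_at_top[of y] by eventually_elim (simp add: g_def min_def)
      ultimately show "((\<lambda>t. g t y) \<longlongrightarrow> 0) at_top" by (simp add: tendsto_cong)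
    qed
  qed simp
  moreover have "\<forall>\<^sub>F t in at_top. (\<integral>y. g t y \<partial>lebesgue) = f t / t"
    using eventually_gt_at_top[of 0]
  proof eventually_elim
    case (elim t)
    have "f t / t = (\<integral>y. indicator {0<..} y *\<^sub>R (2 * min t y * h y) \<partial>lebesgue) / t"
      using f elim by (simp add: is_potential_of_def killed_BM_potential_density_def set_lebesgue_integral_def)
    also have "\<dots> = (\<integral>y. indicator {0<..} y *\<^sub>R (2 * min t y * h y) / t \<partial>lebesgue)" by simp
    also have "\<dots> = (\<integral>y. g t y \<partial>lebesgue)" by (intro Bochner_Integration.integral_cong) (auto simp: g_def)
    finally show ?case by simp
  qed
  ultimately show ?thesis by (simp add: tendsto_cong)
qed

theorem theorem1p12:
  fixes f :: "real \<Rightarrow> real" and \<alpha> :: real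
  assumes f_pos: "\<And>t. t > 0 \<Longrightarrow> f t > 0"
    and f_concave: "concave_on {0<..} f"
    and alpha_pos: "\<alpha> > 0"
  shows
    "(\<exists>(M :: (real \<Rightarrow> real) measure) Z.
        permanental_process M \<alpha> {0<..} (u_tilde f) Z \<and> continuous_paths_on M {0<..} Z)
   \<and> (\<exists>C\<^sub>0 :: real. ((\<lambda>t. f t / t) \<longlongrightarrow> C\<^sub>0) at_top \<and>
        (\<forall>(M :: 'w measure) Z.
           permanental_process M \<alpha> {0<..} (u_tilde f) Z \<and> continuous_paths_on M {0<..} Z \<longrightarrow>
           (AE \<omega> in M. 1 \<le> limsup_ratio Z \<omega> \<and> limsup_ratio Z \<omega> \<le> ereal (1 + C\<^sub>0))))
   \<and> ((\<exists>h\<in>L1_plus. is_potential_of f h) \<longrightarrow>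
        f \<in> o[at_top](\<lambda>t. t) \<and>
        (\<forall>(M :: 'w measure) Z.
           permanental_process M \<alpha> {0<..} (u_tilde f) Z \<and> continuous_paths_on M {0<..} Z \<longrightarrow>
           (AE \<omega> in M. limsup_ratio Z \<omega> = 1)))"
proof -
  interpret pos_concave f
    using f_pos f_concave by unfold_locales
  have two_sided: "AE \<omega> in M. 1 \<le> limsup_ratio Z \<omega> \<and> limsup_ratio Z \<omega> \<le> ereal (1 + C)"
    if C: "((\<lambda>t. f t / t) \<longlongrightarrow> C) at_top"
      and Z: "permanental_process M \<alpha> {0<..} (u_tilde f) Z \<and> continuous_paths_on M {0<..} Z"
    for C and M :: "'w measure" and Z
    using limsup_lower[OF conjunct1[OF Z]] limsup_upper[OF conjunct1[OF Z] conjunct2[OF Z] C]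
    by eventually_elim (rule conjI)
  show ?thesis
  proof (intro conjI impI)
    show "\<exists>(M :: (real \<Rightarrow> real) measure) Z.
        permanental_process M \<alpha> {0<..} (u_tilde f) Z \<and> continuous_paths_on M {0<..} Z"
      using permanental_process_exists[OF alpha_pos] continuous_version by blast
  next
    obtain C where C: "((\<lambda>t. f t / t) \<longlongrightarrow> C) at_top" using ratio_converges by blast
    show "\<exists>C\<^sub>0 :: real. ((\<lambda>t. f t / t) \<longlongrightarrow> C\<^sub>0) at_top \<and>
        (\<forall>(M :: 'w measure) Z.
           permanental_process M \<alpha> {0<..} (u_tilde f) Z \<and> continuous_paths_on M {0<..} Z \<longrightarrow>
           (AE \<omega> in M. 1 \<le> limsup_ratio Z \<omega> \<and> limsup_ratio Z \<omega> \<le> ereal (1 + C\<^sub>0)))"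
      using C two_sided[OF C] by blast
  next
    assume "\<exists>h\<in>L1_plus. is_potential_of f h"
    then have zero: "((\<lambda>t. f t / t) \<longlongrightarrow> 0) at_top" using potential_sublinear by blast
    show "f \<in> o[at_top](\<lambda>t. t)"
      by (rule smalloI_tendsto[OF zero eventually_mono[OF eventually_gt_at_top[of 0]]]) simp
    show "\<forall>(M :: 'w measure) Z.
           permanental_process M \<alpha> {0<..} (u_tilde f) Z \<and> continuous_paths_on M {0<..} Z \<longrightarrow>
           (AE \<omega> in M. limsup_ratio Z \<omega> = 1)"
    proof (intro allI impI)
      fix M :: "'w measure" and Z
      assume "permanental_process M \<alpha> {0<..} (u_tilde f) Z \<and> continuous_paths_on M {0<..} Z"
      from two_sided[OF zero this] show "AE \<omega> in M. limsup_ratio Z \<omega> = 1"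
        by eventually_elim (simp add: one_ereal_def[symmetric] order_antisym)
    qed
  qed
qed

end
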